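(* Let $(M,J)$ be a compact complex manifold and let $g(t)$, $t\in[0,\tau)$, be a solution of the HCF on $M$. If the Chern curvature $\Omega^{g(0)}$ is Griffiths non-negative, then $\Omega^{g(t)}$ is Griffiths non-negative for all $t\in(0,\tau)$.
   Context: Einstein summation is used. Hermitian metric: a $J$-invariant Riemannian metric $g$, with components $g_{i\bar j}$ on $T^{1,0}M$ and inverse $g^{i\bar j}$. In holomorphic coordinates the torsion of the Chern connection is $T_{ij}^k=g^{k\bar l}(\partial_i g_{j\bar l}-\partial_j g_{i\bar l})$, with $T_{ij\bar l}=T_{ij}^kg_{k\bar l}$, $T_{\bar i\bar j l}=\overline{T_{ij\bar l}}$, and the Chern curvature is $\Omega_{i\bar jk\bar l}=-\partial_i\partial_{\bar j}g_{k\bar l}+g^{p\bar s}\partial_{\bar j}g_{p\bar l}\,\partial_ig_{k\bar s}$. HCF: $\partial_t g_{i\bar j}=-S^{(2)}_{i\bar j}-Q_{i\bar j}$ for a smooth family of Hermitian metrics $g(t)$, where $S^{(2)}_{i\bar j}=g^{m\bar n}\Omega_{m\bar ni\bar j}$ and $Q_{i\bar j}=\frac12 g^{m\bar n}g^{p\bar s}T_{mp\bar j}T_{\bar n\bar s i}$. The Chern curvature is Griffiths non-negative if $\Omega(\xi,\bar\xi,\eta,\bar\eta)=\Omega_{i\bar jk\bar l}\xi^i\overline{\xi^j}\eta^k\overline{\eta^l}\ge0$ for all $m\in M$ and $\xi,\eta\in T^{1,0}_mM$. *)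

theory Defs
  imports "HOL-Analysis.Analysis"
begin

section \<open>Smooth and holomorphic maps\<close>

text \<open>
  The derivatives are taken within \<open>S\<close>. Below, \<open>S\<close> is either open or the product of an open set
  with a half-open interval \<open>[0, \<tau>)\<close>, where Frechet derivatives within \<open>S\<close> are unique;
  at the boundary \<open>t = 0\<close> they are one-sided in the last variable.
\<close>

primrec Ck_on ::
    "nat \<Rightarrow> 'e::real_normed_vector set \<Rightarrow> ('e \<Rightarrow> 'f::real_normed_vector) \<Rightarrow> bool" where
  "Ck_on 0 S f \<longleftrightarrow> continuous_on S f"
| "Ck_on (Suc k) S f \<longleftrightarrow>
     f differentiable_on S \<and> (\<forall>v. Ck_on k S (\<lambda>x. frechet_derivative f (at x within S) v))"

definition smooth_on :: "'e::real_normed_vector set \<Rightarrow> ('e \<Rightarrow> 'f::real_normed_vector) \<Rightarrow> bool" where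
  "smooth_on S f \<longleftrightarrow> (\<forall>k. Ck_on k S f)"

definition Jst :: "complex^'n \<Rightarrow> complex^'n" where
  "Jst v = \<i> *s v"

definition holomorphic_map_on ::
    "(complex^'n::finite \<Rightarrow> complex^'m::finite) \<Rightarrow> (complex^'n) set \<Rightarrow> bool" where
  "holomorphic_map_on f S \<longleftrightarrow>
     (\<forall>z\<in>S. \<exists>D. (f has_derivative D) (at z) \<and> (\<forall>v. D (Jst v) = Jst (D v)))"


section \<open>Complex manifolds\<close>

type_synonym ('a, 'n) chart = "'a set \<times> ('a \<Rightarrow> complex^'n)"

abbreviation dom_of :: "('a, 'n::finite) chart \<Rightarrow> 'a set" where
  "dom_of c \<equiv> fst c"

abbreviation coord :: "('a, 'n::finite) chart \<Rightarrow> 'a \<Rightarrow> complex^'n" where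
  "coord c \<equiv> snd c"

definition chart_inv :: "('a, 'n::finite) chart \<Rightarrow> complex^'n \<Rightarrow> 'a" where
  "chart_inv c = inv_into (dom_of c) (coord c)"

definition is_chart :: "('a::topological_space, 'n::finite) chart \<Rightarrow> bool" where
  "is_chart c \<longleftrightarrow> open (dom_of c) \<and> open (coord c ` dom_of c) \<and>
     homeomorphism (dom_of c) (coord c ` dom_of c) (coord c) (chart_inv c)"

definition transition ::
    "('a, 'n::finite) chart \<Rightarrow> ('a, 'n) chart \<Rightarrow> complex^'n \<Rightarrow> complex^'n" where
  "transition c c' = coord c' \<circ> chart_inv c"

definition complex_atlas :: "('a::topological_space, 'n::finite) chart set \<Rightarrow> bool" where
  "complex_atlas A \<longleftrightarrow>
     (\<forall>c\<in>A. is_chart c) \<and>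
     (\<Union>c\<in>A. dom_of c) = UNIV \<and>
     (\<forall>c\<in>A. \<forall>c'\<in>A. holomorphic_map_on (transition c c') (coord c ` (dom_of c \<inter> dom_of c')))"


section \<open>Hermitian metrics\<close>

text \<open>
  A field of real bilinear forms on the tangent spaces is represented by its expressions in all
  charts of the atlas: \<open>g c p v w\<close> is the value at \<open>p\<close> on the real tangent vectors whose coordinate
  expressions in the chart \<open>c\<close> are \<open>v\<close> and \<open>w\<close>. In each chart \<open>J\<close> is \<open>Jst\<close>.
  Only values with \<open>c\<close> in the atlas and \<open>p\<close> in the domain of \<open>c\<close> are meaningful.
\<close>

type_synonym ('a, 'n) form_field =
  "('a, 'n) chart \<Rightarrow> 'a \<Rightarrow> complex^'n \<Rightarrow> complex^'n \<Rightarrow> real"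

definition hermitian_metric ::
    "('a::topological_space, 'n::finite) chart set \<Rightarrow> ('a, 'n) form_field \<Rightarrow> bool" where
  "hermitian_metric A g \<longleftrightarrow>
     (\<forall>c\<in>A. \<forall>p\<in>dom_of c.
        bilinear (g c p) \<and>
        (\<forall>v w. g c p v w = g c p w v) \<and>
        (\<forall>v. v \<noteq> 0 \<longrightarrow> 0 < g c p v v) \<and>
        (\<forall>v w. g c p (Jst v) (Jst w) = g c p v w)) \<and>
     (\<forall>c\<in>A. \<forall>c'\<in>A. \<forall>p\<in>dom_of c \<inter> dom_of c'. \<forall>v w.
        g c p v w =
          (let D = frechet_derivative (transition c c') (at (coord c p))
           in g c' p (D v) (D w))) \<and>
     (\<forall>c\<in>A. \<forall>v w. smooth_on (coord c ` dom_of c) (\<lambda>z. g c (chart_inv c z) v w))"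

text \<open>
  The component of index \<open>i\<close> and barred index \<open>j\<close>: the complex bilinear extension of a real bilinear form \<open>b\<close>, evaluated at
  \<open>\<partial>/\<partial>z\<^sup>i = (e\<^sub>i - \<i> J e\<^sub>i) / 2\<close> and \<open>\<partial>/\<partial>(cnj z\<^sup>j) = (e\<^sub>j + \<i> J e\<^sub>j) / 2\<close>.
\<close>

definition herm_comp ::
    "(complex^'n \<Rightarrow> complex^'n \<Rightarrow> real) \<Rightarrow> 'n::finite \<Rightarrow> 'n \<Rightarrow> complex" where
  "herm_comp b i j =
     (let e = (\<lambda>k. axis k 1 :: complex^'n)
      in (complex_of_real (b (e i) (e j)) + complex_of_real (b (Jst (e i)) (Jst (e j)))
          + \<i> * (complex_of_real (b (e i) (Jst (e j))) - complex_of_real (b (Jst (e i)) (e j)))) / 4)"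

definition metric_matrix ::
    "('a, 'n::finite) form_field \<Rightarrow> ('a, 'n) chart \<Rightarrow> complex^'n \<Rightarrow> complex^'n^'n" where
  "metric_matrix g c z = (\<chi> i j. herm_comp (g c (chart_inv c z)) i j)"


section \<open>Chern torsion and curvature in holomorphic coordinates\<close>

definition wirt :: "'n::finite \<Rightarrow> (complex^'n \<Rightarrow> complex) \<Rightarrow> complex^'n \<Rightarrow> complex" where
  "wirt i f z = (frechet_derivative f (at z) (axis i 1)
                 - \<i> * frechet_derivative f (at z) (Jst (axis i 1))) / 2"

definition wirt_bar :: "'n::finite \<Rightarrow> (complex^'n \<Rightarrow> complex) \<Rightarrow> complex^'n \<Rightarrow> complex" where
  "wirt_bar i f z = (frechet_derivative f (at z) (axis i 1)
                     + \<i> * frechet_derivative f (at z) (Jst (axis i 1))) / 2"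

text \<open>
  In the following, \<open>h\<close> is the coordinate expression of the metric, \<open>h z $ i $ j\<close>
  being its component of index \<open>i\<close> and barred index \<open>j\<close> at \<open>z\<close>.
  A bar over an index is not visible in the names: the positions of the barred indices are
  the second one of \<open>met_inv\<close>, the last one of \<open>torsion_low\<close>, the first two of \<open>torsion_low_bar\<close>,
  and the second and fourth ones of \<open>chern_curv\<close>.

  The inverse is normalised by \<open>g\<^sup>k\<^sup>m g\<^sub>k\<^sub>l = \<delta>\<^sup>m\<^sub>l\<close> (\<open>m\<close> and \<open>l\<close> barred), so it is the transpose
  of the inverse matrix.
\<close>

definition met_inv :: "complex^'n^'n \<Rightarrow> 'n::finite \<Rightarrow> 'n \<Rightarrow> complex" where
  "met_inv H k l = matrix_inv H $ l $ k"

definition torsion ::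
    "(complex^'n \<Rightarrow> complex^'n^'n) \<Rightarrow> complex^'n \<Rightarrow> 'n::finite \<Rightarrow> 'n \<Rightarrow> 'n \<Rightarrow> complex" where
  "torsion h z i j k =
     (\<Sum>l\<in>UNIV. met_inv (h z) k l *
        (wirt i (\<lambda>x. h x $ j $ l) z - wirt j (\<lambda>x. h x $ i $ l) z))"

definition torsion_low ::
    "(complex^'n \<Rightarrow> complex^'n^'n) \<Rightarrow> complex^'n \<Rightarrow> 'n::finite \<Rightarrow> 'n \<Rightarrow> 'n \<Rightarrow> complex" where
  "torsion_low h z i j l = (\<Sum>k\<in>UNIV. torsion h z i j k * h z $ k $ l)"

definition torsion_low_bar ::
    "(complex^'n \<Rightarrow> complex^'n^'n) \<Rightarrow> complex^'n \<Rightarrow> 'n::finite \<Rightarrow> 'n \<Rightarrow> 'n \<Rightarrow> complex" where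
  "torsion_low_bar h z i j l = cnj (torsion_low h z i j l)"

definition chern_curv ::
    "(complex^'n \<Rightarrow> complex^'n^'n) \<Rightarrow> complex^'n \<Rightarrow> 'n::finite \<Rightarrow> 'n \<Rightarrow> 'n \<Rightarrow> 'n \<Rightarrow> complex" where
  "chern_curv h z i j k l =
     - wirt i (wirt_bar j (\<lambda>x. h x $ k $ l)) z
     + (\<Sum>p\<in>UNIV. \<Sum>s\<in>UNIV. met_inv (h z) p s *
          wirt_bar j (\<lambda>x. h x $ p $ l) z * wirt i (\<lambda>x. h x $ k $ s) z)"

definition S2 ::
    "(complex^'n \<Rightarrow> complex^'n^'n) \<Rightarrow> complex^'n \<Rightarrow> 'n::finite \<Rightarrow> 'n \<Rightarrow> complex" where
  "S2 h z i j = (\<Sum>m\<in>UNIV. \<Sum>n\<in>UNIV. met_inv (h z) m n * chern_curv h z m n i j)"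

definition Qtor ::
    "(complex^'n \<Rightarrow> complex^'n^'n) \<Rightarrow> complex^'n \<Rightarrow> 'n::finite \<Rightarrow> 'n \<Rightarrow> complex" where
  "Qtor h z i j = 1 / 2 *
     (\<Sum>m\<in>UNIV. \<Sum>n\<in>UNIV. \<Sum>p\<in>UNIV. \<Sum>s\<in>UNIV.
        met_inv (h z) m n * met_inv (h z) p s * torsion_low h z m p j * torsion_low_bar h z n s i)"

definition griffiths_nonneg ::
    "('a, 'n::finite) chart set \<Rightarrow> ('a, 'n) form_field \<Rightarrow> bool" where
  "griffiths_nonneg A g \<longleftrightarrow>
     (\<forall>c\<in>A. \<forall>p\<in>dom_of c. \<forall>\<xi> \<eta> :: complex^'n.
        (\<Sum>i\<in>UNIV. \<Sum>j\<in>UNIV. \<Sum>k\<in>UNIV. \<Sum>l\<in>UNIV.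
           chern_curv (metric_matrix g c) (coord c p) i j k l *
             (\<xi> $ i) * cnj (\<xi> $ j) * (\<eta> $ k) * cnj (\<eta> $ l)) \<in> \<real>\<^sub>\<ge>\<^sub>0)"


section \<open>The Hermitian curvature flow\<close>

definition time_int :: "ereal \<Rightarrow> real set" where
  "time_int \<tau> = {t. 0 \<le> t \<and> ereal t < \<tau>}"

definition smooth_metric_family ::
    "('a::topological_space, 'n::finite) chart set \<Rightarrow> ereal \<Rightarrow> (real \<Rightarrow> ('a, 'n) form_field) \<Rightarrow> bool"
where
  "smooth_metric_family A \<tau> g \<longleftrightarrow>
     (\<forall>t\<in>time_int \<tau>. hermitian_metric A (g t)) \<and>
     (\<forall>c\<in>A. \<forall>v w. smooth_on ((coord c ` dom_of c) \<times> time_int \<tau>)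
        (\<lambda>(z, t). g t c (chart_inv c z) v w))"

definition HCF_solution ::
    "('a::topological_space, 'n::finite) chart set \<Rightarrow> ereal \<Rightarrow> (real \<Rightarrow> ('a, 'n) form_field) \<Rightarrow> bool"
where
  "HCF_solution A \<tau> g \<longleftrightarrow>
     smooth_metric_family A \<tau> g \<and>
     (\<forall>t\<in>time_int \<tau>. \<forall>c\<in>A. \<forall>p\<in>dom_of c. \<forall>i j.
        ((\<lambda>s. herm_comp (g s c p) i j) has_vector_derivative
           (- S2 (metric_matrix (g t) c) (coord c p) i j
            - Qtor (metric_matrix (g t) c) (coord c p) i j))
          (at t within time_int \<tau>))"

end

theory Submission
  imports Defs "HOL-Complex_Analysis.Cauchy_Integral_Formula"
begin

text \<open>
  In terms of the inverse metric the flow reads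
  \<open>\<partial>\<^sub>t h\<^sup>k\<^sup>l = h\<^sup>m\<^sup>n \<partial>\<^sub>m\<partial>\<^sub>n h\<^sup>k\<^sup>l - \<partial>\<^sub>m h\<^sup>k\<^sup>n \<partial>\<^sub>n h\<^sup>m\<^sup>l\<close> (\<open>n\<close> and \<open>l\<close> barred). Hence the function
  \<open>u (z, \<alpha>) = h\<^sup>k\<^sup>l \<alpha>\<^sub>k cnj \<alpha>\<^sub>l\<close> on the cotangent bundle satisfies
  \<open>\<partial>\<^sub>t u = 1/2 J\<^sup>A\<^sup>B J\<^sup>C\<^sup>D u\<^sub>A\<^sub>C u\<^sub>B\<^sub>D\<close>, where \<open>u\<^sub>A\<^sub>C\<close> is the complex Hessian and \<open>J\<close> the canonical
  holomorphic symplectic form. Completing a square identifies Griffiths non-negativity of the metric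
  with positive semidefiniteness of the complex Hessian of \<open>u\<close>.

  The latter is preserved by the maximum principle. Apply it to
  \<open>N (x, V) = u\<^sub>A\<^sub>C V\<^sup>A cnj V\<^sup>C + \<epsilon> exp (C t) K\<close> with \<open>V = (v, \<beta>)\<close>, \<open>K = g(v, v) h(\<alpha>, \<alpha>)\<close>.
  At a first zero the Levi matrix of \<open>N\<close> in all variables \<open>(x, V)\<close> is positive semidefinite, that is,
  a sum of rank one matrices \<open>w\<^sub>k w\<^sub>k\<^sup>*\<close>. Up to terms of size \<open>\<epsilon> exp (C t)\<close> the time
  derivative of \<open>u\<^sub>A\<^sub>C V\<^sup>A cnj V\<^sup>C\<close> is a quadratic form in that matrix, equal to
  \<open>1/2 \<Sum>\<^sub>k\<^sub>l \<bar>q (w\<^sub>k, w\<^sub>l)\<bar>\<^sup>2\<close> for a bilinear \<open>q\<close>; so for large \<open>C\<close> a first zero cannot occur.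
\<close>

text \<open>A tensor maximum principle usually follows a null vector by parallel transport and has
  to control gradient terms. Here V is a set of independent coordinates: a zero is a minimum in x
  and V jointly, the mixed blocks of the Levi matrix are exactly the gradient terms of the reaction,
  and no connection is chosen. J is constant, so differentiating the equation for u twice yields no
  lower order terms. The barrier K omits \<beta>, so it is not positive on all V. It suffices
  because the completed square determines the minimising \<beta>: zeros need only be sought at unit
  vectors v and a = H \<alpha> over compact coordinate balls, where K is positive. The constant C
  comes from compactness of these pieces and must not depend on \<epsilon>; keeping
  \<open>\<epsilon> * exp (C * t) \<le> 1\<close> lets the error quadratic in the barrier be
  absorbed like the linear one. All this happens in one chart, whereas a first zero is sought on M.
  Hence the curvature form has to be shown invariant under coordinate changes, and these are given
  only as complex differentiable maps.\<close>

abbreviation sum_univ :: "('i \<Rightarrow> 'b::comm_monoid_add) \<Rightarrow> 'b" (binder "\<Sum>\<Sum>" 10) where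
  "sum_univ f \<equiv> sum f UNIV"


section \<open>Smooth functions\<close>

text \<open>All derivatives are taken within S, so values off S never matter. This is what later
  allows derivatives to be set to 0 there.\<close>

lemma Ck_on_cong:
  assumes "\<And>x. x \<in> S \<Longrightarrow> f x = g x"
  shows "Ck_on k S f \<longleftrightarrow> Ck_on k S g"
proof -
  have *: "Ck_on k S f \<longleftrightarrow> Ck_on k S g" if "\<And>x. x \<in> S \<Longrightarrow> f x = g x" for k and f g :: "'a \<Rightarrow> 'b"
    using that
  proof (induction k arbitrary: f g)
    case 0
    then show ?case by (simp cong: continuous_on_cong)
  next
    case (Suc k)
    have has_frechet_derivative: "(f has_derivative D) (at x within S) \<longleftrightarrow> (g has_derivative D) (at x within S)" if "x \<in> S" for x D
      using Suc.prems that by (metis has_derivative_transform)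
    have fd: "frechet_derivative f (at x within S) = frechet_derivative g (at x within S)" if "x \<in> S" for x
      unfolding frechet_derivative_def using has_frechet_derivative[OF that] by presburger
    have df: "f differentiable_on S \<longleftrightarrow> g differentiable_on S"
      unfolding differentiable_on_def differentiable_def using has_frechet_derivative by blast
    have "Ck_on k S (\<lambda>x. frechet_derivative f (at x within S) v)
      \<longleftrightarrow> Ck_on k S (\<lambda>x. frechet_derivative g (at x within S) v)" for v
      by (rule Suc.IH) (simp add: fd)
    then show ?case using df by simp
  qed
  show ?thesis using *[OF assms] .
qed

lemma Ck_on_SucD: "Ck_on (Suc k) S f \<Longrightarrow> Ck_on k S f"
proof (induction k arbitrary: f)
  case 0
  then have "f differentiable_on S" by simp
  then show ?case by (simp add: differentiable_imp_continuous_on)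
next
  case (Suc k)
  then show ?case by (metis Ck_on.simps(2))
qed

lemma smooth_on_cong:
  "(\<And>x. x \<in> S \<Longrightarrow> f x = g x) \<Longrightarrow> smooth_on S f \<longleftrightarrow> smooth_on S g"
  unfolding smooth_on_def using Ck_on_cong by metis

lemma smooth_on_imp_continuous_on: "smooth_on S f \<Longrightarrow> continuous_on S f"
  unfolding smooth_on_def by (metis Ck_on.simps(1))

lemma smooth_on_imp_differentiable_on: "smooth_on S f \<Longrightarrow> f differentiable_on S"
  unfolding smooth_on_def by (metis Ck_on.simps(2))

text \<open>
  The first assumption makes derivatives within \<open>S\<close> unique, the second extends the symmetry of second
  derivatives from the interior to all of \<open>S\<close>.
\<close>

locale smooth_dom =
  fixes S :: "'e::euclidean_space set"
  assumes dirs: "\<And>x i e. x \<in> S \<Longrightarrow> i \<in> Basis \<Longrightarrow> 0 < e \<Longrightarrow>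
      \<exists>d. 0 < \<bar>d\<bar> \<and> \<bar>d\<bar> < e \<and> x + d *\<^sub>R i \<in> S"
    and dense: "S \<subseteq> closure (interior S)"
begin

lemma fd_eq:
  fixes f :: "'e \<Rightarrow> 'f::real_normed_vector"
  assumes "(f has_derivative D) (at x within S)" "x \<in> S"
  shows "frechet_derivative f (at x within S) = D"
  using frechet_derivative_unique_within[OF _ assms(1) dirs[OF assms(2)]] assms(1)
    frechet_derivative_works differentiable_def by metis

lemma has_frechet_derivative:
  fixes f :: "'e \<Rightarrow> 'f::real_normed_vector"
  assumes "f differentiable_on S" "x \<in> S"
  shows "(f has_derivative frechet_derivative f (at x within S)) (at x within S)"
  using assms differentiable_on_def frechet_derivative_works by blast

lemma Ck_on_const:
  fixes c :: "'f::real_normed_vector"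
  shows "Ck_on k S (\<lambda>x. c)"
proof (induction k arbitrary: c)
  case (Suc k)
  have "Ck_on k S (\<lambda>x. frechet_derivative (\<lambda>x. c) (at x within S) v) \<longleftrightarrow> Ck_on k S (\<lambda>x. 0 :: 'f)" for v
    by (rule Ck_on_cong) (metis fd_eq has_derivative_const)
  then show ?case using Suc[of 0] by simp
qed simp

lemma smooth_on_const [simp]:
  fixes c :: "'f::real_normed_vector"
  shows "smooth_on S (\<lambda>x. c)"
  by (simp add: smooth_on_def Ck_on_const)

lemma Ck_on_bounded_linear:
  fixes f :: "'e \<Rightarrow> 'f::real_normed_vector" and L :: "'f \<Rightarrow> 'g::real_normed_vector"
  assumes L: "bounded_linear L"
  shows "Ck_on k S f \<Longrightarrow> Ck_on k S (\<lambda>x. L (f x))"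
proof (induction k arbitrary: f)
  case 0
  then show ?case using L by (simp add: linear_continuous_on_compose bounded_linear.continuous_on)
next
  case (Suc k)
  have h: "((\<lambda>x. L (f x)) has_derivative (\<lambda>v. L (frechet_derivative f (at x within S) v))) (at x within S)"
    if "x \<in> S" for x
    using Suc.prems that by (intro bounded_linear.has_derivative[OF L] has_frechet_derivative) auto
  have "Ck_on k S (\<lambda>x. frechet_derivative (\<lambda>x. L (f x)) (at x within S) v)
     \<longleftrightarrow> Ck_on k S (\<lambda>x. L (frechet_derivative f (at x within S) v))" for v
    by (rule Ck_on_cong) (simp add: fd_eq[OF h])
  moreover have "(\<lambda>x. L (f x)) differentiable_on S"
    using h differentiable_on_def differentiable_def by blast
  ultimately show ?case using Suc by simp
qed

lemma Ck_on_add: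
  fixes f g :: "'e \<Rightarrow> 'f::real_normed_vector"
  shows "Ck_on k S f \<Longrightarrow> Ck_on k S g \<Longrightarrow> Ck_on k S (\<lambda>x. f x + g x)"
proof (induction k arbitrary: f g)
  case 0
  then show ?case by (simp add: continuous_on_add)
next
  case (Suc k)
  have h: "((\<lambda>x. f x + g x) has_derivative (\<lambda>v. frechet_derivative f (at x within S) v
     + frechet_derivative g (at x within S) v)) (at x within S)"
    if "x \<in> S" for x
    using Suc.prems that by (intro has_derivative_add has_frechet_derivative) auto
  have "Ck_on k S (\<lambda>x. frechet_derivative (\<lambda>x. f x + g x) (at x within S) v)
     \<longleftrightarrow> Ck_on k S (\<lambda>x. frechet_derivative f (at x within S) v + frechet_derivative g (at x within S) v)" for v
    by (rule Ck_on_cong) (simp add: fd_eq[OF h])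
  moreover have "(\<lambda>x. f x + g x) differentiable_on S"
    using h differentiable_on_def differentiable_def by blast
  ultimately show ?case using Suc by simp
qed

lemma Ck_on_mult:
  fixes f g :: "'e \<Rightarrow> complex"
  shows "Ck_on k S f \<Longrightarrow> Ck_on k S g \<Longrightarrow> Ck_on k S (\<lambda>x. f x * g x)"
proof (induction k arbitrary: f g)
  case 0
  then show ?case by (simp add: continuous_on_mult)
next
  case (Suc k)
  have h: "((\<lambda>x. f x * g x) has_derivative (\<lambda>v. f x * frechet_derivative g (at x within S) v
     + frechet_derivative f (at x within S) v * g x)) (at x within S)"
    if "x \<in> S" for x
    using Suc.prems that by (intro has_derivative_mult has_frechet_derivative) auto
  have "Ck_on k S (\<lambda>x. frechet_derivative (\<lambda>x. f x * g x) (at x within S) v)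
     \<longleftrightarrow> Ck_on k S (\<lambda>x. f x * frechet_derivative g (at x within S) v
        + frechet_derivative f (at x within S) v * g x)" for v
    by (rule Ck_on_cong) (simp add: fd_eq[OF h])
  moreover have "(\<lambda>x. f x * g x) differentiable_on S"
    using h differentiable_on_def differentiable_def by blast
  moreover have "Ck_on k S f" "Ck_on k S g"
    using Suc.prems Ck_on_SucD by blast+
  ultimately show ?case using Suc by (auto intro!: Ck_on_add)
qed

text \<open>The derivative of \<open>inverse f\<close> is a product of \<open>inverse f\<close>
  itself and a derivative of f, so the induction feeds on its own hypothesis with f fixed.\<close>

lemma Ck_on_inverse:
  fixes f :: "'e \<Rightarrow> complex"
  assumes nz: "\<And>x. x \<in> S \<Longrightarrow> f x \<noteq> 0"
  shows "Ck_on k S f \<Longrightarrow> Ck_on k S (\<lambda>x. inverse (f x))"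
proof (induction k)
  case 0
  then show ?case using nz by (simp add: continuous_on_inverse)
next
  case (Suc k)
  have h: "((\<lambda>x. inverse (f x)) has_derivative (\<lambda>v. - (inverse (f x) *
      frechet_derivative f (at x within S) v * inverse (f x)))) (at x within S)"
    if "x \<in> S" for x
    using Suc.prems that by (intro Deriv.has_derivative_inverse nz has_frechet_derivative) auto
  have *: "Ck_on k S (\<lambda>x. frechet_derivative (\<lambda>x. inverse (f x)) (at x within S) v)
     \<longleftrightarrow> Ck_on k S (\<lambda>x. - 1 * (inverse (f x) * frechet_derivative f (at x within S) v * inverse (f x)))" for v
    by (rule Ck_on_cong) (simp add: fd_eq[OF h])
  have "(\<lambda>x. inverse (f x)) differentiable_on S"
    using h differentiable_on_def differentiable_def by blast
  moreover have "Ck_on k S (\<lambda>x. inverse (f x))"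
    using Suc Ck_on_SucD by blast
  then have "Ck_on k S (\<lambda>x. - 1 * (inverse (f x) * frechet_derivative f (at x within S) v * inverse (f x)))" for v
    using Suc.prems by (intro Ck_on_mult Ck_on_const) auto
  ultimately show ?case using * by simp
qed

lemma smooth_bounded_linear:
  fixes f :: "'e \<Rightarrow> 'f::real_normed_vector"
  shows "bounded_linear L \<Longrightarrow> smooth_on S f \<Longrightarrow> smooth_on S (\<lambda>x. L (f x))"
  by (simp add: smooth_on_def Ck_on_bounded_linear)

lemma smooth_id: "smooth_on S (\<lambda>x. x)"
proof -
  have "Ck_on k S (\<lambda>x. x)" for k
  proof (cases k)
    case (Suc n)
    have "Ck_on n S (\<lambda>x. frechet_derivative (\<lambda>x. x) (at x within S) v) \<longleftrightarrow> Ck_on n S (\<lambda>x. v)" for v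
      by (rule Ck_on_cong) (metis fd_eq has_derivative_ident)
    then show ?thesis using Suc by (simp add: Ck_on_const)
  qed simp
  then show ?thesis by (simp add: smooth_on_def)
qed

lemma smooth_linear: "bounded_linear L \<Longrightarrow> smooth_on S L"
  using smooth_bounded_linear[OF _ smooth_id] .

lemma smooth_add [simp]:
  fixes f g :: "'e \<Rightarrow> 'f::real_normed_vector"
  shows "smooth_on S f \<Longrightarrow> smooth_on S g \<Longrightarrow> smooth_on S (\<lambda>x. f x + g x)"
  by (simp add: smooth_on_def Ck_on_add)

lemma smooth_mult [simp]:
  fixes f g :: "'e \<Rightarrow> complex"
  shows "smooth_on S f \<Longrightarrow> smooth_on S g \<Longrightarrow> smooth_on S (\<lambda>x. f x * g x)"
  by (simp add: smooth_on_def Ck_on_mult)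

lemma smooth_minus [simp]:
  fixes f :: "'e \<Rightarrow> 'f::real_normed_vector"
  shows "smooth_on S f \<Longrightarrow> smooth_on S (\<lambda>x. - f x)"
  by (rule smooth_bounded_linear[OF bounded_linear_minus[OF bounded_linear_ident]])

lemma smooth_diff [simp]:
  fixes f g :: "'e \<Rightarrow> 'f::real_normed_vector"
  shows "smooth_on S f \<Longrightarrow> smooth_on S g \<Longrightarrow> smooth_on S (\<lambda>x. f x - g x)"
  using smooth_add[OF _ smooth_minus, of f g] by simp

lemma smooth_cnj [simp]: "smooth_on S f \<Longrightarrow> smooth_on S (\<lambda>x. cnj (f x))"
  by (rule smooth_bounded_linear[OF bounded_linear_cnj])

lemma smooth_of_real: "smooth_on S f \<Longrightarrow> smooth_on S (\<lambda>x. complex_of_real (f x))"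
  by (rule smooth_bounded_linear[OF bounded_linear_of_real])

lemma smooth_inverse:
  fixes f :: "'e \<Rightarrow> complex"
  shows "(\<And>x. x \<in> S \<Longrightarrow> f x \<noteq> 0) \<Longrightarrow> smooth_on S f \<Longrightarrow> smooth_on S (\<lambda>x. inverse (f x))"
  by (simp add: smooth_on_def Ck_on_inverse)

lemma smooth_sum [simp]:
  fixes f :: "'i \<Rightarrow> 'e \<Rightarrow> 'f::real_normed_vector"
  assumes "\<And>i. i \<in> I \<Longrightarrow> smooth_on S (f i)"
  shows "smooth_on S (\<lambda>x. \<Sum>i\<in>I. f i x)"
  using assms by (induction I rule: infinite_finite_induct) auto

lemma smooth_prod:
  fixes f :: "'i \<Rightarrow> 'e \<Rightarrow> complex"
  assumes "\<And>i. i \<in> I \<Longrightarrow> smooth_on S (f i)"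
  shows "smooth_on S (\<lambda>x. \<Prod>i\<in>I. f i x)"
  using assms by (induction I rule: infinite_finite_induct) auto

end

section \<open>Symmetry of second derivatives\<close>

lemma second_difference_mvt:
  fixes f fv fvw :: "'e::real_normed_vector \<Rightarrow> real"
  assumes fv: "\<And>y. y \<in> U \<Longrightarrow> ((\<lambda>s. f (y + s *\<^sub>R v)) has_real_derivative fv y) (at 0)"
    and fvw: "\<And>y. y \<in> U \<Longrightarrow> ((\<lambda>s. fv (y + s *\<^sub>R w)) has_real_derivative fvw y) (at 0)"
    and s: "0 < s"
    and box: "\<And>a b. 0 \<le> a \<Longrightarrow> a \<le> s \<Longrightarrow> 0 \<le> b \<Longrightarrow> b \<le> s \<Longrightarrow> x + a *\<^sub>R v + b *\<^sub>R w \<in> U"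
  shows "\<exists>a b. 0 < a \<and> a < s \<and> 0 < b \<and> b < s \<and>
      f (x + s *\<^sub>R v + s *\<^sub>R w) - f (x + s *\<^sub>R v) - f (x + s *\<^sub>R w) + f x
        = s\<^sup>2 * fvw (x + a *\<^sub>R v + b *\<^sub>R w)"
proof -
  have shift: "((\<lambda>s. h (y + s *\<^sub>R d)) has_real_derivative h' (y + a *\<^sub>R d)) (at a)"
    if "\<And>y. y \<in> U \<Longrightarrow> ((\<lambda>s. h (y + s *\<^sub>R d)) has_real_derivative h' y) (at 0)" "y + a *\<^sub>R d \<in> U"
    for h h' :: "'e \<Rightarrow> real" and d y a
    using that(1)[OF that(2)] DERIV_shift[of "\<lambda>s. h (y + s *\<^sub>R d)" "h' (y + a *\<^sub>R d)" 0 a]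
    by (simp add: scaleR_left_distrib add.commute add.left_commute)
  \<comment> \<open>The mean value theorem is applied twice: in direction v to this difference in
    direction w, then in direction w to \<open>fv\<close>. The second difference is symmetric in v
    and w although the resulting expression is not.\<close>
  define \<phi> where "\<phi> a = f (x + a *\<^sub>R v + s *\<^sub>R w) - f (x + a *\<^sub>R v)" for a
  have "(\<phi> has_real_derivative (fv (x + a *\<^sub>R v + s *\<^sub>R w) - fv (x + a *\<^sub>R v))) (at a)"
    if "0 \<le> a" "a \<le> s" for a
    using shift[OF fv, of "x + s *\<^sub>R w" a] shift[OF fv, of x a] box[OF that, of s] box[OF that, of 0] s
    unfolding \<phi>_def by (auto intro!: DERIV_diff simp: algebra_simps)
  from MVT2[OF s this] obtain a where a: "0 < a" "a < s"
    "\<phi> s - \<phi> 0 = s * (fv (x + a *\<^sub>R v + s *\<^sub>R w) - fv (x + a *\<^sub>R v))" by auto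
  have "((\<lambda>b. fv (x + a *\<^sub>R v + b *\<^sub>R w)) has_real_derivative fvw (x + a *\<^sub>R v + b *\<^sub>R w)) (at b)"
    if "0 \<le> b" "b \<le> s" for b
    using shift[OF fvw, of "x + a *\<^sub>R v" b] box[of a b] a that by simp
  from MVT2[OF s this] obtain b where b: "0 < b" "b < s"
    "fv (x + a *\<^sub>R v + s *\<^sub>R w) - fv (x + a *\<^sub>R v) = s * fvw (x + a *\<^sub>R v + b *\<^sub>R w)" by auto
  show ?thesis
    using a b unfolding \<phi>_def
    by (intro exI[of _ a] exI[of _ b]) (simp add: power2_eq_square algebra_simps)
qed

text \<open>The second difference over a box of side s is s^2 times either mixed derivative, each at
  some point of the box. Shrinking the box and using continuity at x identifies the two.\<close>

lemma mixed_directional_derivatives: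
  fixes f fv fw fvw fwv :: "'e::real_normed_vector \<Rightarrow> real"
  assumes U: "open U" "x \<in> U"
    and fv: "\<And>y. y \<in> U \<Longrightarrow> ((\<lambda>s. f (y + s *\<^sub>R v)) has_real_derivative fv y) (at 0)"
    and fvw: "\<And>y. y \<in> U \<Longrightarrow> ((\<lambda>s. fv (y + s *\<^sub>R w)) has_real_derivative fvw y) (at 0)"
    and fw: "\<And>y. y \<in> U \<Longrightarrow> ((\<lambda>s. f (y + s *\<^sub>R w)) has_real_derivative fw y) (at 0)"
    and fwv: "\<And>y. y \<in> U \<Longrightarrow> ((\<lambda>s. fw (y + s *\<^sub>R v)) has_real_derivative fwv y) (at 0)"
    and cont: "isCont fvw x" "isCont fwv x"
  shows "fvw x = fwv x"
proof (rule ccontr)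
  assume "fvw x \<noteq> fwv x"
  define e where "e = \<bar>fvw x - fwv x\<bar> / 2"
  have e: "0 < e" using \<open>fvw x \<noteq> fwv x\<close> by (simp add: e_def)
  obtain d1 where d1: "0 < d1" "\<And>y. dist y x < d1 \<Longrightarrow> dist (fvw y) (fvw x) < e"
    using cont(1) e unfolding continuous_at_eps_delta by (metis dist_commute)
  obtain d2 where d2: "0 < d2" "\<And>y. dist y x < d2 \<Longrightarrow> dist (fwv y) (fwv x) < e"
    using cont(2) e unfolding continuous_at_eps_delta by (metis dist_commute)
  obtain d3 where d3: "0 < d3" "\<And>y. dist y x < d3 \<Longrightarrow> y \<in> U"
    using U unfolding open_dist by blast
  define d where "d = min d1 (min d2 d3)"
  \<comment> \<open>Small enough for the whole box of side s to lie within distance d of x; the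
    summand 1 covers v = w = 0.\<close>
  define s where "s = d / (2 * (norm v + norm w + 1))"
  have den: "0 < 2 * (norm v + norm w + 1)"
    by (simp add: add_nonneg_pos)
  have d: "0 < d" using d1 d2 d3 by (simp add: d_def)
  have s: "0 < s" using d den by (simp add: s_def)
  have near: "dist (x + a *\<^sub>R v + b *\<^sub>R w) x < d" if "0 \<le> a" "a \<le> s" "0 \<le> b" "b \<le> s" for a b
  proof -
    have "norm (a *\<^sub>R v + b *\<^sub>R w) \<le> a * norm v + b * norm w"
      using norm_triangle_ineq[of "a *\<^sub>R v" "b *\<^sub>R w"] that by simp
    also have "\<dots> \<le> s * norm v + s * norm w"
      using that by (intro add_mono mult_right_mono) auto
    also have "\<dots> < s * (2 * (norm v + norm w + 1))"
      using s den by (simp add: algebra_simps add_nonneg_pos pos_add_strict)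
    also have "\<dots> = d" using den by (simp add: s_def)
    finally show ?thesis by (simp add: dist_norm add.assoc)
  qed
  have box1: "x + a *\<^sub>R v + b *\<^sub>R w \<in> U" if "0 \<le> a" "a \<le> s" "0 \<le> b" "b \<le> s" for a b
    using near[OF that] d3 by (simp add: d_def)
  have box2: "x + a *\<^sub>R w + b *\<^sub>R v \<in> U" if "0 \<le> a" "a \<le> s" "0 \<le> b" "b \<le> s" for a b
    using box1[of b a] that by (simp add: algebra_simps)
  obtain a b where ab: "0 < a" "a < s" "0 < b" "b < s"
     "f (x + s *\<^sub>R v + s *\<^sub>R w) - f (x + s *\<^sub>R v) - f (x + s *\<^sub>R w) + f x
        = s\<^sup>2 * fvw (x + a *\<^sub>R v + b *\<^sub>R w)"
    using second_difference_mvt[OF fv fvw s box1] by blast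
  obtain a' b' where ab': "0 < a'" "a' < s" "0 < b'" "b' < s"
     "f (x + s *\<^sub>R w + s *\<^sub>R v) - f (x + s *\<^sub>R w) - f (x + s *\<^sub>R v) + f x
        = s\<^sup>2 * fwv (x + a' *\<^sub>R w + b' *\<^sub>R v)"
    using second_difference_mvt[OF fw fwv s box2] by blast
  have "s\<^sup>2 * fvw (x + a *\<^sub>R v + b *\<^sub>R w) = s\<^sup>2 * fwv (x + b' *\<^sub>R v + a' *\<^sub>R w)"
    using ab(5) ab'(5) by (simp add: algebra_simps)
  then have eq: "fvw (x + a *\<^sub>R v + b *\<^sub>R w) = fwv (x + b' *\<^sub>R v + a' *\<^sub>R w)"
    using s by simp
  have "dist (fvw (x + a *\<^sub>R v + b *\<^sub>R w)) (fvw x) < e"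
    using near[of a b] ab d1 by (simp add: d_def)
  moreover have "dist (fwv (x + b' *\<^sub>R v + a' *\<^sub>R w)) (fwv x) < e"
    using near[of b' a'] ab' d2 by (simp add: d_def)
  ultimately show False
    using eq unfolding e_def dist_real_def by (simp add: abs_if split: if_splits)
qed

text \<open>
  Setting derivatives to \<open>0\<close> outside \<open>S\<close> turns the rules for sums and products, and the commutation of
  derivatives, into equations between functions.
\<close>

definition dd :: "'e::real_normed_vector set \<Rightarrow> 'e \<Rightarrow> ('e \<Rightarrow> complex) \<Rightarrow> 'e \<Rightarrow> complex" where
  "dd S v f = (\<lambda>x. if x \<in> S then frechet_derivative f (at x within S) v else 0)"

text \<open>The derivative along the complexified vector v + i w. Coordinate Wirtinger derivatives,
  derivatives along a (1,0) vector and the time derivative are all instances, so the calculus is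
  done once.\<close>

definition cd :: "'e::real_normed_vector set \<Rightarrow> 'e \<Rightarrow> 'e \<Rightarrow> ('e \<Rightarrow> complex) \<Rightarrow> 'e \<Rightarrow> complex" where
  "cd S v w f = (\<lambda>x. dd S v f x + \<i> * dd S w f x)"

context smooth_dom
begin

lemma dd_eq:
  assumes "(f has_derivative D) (at x within S)" "x \<in> S"
  shows "dd S v f x = D v"
  using fd_eq[OF assms] assms(2) by (simp add: dd_def)

lemma has_derivative_dd:
  assumes "smooth_on S f" "x \<in> S"
  shows "(f has_derivative (\<lambda>v. dd S v f x)) (at x within S)"
  using has_frechet_derivative[OF smooth_on_imp_differentiable_on] assms by (simp add: dd_def)

lemma dd_ext: "(\<And>x. x \<in> S \<Longrightarrow> (f has_derivative D x) (at x within S)) \<Longrightarrow>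
   dd S v f = (\<lambda>x. if x \<in> S then D x v else 0)"
  using dd_eq by (fastforce simp: dd_def)

lemma dd_outside: "x \<notin> S \<Longrightarrow> dd S v f x = 0"
  by (simp add: dd_def)

lemma dd_smooth:
  assumes "smooth_on S f"
  shows "smooth_on S (dd S v f)"
proof -
  have "Ck_on k S (\<lambda>x. frechet_derivative f (at x within S) v)" for k
    using assms unfolding smooth_on_def by (metis Ck_on.simps(2))
  then have "smooth_on S (\<lambda>x. frechet_derivative f (at x within S) v)"
    by (simp add: smooth_on_def)
  then show ?thesis
    by (rule iffD1[OF smooth_on_cong, rotated]) (simp add: dd_def)
qed

lemma dd_cong:
  assumes "\<And>x. x \<in> S \<Longrightarrow> f x = g x"
  shows "dd S v f = dd S v g"
proof -
  have "(f has_derivative D) (at x within S) \<longleftrightarrow> (g has_derivative D) (at x within S)" if "x \<in> S" for x D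
    using assms that by (metis has_derivative_transform)
  then have "frechet_derivative f (at x within S) = frechet_derivative g (at x within S)" if "x \<in> S" for x
    unfolding frechet_derivative_def using that by presburger
  then show ?thesis
    unfolding dd_def by auto
qed

lemma dd_const: "dd S v (\<lambda>x. c) = (\<lambda>x. 0)"
  using dd_ext[OF has_derivative_const] by auto

lemma dd_linear: "bounded_linear L \<Longrightarrow> dd S v L = (\<lambda>x. if x \<in> S then L v else 0)"
  by (rule dd_ext) (rule bounded_linear_imp_has_derivative)

lemma dd_add:
  assumes "smooth_on S f" "smooth_on S g"
  shows "dd S v (\<lambda>x. f x + g x) = (\<lambda>x. dd S v f x + dd S v g x)"
  using dd_ext[OF has_derivative_add[OF has_derivative_dd has_derivative_dd], OF assms(1) _ assms(2)]
  by (auto simp: dd_outside)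

lemma dd_mult:
  assumes "smooth_on S f" "smooth_on S g"
  shows "dd S v (\<lambda>x. f x * g x) = (\<lambda>x. dd S v f x * g x + f x * dd S v g x)"
  using dd_ext[OF has_derivative_mult[OF has_derivative_dd has_derivative_dd], OF assms(1) _ assms(2)]
  by (auto simp: dd_outside)

lemma dd_bounded_linear:
  assumes "bounded_linear L" "smooth_on S f"
  shows "dd S v (\<lambda>x. L (f x)) = (\<lambda>x. L (dd S v f x))"
  using dd_ext[OF bounded_linear.has_derivative[OF assms(1) has_derivative_dd], OF assms(2)]
    linear_0[OF bounded_linear.linear[OF assms(1)]]
  by (auto simp: dd_outside)

lemma dd_cnj: "smooth_on S f \<Longrightarrow> dd S v (\<lambda>x. cnj (f x)) = (\<lambda>x. cnj (dd S v f x))"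
  by (rule dd_bounded_linear[OF bounded_linear_cnj])

lemma dd_dir_add:
  assumes "smooth_on S f"
  shows "dd S (v + w) f x = dd S v f x + dd S w f x"
proof (cases "x \<in> S")
  case True
  show ?thesis
    using linear_add[OF has_derivative_linear[OF has_derivative_dd[OF assms True]]] .
qed (simp add: dd_outside)

lemma dd_dir_scale:
  assumes "smooth_on S f"
  shows "dd S (r *\<^sub>R v) f x = r *\<^sub>R dd S v f x"
proof (cases "x \<in> S")
  case True
  show ?thesis
    using linear_scale[OF has_derivative_linear[OF has_derivative_dd[OF assms True]]] .
qed (simp add: dd_outside)

lemma dd_dir_zero: "smooth_on S f \<Longrightarrow> dd S 0 f x = 0"
  using dd_dir_scale[of f 0 0 x] by simp

lemma dd_dir_minus: "smooth_on S f \<Longrightarrow> dd S (- v) f x = - dd S v f x"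
  using dd_dir_scale[of f "-1" v x] by simp

lemma has_real_derivative_dd:
  assumes f: "smooth_on S f" and x: "x \<in> interior S" and L: "bounded_linear L"
  shows "((\<lambda>s. L (f (x + s *\<^sub>R v))) has_real_derivative L (dd S v f x)) (at 0)"
proof -
  have "x \<in> S" using x interior_subset by blast
  have "(f has_derivative (\<lambda>v. dd S v f x)) (at x)"
    using has_derivative_dd[OF f \<open>x \<in> S\<close>] x at_within_interior by metis
  then have "(f has_derivative (\<lambda>v. dd S v f x)) (at (x + 0 *\<^sub>R v))" by simp
  moreover have "((\<lambda>s. x + s *\<^sub>R v) has_derivative (\<lambda>s. s *\<^sub>R v)) (at 0)"
    by (auto intro!: derivative_eq_intros)
  ultimately have "((\<lambda>s. f (x + s *\<^sub>R v)) has_derivative (\<lambda>s. dd S (s *\<^sub>R v) f x)) (at 0)"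
    by (rule has_derivative_compose[rotated])
  from bounded_linear.has_derivative[OF L this]
  have "((\<lambda>s. L (f (x + s *\<^sub>R v))) has_derivative (\<lambda>s. L (s *\<^sub>R dd S v f x))) (at 0)"
    by (simp add: dd_dir_scale[OF f])
  then show ?thesis
    using bounded_linear.linear[OF L]
    by (auto simp: has_field_derivative_def linear_scale elim!: has_derivative_eq_rhs)
qed

lemma dd_commute_interior:
  assumes f: "smooth_on S f" and x: "x \<in> interior S"
  shows "dd S v (dd S w f) x = dd S w (dd S v f) x"
proof -
  \<comment> \<open>The mean value argument needs real values; L will be Re and Im.\<close>
  have "L (dd S v (dd S w f) x) = L (dd S w (dd S v f) x)"
    if L: "bounded_linear L" for L :: "complex \<Rightarrow> real"
  proof (rule mixed_directional_derivatives[OF open_interior x])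
    fix y assume y: "y \<in> interior S"
    show "((\<lambda>s. L (f (y + s *\<^sub>R w))) has_real_derivative L (dd S w f y)) (at 0)"
      by (rule has_real_derivative_dd[OF f y L])
    show "((\<lambda>s. L (f (y + s *\<^sub>R v))) has_real_derivative L (dd S v f y)) (at 0)"
      by (rule has_real_derivative_dd[OF f y L])
    show "((\<lambda>s. L (dd S w f (y + s *\<^sub>R v))) has_real_derivative L (dd S v (dd S w f) y)) (at 0)"
      by (rule has_real_derivative_dd[OF dd_smooth[OF f] y L])
    show "((\<lambda>s. L (dd S v f (y + s *\<^sub>R w))) has_real_derivative L (dd S w (dd S v f) y)) (at 0)"
      by (rule has_real_derivative_dd[OF dd_smooth[OF f] y L])
  next
    have "isCont (dd S a (dd S b f)) x" for a b
      using smooth_on_imp_continuous_on[OF dd_smooth[OF dd_smooth[OF f]]] x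
        continuous_on_interior by blast
    then show "isCont (\<lambda>y. L (dd S v (dd S w f) y)) x" "isCont (\<lambda>y. L (dd S w (dd S v f) y)) x"
      using bounded_linear.isCont[OF L] by blast+
  qed
  from this[OF bounded_linear_Re] this[OF bounded_linear_Im] show ?thesis
    by (simp add: complex_eq_iff)
qed

lemma dd_commute:
  assumes f: "smooth_on S f"
  shows "dd S v (dd S w f) = dd S w (dd S v f)"
proof (rule ext)
  fix x
  let ?h = "\<lambda>y. dd S v (dd S w f) y - dd S w (dd S v f) y"
  have c: "continuous_on S ?h"
    by (intro smooth_on_imp_continuous_on smooth_diff dd_smooth f)
  show "dd S v (dd S w f) x = dd S w (dd S v f) x"
  proof (cases "x \<in> S")
    case True
    have "closedin (top_of_set S) {y \<in> S. ?h y = 0}"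
      by (rule continuous_closedin_preimage_constant[OF c])
    moreover have "interior S \<subseteq> {y \<in> S. ?h y = 0}"
      using dd_commute_interior[OF f] interior_subset[of S] by auto
    ultimately have "S \<inter> closure (interior S) \<subseteq> {y \<in> S. ?h y = 0}"
      unfolding closedin_closed by (metis Int_mono closure_minimal dual_order.refl le_inf_iff)
    then show ?thesis using True dense by auto
  qed (simp add: dd_outside)
qed

lemma cd_smooth [simp]: "smooth_on S f \<Longrightarrow> smooth_on S (cd S v w f)"
  unfolding cd_def by (intro smooth_add smooth_mult smooth_on_const dd_smooth)

lemma cd_outside: "x \<notin> S \<Longrightarrow> cd S v w f x = 0"
  by (simp add: cd_def dd_outside)

lemma cd_cong: "(\<And>x. x \<in> S \<Longrightarrow> f x = g x) \<Longrightarrow> cd S v w f = cd S v w g"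
  using dd_cong[of f g] by (simp add: cd_def)

lemma cd_const [simp]: "cd S v w (\<lambda>x. c) = (\<lambda>x. 0)"
  by (simp add: cd_def dd_const)

lemma cd_add [simp]: "smooth_on S f \<Longrightarrow> smooth_on S g \<Longrightarrow>
   cd S v w (\<lambda>x. f x + g x) = (\<lambda>x. cd S v w f x + cd S v w g x)"
  by (auto simp: cd_def dd_add algebra_simps)

lemma cd_mult [simp]: "smooth_on S f \<Longrightarrow> smooth_on S g \<Longrightarrow>
   cd S v w (\<lambda>x. f x * g x) = (\<lambda>x. cd S v w f x * g x + f x * cd S v w g x)"
  by (auto simp: cd_def dd_mult algebra_simps)

lemma cd_cnj [simp]: "smooth_on S f \<Longrightarrow> cd S v w (\<lambda>x. cnj (f x)) = (\<lambda>x. cnj (cd S v (- w) f x))"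
  by (auto simp: cd_def dd_cnj dd_dir_minus)

lemma cd_minus [simp]: "smooth_on S f \<Longrightarrow> cd S v w (\<lambda>x. - f x) = (\<lambda>x. - cd S v w f x)"
  using cd_mult[of "\<lambda>x. -1" f] by simp

lemma cd_diff [simp]: "smooth_on S f \<Longrightarrow> smooth_on S g \<Longrightarrow>
   cd S v w (\<lambda>x. f x - g x) = (\<lambda>x. cd S v w f x - cd S v w g x)"
  using cd_add[of f "\<lambda>x. - g x"] by simp

lemma cd_sum [simp]:
  assumes "\<And>i. i \<in> I \<Longrightarrow> smooth_on S (f i)"
  shows "cd S v w (\<lambda>x. \<Sum>i\<in>I. f i x) = (\<lambda>x. \<Sum>i\<in>I. cd S v w (f i) x)"
  using assms by (induction I rule: infinite_finite_induct) auto

lemma cd_commute: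
  assumes "smooth_on S f"
  shows "cd S v w (cd S v' w' f) = cd S v' w' (cd S v w f)"
proof -
  have *: "cd S v w (cd S v' w' f) = (\<lambda>x. dd S v (dd S v' f) x + \<i> * dd S v (dd S w' f) x +
     \<i> * (dd S w (dd S v' f) x + \<i> * dd S w (dd S w' f) x))" for v w v' w'
    using assms unfolding cd_def by (simp add: dd_add dd_mult dd_const dd_smooth)
  show ?thesis
    unfolding * using assms dd_commute[of f] by (auto simp: algebra_simps fun_eq_iff)
qed

end

section \<open>Positive semidefinite Hermitian matrices\<close>

text \<open>The elementary step of an elimination: x is changed in the single coordinate s. Below, c
  is chosen to make the form drop, either to negativity (zero pivot) or to its minimum (positive
  pivot).\<close>

lemma hermitian_form_add_axis:
  fixes M :: "'k::finite \<Rightarrow> 'k \<Rightarrow> complex"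
  assumes herm: "\<And>a b. M b a = cnj (M a b)"
  shows "(\<Sum>\<Sum>a b. M a b * (x a + (if a = s then c else 0)) * cnj (x b + (if b = s then c else 0)))
    = (\<Sum>\<Sum>a b. M a b * x a * cnj (x b))
      + (\<Sum>\<Sum>a. M a s * x a) * cnj c + c * cnj (\<Sum>\<Sum>a. M a s * x a) + c * cnj c * M s s"
proof -
  have "(\<Sum>\<Sum>a b. M a b * (x a + (if a = s then c else 0)) * cnj (x b + (if b = s then c else 0)))
     = (\<Sum>\<Sum>a b. M a b * x a * cnj (x b))
       + (\<Sum>\<Sum>a b. if b = s then M a b * x a * cnj c else 0)
       + (\<Sum>\<Sum>a b. if a = s then M a b * c * cnj (x b) else 0)
       + (\<Sum>\<Sum>a b. if b = s then (if a = s then M a b * c * cnj c else 0) else 0)"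
    unfolding sum.distrib[symmetric]
    by (intro sum.cong refl) (auto simp: algebra_simps)
  also have "(\<Sum>\<Sum>a b. if a = s then M a b * c * cnj (x b) else 0)
      = (\<Sum>\<Sum>b. M s b * c * cnj (x b))"
    by (subst sum.swap) simp
  also have "\<dots> = c * cnj (\<Sum>\<Sum>a. M a s * x a)"
    by (simp add: sum_distrib_left herm[of s] mult_ac)
  also have "(\<Sum>\<Sum>a b. if b = s then M a b * x a * cnj c else 0) = (\<Sum>\<Sum>a. M a s * x a) * cnj c"
    by (simp add: sum_distrib_right)
  also have "(\<Sum>\<Sum>a b. if b = s then (if a = s then M a b * c * cnj c else 0) else 0) = c * cnj c * M s s"
    by (simp add: mult_ac)
  finally show ?thesis .
qed

text \<open>A Cholesky factorisation, which avoids eigenvectors. The induction is over a set F of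
  indices outside which M vanishes. A positive pivot is removed by a Schur complement; a zero pivot
  forces its whole row and column to vanish.\<close>

lemma psd_sum_rank_one:
  fixes M :: "'k::finite \<Rightarrow> 'k \<Rightarrow> complex"
  assumes "\<And>a b. M b a = cnj (M a b)"
    and "\<And>x. 0 \<le> Re (\<Sum>\<Sum>a b. M a b * x a * cnj (x b))"
  shows "\<exists>w :: 'k \<Rightarrow> 'k \<Rightarrow> complex. \<forall>a b. M a b = (\<Sum>\<Sum>r. w r a * cnj (w r b))"
proof -
  have "\<exists>w :: 'k \<Rightarrow> 'k \<Rightarrow> complex. \<forall>a b. M a b = (\<Sum>r\<in>F. w r a * cnj (w r b))"
    if "finite F" "\<And>a b. M b a = cnj (M a b)"
      "\<And>x. 0 \<le> Re (\<Sum>\<Sum>a b. M a b * x a * cnj (x b))"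
      "\<And>a b. a \<notin> F \<Longrightarrow> M a b = 0" for F and M :: "'k \<Rightarrow> 'k \<Rightarrow> complex"
    using that
  proof (induction F arbitrary: M rule: finite_induct)
    case empty
    then show ?case by simp
  next
    case (insert s F)
    note herm = insert.prems(1) and psd = insert.prems(2) and supp = insert.prems(3)
    have supp2: "M a b = 0" if "b \<notin> insert s F" for a b
      using supp[OF that, of a] herm[of a b] by simp
    have delta: "(\<Sum>\<Sum>a b. M a b * (if a = i then 1 else 0) * cnj (if b = i then 1 else 0)) = M i i" for i
    proof -
      have "(\<Sum>\<Sum>a b. M a b * (if a = i then 1 else 0) * cnj (if b = i then 1 else 0))
        = (\<Sum>\<Sum>a b. if b = i then (if a = i then M a b else 0) else 0)"
        by (intro sum.cong refl) simp
      then show ?thesis by simp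
    qed
    have diag: "0 \<le> Re (M i i)" for i
      using psd[of "\<lambda>a. if a = i then 1 else 0"] unfolding delta .
    define m where "m = Re (M s s)"
    have m: "M s s = of_real m"
      using herm[of s s] by (simp add: m_def complex_eq_iff)
    show ?case
    proof (cases "m = 0")
      case True
      have zero: "M a s = 0" for a
      proof (rule ccontr)
        assume "M a s \<noteq> 0"
        define q where "q = (cmod (M a s))\<^sup>2"
        have q: "0 < q" using \<open>M a s \<noteq> 0\<close> by (simp add: q_def)
        have L: "(\<Sum>\<Sum>b. M b s * (if b = a then 1 else 0)) = M a s"
          by (simp add: if_distrib cong: if_cong)
        \<comment> \<open>The form at the a-th unit vector plus \<open>- l * M a s\<close> times the
          s-th one is Re (M a a) - 2 l q. This l turns it into - Re (M a a) - 2, which is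
          negative.\<close>
        define l where "l = (Re (M a a) + 1) / q"
        have "0 \<le> Re (M a a + M a s * cnj (- l * M a s) + (- l * M a s) * cnj (M a s))"
          using psd[of "\<lambda>b. (if b = a then 1 else 0) + (if b = s then - l * M a s else 0)"] True m
          unfolding hermitian_form_add_axis[OF herm] delta L by simp
        also have "\<dots> = Re (M a a) - 2 * l * q"
          unfolding q_def cmod_power2 by (simp add: power2_eq_square algebra_simps)
        also have "\<dots> = - Re (M a a) - 2"
          using q by (simp add: l_def)
        finally show False using diag[of a] by simp
      qed
      have "M a b = 0" if "a \<notin> F" for a b
        using supp[of a b] zero[of b] herm[of b s] that by (cases "a = s") auto
      from insert.IH[OF herm psd this] obtain w where
        w: "\<And>a b. M a b = (\<Sum>r\<in>F. w r a * cnj (w r b))" by blast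
      show ?thesis
        by (rule exI[of _ "w(s := \<lambda>_. 0)"]) (use w insert.hyps in \<open>auto intro!: sum.cong\<close>)
    next
      case False
      then have mpos: "0 < m" using diag[of s] by (simp add: m_def)
      \<comment> \<open>The Schur complement. Its form at x is that of M after shifting the
        coordinate s by - L / m, the minimising shift, so it stays non-negative.\<close>
      define M' where "M' a b = M a b - M a s * M s b / m" for a b
      have herm': "M' b a = cnj (M' a b)" for a b
        using herm[of a b] herm[of a s] herm[of s b] by (simp add: M'_def mult.commute)
      have psd': "0 \<le> Re (\<Sum>\<Sum>a b. M' a b * x a * cnj (x b))" for x
      proof -
        define L where "L = (\<Sum>\<Sum>a. M a s * x a)"
        have square: "q - L * cnj L / m = q + L * cnj (- L / m) + (- L / m) * cnj L
           + (- L / m) * cnj (- L / m) * M s s" for q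
          using mpos by (simp add: m)
        have cL: "(\<Sum>\<Sum>b. M s b * cnj (x b)) = cnj L"
          unfolding L_def by (simp add: herm[of s])
        have "(\<Sum>\<Sum>a b. M' a b * x a * cnj (x b))
          = (\<Sum>\<Sum>a b. M a b * x a * cnj (x b))
            - (\<Sum>\<Sum>a b. (M a s * x a) * (M s b * cnj (x b)) / m)"
          unfolding M'_def sum_subtractf[symmetric] by (intro sum.cong refl) (simp add: algebra_simps)
        also have "(\<Sum>\<Sum>a b. (M a s * x a) * (M s b * cnj (x b)) / m) = L * cnj L / m"
          unfolding cL[symmetric] unfolding L_def by (simp add: sum_product sum_divide_distrib)
        also have "(\<Sum>\<Sum>a b. M a b * x a * cnj (x b)) - L * cnj L / m
          = ((\<Sum>\<Sum>a b. M a b * x a * cnj (x b)) + L * cnj (- L / m)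
             + (- L / m) * cnj L + (- L / m) * cnj (- L / m) * M s s)"
          by (rule square)
        also have "Re \<dots> \<ge> 0"
          using psd[of "\<lambda>a. x a + (if a = s then - L / m else 0)"]
          unfolding hermitian_form_add_axis[OF herm] L_def[symmetric] .
        finally show ?thesis .
      qed
      have "M' a b = 0" if "a \<notin> F" for a b
        using supp[of a b] supp[of a s] that mpos by (cases "a = s") (auto simp: M'_def m)
      from insert.IH[OF herm' psd' this] obtain w where
        w: "\<And>a b. M' a b = (\<Sum>r\<in>F. w r a * cnj (w r b))" by blast
      define w' where "w' = w(s := \<lambda>a. M a s / sqrt m)"
      have "M a b = (\<Sum>r\<in>insert s F. w' r a * cnj (w' r b))" for a b
      proof -
        have "(\<Sum>r\<in>F. w' r a * cnj (w' r b)) = M' a b"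
          unfolding w w'_def using insert.hyps(2) by (intro sum.cong) auto
        moreover have "w' s a * cnj (w' s b) = M a s * M s b / m"
          using mpos herm[of b s] by (simp add: w'_def flip: of_real_mult)
        ultimately have "(\<Sum>r\<in>insert s F. w' r a * cnj (w' r b)) = M a s * M s b / m + M' a b"
          using insert.hyps by simp
        then show ?thesis by (simp add: M'_def)
      qed
      then show ?thesis by blast
    qed
  qed
  from this[of UNIV M, OF finite_class.finite_UNIV assms] show ?thesis by simp
qed

text \<open>
  The reaction term of the complex Hessian flow: \<open>M\<close> is a Levi matrix in the variables \<open>(x, V)\<close>, with
  \<open>Inl\<close> for the point \<open>x\<close> and \<open>Inr\<close> for the vector \<open>V\<close>.
\<close>

definition bform :: "('m \<Rightarrow> 'm \<Rightarrow> real) \<Rightarrow> ('m::finite + 'm \<Rightarrow> 'm + 'm \<Rightarrow> complex) \<Rightarrow>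
    ('m + 'm \<Rightarrow> 'm + 'm \<Rightarrow> complex) \<Rightarrow> complex" where
  "bform J M N = (\<Sum>\<Sum>A B C D. of_real (J A B) * of_real (J C D) *
     (M (Inl A) (Inl C) * N (Inr B) (Inr D) + M (Inl A) (Inr C) * N (Inr B) (Inl D)))"

lemma bform_add_left: "bform J (\<lambda>a b. M a b + M' a b) N = bform J M N + bform J M' N"
  unfolding bform_def sum.distrib[symmetric] by (intro sum.cong refl) (simp add: algebra_simps)

lemma bform_add_right: "bform J M (\<lambda>a b. N a b + N' a b) = bform J M N + bform J M N'"
  unfolding bform_def sum.distrib[symmetric] by (intro sum.cong refl) (simp add: algebra_simps)

lemma bform_scale_left: "bform J (\<lambda>a b. c * M a b) N = c * bform J M N"
  unfolding bform_def sum_distrib_left by (intro sum.cong refl) (simp add: algebra_simps)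

lemma bform_scale_right: "bform J M (\<lambda>a b. c * N a b) = c * bform J M N"
  unfolding bform_def sum_distrib_left by (intro sum.cong refl) (simp add: algebra_simps)

lemma bform_sum_left: "finite I \<Longrightarrow> bform J (\<lambda>a b. \<Sum>k\<in>I. M k a b) N = (\<Sum>k\<in>I. bform J (M k) N)"
proof (induction I rule: finite_induct)
  case empty
  show ?case by (simp add: bform_def)
qed (simp add: bform_add_left)

lemma bform_sum_right: "finite I \<Longrightarrow> bform J M (\<lambda>a b. \<Sum>k\<in>I. N k a b) = (\<Sum>k\<in>I. bform J M (N k))"
proof (induction I rule: finite_induct)
  case empty
  show ?case by (simp add: bform_def)
qed (simp add: bform_add_right)

text \<open>For rank one matrices the sums over A, B and over C, D separate into values of the skew
  pairing \<open>om\<close>. Antisymmetry of J turns the mixed-block term into the subtracted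
  one.\<close>

lemma bform_rank_one:
  fixes w v :: "'m::finite + 'm \<Rightarrow> complex" and J :: "'m \<Rightarrow> 'm \<Rightarrow> real"
  defines "om \<equiv> \<lambda>a b. \<Sum>\<Sum>A B. of_real (J A B) * a A * b B"
  assumes J: "\<And>A B. J B A = - J A B"
  shows "bform J (\<lambda>a b. w a * cnj (w b)) (\<lambda>a b. v a * cnj (v b))
    = om (\<lambda>A. w (Inl A)) (\<lambda>A. v (Inr A)) *
      cnj (om (\<lambda>A. w (Inl A)) (\<lambda>A. v (Inr A)) - om (\<lambda>A. v (Inl A)) (\<lambda>A. w (Inr A)))"
proof -
  have prod: "(\<Sum>\<Sum>A B C D. (of_real (J A B) * a A * b B) * (of_real (J C D) * c C * d D))
     = om a b * om c d" for a b c d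
    unfolding om_def sum_distrib_right unfolding sum_distrib_left ..
  have cnj: "cnj (om a b) = om (\<lambda>A. cnj (a A)) (\<lambda>A. cnj (b A))" for a b
    by (simp add: om_def)
  have anti: "om b a = - om a b" for a b
  proof -
    have "om b a = (\<Sum>\<Sum>B A. of_real (J A B) * b A * a B)"
      unfolding om_def by (rule sum.swap)
    also have "\<dots> = - om a b"
      unfolding om_def sum_negf[symmetric]
    proof (intro sum.cong refl)
      fix A B
      show "of_real (J B A) * b B * a A = - (of_real (J A B) * a A * b B)"
        by (simp add: J[of A B])
    qed
    finally show ?thesis .
  qed
  have "bform J (\<lambda>a b. w a * cnj (w b)) (\<lambda>a b. v a * cnj (v b))
    = om (\<lambda>A. w (Inl A)) (\<lambda>A. v (Inr A)) * om (\<lambda>A. cnj (w (Inl A))) (\<lambda>A. cnj (v (Inr A)))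
     + om (\<lambda>A. w (Inl A)) (\<lambda>A. v (Inr A)) * om (\<lambda>A. cnj (w (Inr A))) (\<lambda>A. cnj (v (Inl A)))"
    unfolding bform_def prod[symmetric] sum.distrib[symmetric]
    by (intro sum.cong refl) (simp add: algebra_simps)
  then show ?thesis
    unfolding complex_cnj_diff cnj anti[of "\<lambda>A. cnj (w (Inr A))"] by (simp add: algebra_simps)
qed

text \<open>With M a sum of rank one matrices, the form is the sum of q_kl times the conjugate of
  q_kl - q_lk. Averaging with k and l exchanged leaves half the sum of the squares of |q_kl - q_lk|;
  it is the mixed blocks that provide the antisymmetrisation.\<close>

lemma bform_psd_nonneg:
  fixes M :: "'m::finite + 'm \<Rightarrow> 'm + 'm \<Rightarrow> complex"
  assumes J: "\<And>A B. J B A = - J A B"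
    and herm: "\<And>a b. M b a = cnj (M a b)"
    and psd: "\<And>x. 0 \<le> Re (\<Sum>\<Sum>a b. M a b * x a * cnj (x b))"
  shows "0 \<le> Re (bform J M M)"
proof -
  from psd_sum_rank_one[of M, OF herm psd]
  obtain w :: "'m + 'm \<Rightarrow> 'm + 'm \<Rightarrow> complex" where "\<forall>a b. M a b = (\<Sum>\<Sum>r. w r a * cnj (w r b))" by (rule exE)
  then have M: "M = (\<lambda>a b. \<Sum>\<Sum>r. w r a * cnj (w r b))" by blast
  define q where "q k l = (\<Sum>\<Sum>A B. complex_of_real (J A B) * w k (Inl A) * w l (Inr B))" for k l
  have "bform J M M = (\<Sum>\<Sum>k l. q k l * cnj (q k l - q l k))"
    unfolding M bform_sum_left[OF finite_class.finite_UNIV] bform_sum_right[OF finite_class.finite_UNIV]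
      bform_rank_one[OF J] q_def ..
  then have re: "Re (bform J M M) = (\<Sum>\<Sum>k l. Re (q k l * cnj (q k l - q l k)))" by simp
  also have "\<dots> = (\<Sum>\<Sum>k l. Re (q l k * cnj (q l k - q k l)))"
    by (rule sum.swap)
  finally have "2 * Re (bform J M M) = (\<Sum>\<Sum>k l. Re (q k l * cnj (q k l - q l k)) + Re (q l k * cnj (q l k - q k l)))"
    using re by (simp add: sum.distrib)
  also have "\<dots> = (\<Sum>\<Sum>k l. (cmod (q k l - q l k))\<^sup>2)"
    unfolding cmod_power2
    by (intro sum.cong refl) (simp add: power2_eq_square algebra_simps)
  also have "\<dots> \<ge> 0" by (intro sum_nonneg) simp
  finally show ?thesis by simp
qed

section \<open>The second derivative test\<close>

lemma second_derivative_nonneg_at_local_min: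
  fixes f f' :: "real \<Rightarrow> real"
  assumes r: "0 < r"
    and f': "\<And>s. \<bar>s\<bar> < r \<Longrightarrow> (f has_real_derivative f' s) (at s)"
    and f'': "(f' has_real_derivative D) (at 0)"
    and min: "\<And>s. \<bar>s\<bar> < r \<Longrightarrow> f 0 \<le> f s"
  shows "0 \<le> D"
proof (rule ccontr)
  assume "\<not> 0 \<le> D"
  have 0: "f' 0 = 0"
    by (rule DERIV_local_min[OF f'[of 0] r]) (use r min in auto)
  obtain d where d: "0 < d" "\<And>h. 0 < h \<Longrightarrow> h < d \<Longrightarrow> f' (0 + h) < f' 0"
    using DERIV_neg_dec_right[OF f''] \<open>\<not> 0 \<le> D\<close> by auto
  define h where "h = min d r / 2"
  have h: "0 < h" "h < d" "h < r" using d r by (auto simp: h_def min_def)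
  have "\<And>s. 0 \<le> s \<Longrightarrow> s \<le> h \<Longrightarrow> (f has_real_derivative f' s) (at s)"
    using f' h by auto
  from MVT2[OF h(1) this] obtain z where z: "0 < z" "z < h" "f h - f 0 = (h - 0) * f' z" by blast
  have "f' z < 0" using d(2)[of z] z h 0 by simp
  then have "f h < f 0" using z(3) mult_pos_neg[OF h(1)] by fastforce
  then show False using min[of h] h by simp
qed

section \<open>Wirtinger derivatives and the Levi form\<close>

datatype 'k pdir = Dz 'k | Dzb 'k | Dt

text \<open>\<open>pvec\<close> and \<open>ivec\<close> are the real and imaginary parts of a
  complexified coordinate field, as in \<partial>_z = (\<partial>_x - i \<partial>_y) / 2 with
  \<partial>_y the direction \<open>\<i>\<close>.\<close>

fun pvec :: "'k pdir \<Rightarrow> (complex^'k::finite) \<times> real" where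
  "pvec (Dz a) = (axis a (1/2), 0)"
| "pvec (Dzb a) = (axis a (1/2), 0)"
| "pvec Dt = (0, 1)"

fun ivec :: "'k pdir \<Rightarrow> (complex^'k::finite) \<times> real" where
  "ivec (Dz a) = (axis a (- \<i>/2), 0)"
| "ivec (Dzb a) = (axis a (\<i>/2), 0)"
| "ivec Dt = (0, 0)"

fun cdir :: "'k pdir \<Rightarrow> 'k pdir" where
  "cdir (Dz a) = Dzb a"
| "cdir (Dzb a) = Dz a"
| "cdir Dt = Dt"

definition pd :: "((complex^'k::finite) \<times> real) set \<Rightarrow> 'k pdir \<Rightarrow>
    ((complex^'k) \<times> real \<Rightarrow> complex) \<Rightarrow> (complex^'k) \<times> real \<Rightarrow> complex" where
  "pd S p f = cd S (pvec p) (ivec p) f"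

definition crd :: "'k::finite \<Rightarrow> (complex^'k) \<times> real \<Rightarrow> complex" where
  "crd a x = fst x $ a"

lemma cdir_vec: "pvec (cdir p) = pvec p" "ivec (cdir p) = - ivec p"
  by (cases p; simp add: axis_def vec_eq_iff)+

lemma bounded_linear_crd: "bounded_linear (crd a)"
  unfolding crd_def by (rule bounded_linear_compose[OF bounded_linear_vec_nth bounded_linear_fst])

locale chart_dom = smooth_dom S for S :: "((complex^'k::finite) \<times> real) set"
begin

lemma pd_smooth [simp]: "smooth_on S f \<Longrightarrow> smooth_on S (pd S p f)"
  by (simp add: pd_def)

lemma pd_cong: "(\<And>x. x \<in> S \<Longrightarrow> f x = g x) \<Longrightarrow> pd S p f = pd S p g"
  unfolding pd_def by (rule cd_cong)

lemma pd_const [simp]: "pd S p (\<lambda>x. c) = (\<lambda>x. 0)"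
  by (simp add: pd_def)

lemma pd_add [simp]: "smooth_on S f \<Longrightarrow> smooth_on S g \<Longrightarrow>
   pd S p (\<lambda>x. f x + g x) = (\<lambda>x. pd S p f x + pd S p g x)"
  by (simp add: pd_def)

lemma pd_mult [simp]: "smooth_on S f \<Longrightarrow> smooth_on S g \<Longrightarrow>
   pd S p (\<lambda>x. f x * g x) = (\<lambda>x. pd S p f x * g x + f x * pd S p g x)"
  by (simp add: pd_def)

lemma pd_cnj [simp]: "smooth_on S f \<Longrightarrow> pd S p (\<lambda>x. cnj (f x)) = (\<lambda>x. cnj (pd S (cdir p) f x))"
  by (simp add: pd_def cdir_vec)

lemma pd_minus [simp]: "smooth_on S f \<Longrightarrow> pd S p (\<lambda>x. - f x) = (\<lambda>x. - pd S p f x)"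
  by (simp add: pd_def)

lemma pd_diff [simp]: "smooth_on S f \<Longrightarrow> smooth_on S g \<Longrightarrow>
   pd S p (\<lambda>x. f x - g x) = (\<lambda>x. pd S p f x - pd S p g x)"
  by (simp add: pd_def)

lemma pd_sum [simp]: "(\<And>i. i \<in> I \<Longrightarrow> smooth_on S (f i)) \<Longrightarrow>
   pd S p (\<lambda>x. \<Sum>i\<in>I. f i x) = (\<lambda>x. \<Sum>i\<in>I. pd S p (f i) x)"
  by (simp add: pd_def)

lemma smooth_divide_const [simp]: "smooth_on S f \<Longrightarrow> smooth_on S (\<lambda>x. f x / c)" for f :: "_ \<Rightarrow> complex"
  using smooth_mult[OF _ smooth_on_const[of "inverse c"], of f] by (simp add: divide_inverse)

lemma pd_divide_const [simp]: "smooth_on S f \<Longrightarrow> pd S p (\<lambda>x. f x / c) = (\<lambda>x. pd S p f x / c)"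
  using pd_mult[of f "\<lambda>x. inverse c"] by (simp add: divide_inverse)

lemma pd_commute: "smooth_on S f \<Longrightarrow> pd S p (pd S q f) = pd S q (pd S p f)"
  unfolding pd_def by (rule cd_commute)

lemma smooth_crd [simp]: "smooth_on S (crd a)"
  by (rule smooth_linear[OF bounded_linear_crd])

text \<open>The derivative of a coordinate is the indicator of S, not a constant, since derivatives
  are 0 off S; second derivatives have to get past these indicators.\<close>

lemma smooth_ind [simp]: "smooth_on S (\<lambda>x. if x \<in> S then c else 0)"
  by (rule iffD1[OF smooth_on_cong smooth_on_const[of c]]) simp

lemma pd_ind [simp]: "pd S p (\<lambda>x. if x \<in> S then c else 0) = (\<lambda>x. 0)"
  using pd_cong[of "\<lambda>x. if x \<in> S then c else 0" "\<lambda>x. c" p] by simp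

lemma smooth_ind_conj [simp]: "smooth_on S (\<lambda>x. if x \<in> S \<and> q then c else 0)"
  by (cases q) simp_all

lemma pd_ind_conj [simp]: "pd S p (\<lambda>x. if x \<in> S \<and> q then c else 0) = (\<lambda>x. 0)"
  by (cases q) simp_all

lemma pd_crd:
  "pd S p (crd a) = (\<lambda>x. if x \<in> S then (case p of Dz b \<Rightarrow> if a = b then 1 else 0 | _ \<Rightarrow> 0) else 0)"
  by (cases p) (auto simp: pd_def cd_def dd_linear[OF bounded_linear_crd] crd_def axis_def fun_eq_iff)

lemma pd_crd_simps [simp]:
  "pd S (Dz b) (crd a) = (\<lambda>x. if x \<in> S \<and> a = b then 1 else 0)"
  "pd S (Dzb b) (crd a) = (\<lambda>x. 0)"
  "pd S Dt (crd a) = (\<lambda>x. 0)"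
  by (auto simp: pd_crd)

lemma dd_axis:
  assumes "smooth_on S f"
  shows "dd S (axis a z, 0) f x = Re z *\<^sub>R dd S (axis a 1, 0) f x + Im z *\<^sub>R dd S (axis a \<i>, 0) f x"
proof -
  have "(axis a z, 0 :: real) = Re z *\<^sub>R (axis a 1, 0) + Im z *\<^sub>R (axis a \<i>, 0)"
    by (auto simp: axis_def vec_eq_iff complex_eq_iff)
  then show ?thesis by (simp only: dd_dir_add[OF assms] dd_dir_scale[OF assms])
qed

lemma dd_dir_sum:
  assumes "smooth_on S f" "finite I"
  shows "dd S (\<Sum>i\<in>I. v i) f x = (\<Sum>i\<in>I. dd S (v i) f x)"
  using assms(2) by (induction I) (auto simp: dd_dir_zero[OF assms(1)] dd_dir_add[OF assms(1)])

lemma dd_vec: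
  assumes "smooth_on S f"
  shows "dd S (d, 0) f x = (\<Sum>\<Sum>a. Re (d $ a) *\<^sub>R dd S (axis a 1, 0) f x + Im (d $ a) *\<^sub>R dd S (axis a \<i>, 0) f x)"
proof -
  have "d = (\<Sum>\<Sum>a. axis a (d $ a))"
    by (simp add: vec_eq_iff axis_def)
  then have "(d, 0 :: real) = (\<Sum>\<Sum>a. (axis a (d $ a), 0))"
    by (simp add: prod_eq_iff fst_sum snd_sum)
  then have "dd S (d, 0) f x = dd S (\<Sum>\<Sum>a. (axis a (d $ a), 0)) f x"
    by (rule arg_cong)
  also have "\<dots> = (\<Sum>\<Sum>a. dd S (axis a (d $ a), 0) f x)"
    by (rule dd_dir_sum[OF assms finite_class.finite_UNIV])
  also have "\<dots> = (\<Sum>\<Sum>a. Re (d $ a) *\<^sub>R dd S (axis a 1, 0) f x + Im (d $ a) *\<^sub>R dd S (axis a \<i>, 0) f x)"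
    by (intro sum.cong refl dd_axis assms)
  finally show ?thesis .
qed

lemma sum_dz:
  assumes "smooth_on S f"
  shows "(\<Sum>\<Sum>a. W $ a * pd S (Dz a) f x) = (dd S (W, 0) f x - \<i> * dd S (\<i> *s W, 0) f x) / 2"
proof -
  let ?p = "\<lambda>a. dd S (axis a 1, 0) f x" and ?q = "\<lambda>a. dd S (axis a \<i>, 0) f x"
  have "W $ a * pd S (Dz a) f x = ((Re (W $ a) *\<^sub>R ?p a + Im (W $ a) *\<^sub>R ?q a)
     - \<i> * (Re ((\<i> *s W) $ a) *\<^sub>R ?p a + Im ((\<i> *s W) $ a) *\<^sub>R ?q a)) / 2" for a
    unfolding pd_def cd_def pvec.simps ivec.simps
      dd_axis[OF assms, of _ "1/2"] dd_axis[OF assms, of _ "- \<i> / 2"]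
    by (simp add: complex_eq_iff field_simps)
  then show ?thesis
    unfolding dd_vec[OF assms, of W] dd_vec[OF assms, of "\<i> *s W"]
    by (simp only: sum_divide_distrib sum_distrib_left sum_subtractf[symmetric])
qed

lemma sum_dzb:
  assumes "smooth_on S f"
  shows "(\<Sum>\<Sum>a. cnj (W $ a) * pd S (Dzb a) f x) = (dd S (W, 0) f x + \<i> * dd S (\<i> *s W, 0) f x) / 2"
proof -
  let ?p = "\<lambda>a. dd S (axis a 1, 0) f x" and ?q = "\<lambda>a. dd S (axis a \<i>, 0) f x"
  have "cnj (W $ a) * pd S (Dzb a) f x = ((Re (W $ a) *\<^sub>R ?p a + Im (W $ a) *\<^sub>R ?q a)
     + \<i> * (Re ((\<i> *s W) $ a) *\<^sub>R ?p a + Im ((\<i> *s W) $ a) *\<^sub>R ?q a)) / 2" for a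
    unfolding pd_def cd_def pvec.simps ivec.simps
      dd_axis[OF assms, of _ "1/2"] dd_axis[OF assms, of _ "\<i> / 2"]
    by (simp add: complex_eq_iff field_simps)
  then show ?thesis
    unfolding dd_vec[OF assms, of W] dd_vec[OF assms, of "\<i> *s W"]
    by (simp only: sum_divide_distrib sum_distrib_left sum.distrib[symmetric])
qed

text \<open>The Levi form is a quarter of the Laplacian on the complex line spanned by W: it
  composes (D_W - i D_iW) / 2 with its conjugate, and the cross terms cancel because D_W and D_iW
  commute. A minimum in the complex sense is thereby reduced to two real second derivative
  tests.\<close>

lemma levi_form_eq:
  assumes f: "smooth_on S f"
  shows "(\<Sum>\<Sum>a b. pd S (Dz a) (pd S (Dzb b) f) x * W $ a * cnj (W $ b))
    = (dd S (W, 0) (dd S (W, 0) f) x + dd S (\<i> *s W, 0) (dd S (\<i> *s W, 0) f) x) / 4"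
proof -
  define g where "g = (\<lambda>x. (dd S (W, 0) f x + \<i> * dd S (\<i> *s W, 0) f x) * (1 / 2))"
  have g: "smooth_on S g"
    unfolding g_def by (intro smooth_mult smooth_add smooth_on_const dd_smooth f)
  have "(\<Sum>\<Sum>a b. pd S (Dz a) (pd S (Dzb b) f) x * W $ a * cnj (W $ b))
    = (\<Sum>\<Sum>a. W $ a * pd S (Dz a) (\<lambda>x. \<Sum>\<Sum>b. cnj (W $ b) * pd S (Dzb b) f x) x)"
    using f by (simp add: sum_distrib_left mult_ac)
  also have "(\<lambda>x. \<Sum>\<Sum>b. cnj (W $ b) * pd S (Dzb b) f x) = g"
    unfolding sum_dzb[OF f] g_def by auto
  also have "(\<Sum>\<Sum>a. W $ a * pd S (Dz a) g x) = (dd S (W, 0) g x - \<i> * dd S (\<i> *s W, 0) g x) / 2"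
    by (rule sum_dz[OF g])
  finally have main: "(\<Sum>\<Sum>a b. pd S (Dz a) (pd S (Dzb b) f) x * W $ a * cnj (W $ b))
    = (dd S (W, 0) g x - \<i> * dd S (\<i> *s W, 0) g x) / 2" .
  have dg: "dd S v g x = (dd S v (dd S (W, 0) f) x + \<i> * dd S v (dd S (\<i> *s W, 0) f) x) / 2" for v
    unfolding g_def using f by (simp only: dd_mult dd_add dd_const dd_smooth smooth_add smooth_mult smooth_on_const) simp
  show ?thesis
    unfolding main dg using dd_commute[OF f, of "(W, 0)" "(\<i> *s W, 0)"]
    by (simp add: algebra_simps add_divide_distrib diff_divide_distrib)
qed

lemma second_derivative_nonneg:
  assumes f: "smooth_on S f" and x: "(y, t) \<in> interior S" and r: "0 < r"
    and min: "\<And>y'. dist y' y < r \<Longrightarrow> Re (f (y, t)) \<le> Re (f (y', t))"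
  shows "0 \<le> Re (dd S (d, 0) (dd S (d, 0) f) (y, t))"
proof -
  obtain e where e: "0 < e" "ball (y, t) e \<subseteq> interior S"
    using x open_interior open_contains_ball by blast
  define q where "q = min r e / (norm d + 1)"
  have nd: "0 < norm d + 1" by (simp add: add_nonneg_pos)
  have q: "0 < q" using r e nd by (simp add: q_def)
  have small: "norm (s *\<^sub>R d) < min r e" if "\<bar>s\<bar> < q" for s
  proof -
    have "norm (s *\<^sub>R d) \<le> \<bar>s\<bar> * (norm d + 1)"
      by (simp add: mult_left_mono)
    also have "\<dots> < q * (norm d + 1)" using that nd by (intro mult_strict_right_mono)
    also have "\<dots> = min r e" using nd by (simp add: q_def)
    finally show ?thesis .
  qed
  have int: "(y, t) + s *\<^sub>R (d, 0) \<in> interior S" if "\<bar>s\<bar> < q" for s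
    using e(2) small[OF that] by (auto simp: dist_norm norm_Pair subset_eq)
  let ?F = "\<lambda>s. Re (f ((y, t) + s *\<^sub>R (d, 0)))"
  let ?F' = "\<lambda>s. Re (dd S (d, 0) f ((y, t) + s *\<^sub>R (d, 0)))"
  show ?thesis
  proof (rule second_derivative_nonneg_at_local_min[of q ?F ?F'])
    show "0 < q" by (rule q)
    fix s :: real assume s: "\<bar>s\<bar> < q"
    show "(?F has_real_derivative ?F' s) (at s)"
      using has_real_derivative_dd[OF f int[OF s] bounded_linear_Re, of "(d, 0)"]
        DERIV_shift[of ?F "?F' s" 0 s]
      by (simp add: scaleR_left_distrib add.assoc add.left_commute algebra_simps)
    show "?F 0 \<le> ?F s"
      using min[of "y + s *\<^sub>R d"] small[OF s] by (simp add: dist_norm)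
  next
    show "(?F' has_real_derivative Re (dd S (d, 0) (dd S (d, 0) f) (y, t))) (at 0)"
      by (rule has_real_derivative_dd[OF dd_smooth[OF f] x bounded_linear_Re])
  qed
qed

lemma levi_form_nonneg_at_local_min:
  assumes f: "smooth_on S f" and x: "(y, t) \<in> interior S" and r: "0 < r"
    and min: "\<And>y'. dist y' y < r \<Longrightarrow> Re (f (y, t)) \<le> Re (f (y', t))"
  shows "0 \<le> Re (\<Sum>\<Sum>a b. pd S (Dz a) (pd S (Dzb b) f) (y, t) * W a * cnj (W b))"
proof -
  let ?d = "\<chi> a. W a"
  have eq: "(\<Sum>\<Sum>a b. pd S (Dz a) (pd S (Dzb b) f) (y, t) * W a * cnj (W b))
    = (dd S (?d, 0) (dd S (?d, 0) f) (y, t) + dd S (\<i> *s ?d, 0) (dd S (\<i> *s ?d, 0) f) (y, t)) / 4"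
    using levi_form_eq[OF f, of "(y, t)" ?d] by (simp only: vec_lambda_beta)
  show ?thesis
    unfolding eq using second_derivative_nonneg[OF f x r min, of ?d]
      second_derivative_nonneg[OF f x r min, of "\<i> *s ?d"] by simp
qed

lemma levi_form_hermitian:
  assumes f: "smooth_on S f" and real: "\<And>x. x \<in> S \<Longrightarrow> cnj (f x) = f x"
  shows "pd S (Dz b) (pd S (Dzb a) f) x = cnj (pd S (Dz a) (pd S (Dzb b) f) x)"
proof -
  have "pd S (Dzb a) f = pd S (Dzb a) (\<lambda>x. cnj (f x))" for a
    by (rule pd_cong) (simp add: real)
  then have "pd S (Dzb a) f = (\<lambda>x. cnj (pd S (Dz a) f x))" for a
    using f by simp
  then have "pd S (Dz b) (pd S (Dzb a) f) x = cnj (pd S (Dzb b) (pd S (Dz a) f) x)"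
    using f by simp
  then show ?thesis
    using pd_commute[OF f, of "Dzb b" "Dz a"] by simp
qed

lemma dd_scale_vec:
  "smooth_on S f \<Longrightarrow> dd S (r *\<^sub>R W, 0) f x = of_real r * dd S (W, 0) f x"
  using dd_dir_scale[of f r "(W, 0)" x] by (simp add: scaleR_conv_of_real)

lemma sum_dz_cd:
  assumes "smooth_on S f"
  shows "(\<Sum>\<Sum>a. W $ a * pd S (Dz a) f x) = cd S ((1/2) *\<^sub>R W, 0) (- (1/2) *\<^sub>R (\<i> *s W), 0) f x"
  unfolding sum_dz[OF assms] cd_def dd_scale_vec[OF assms] by (simp add: field_simps)

lemma sum_dzb_cd:
  assumes "smooth_on S f"
  shows "(\<Sum>\<Sum>a. cnj (W $ a) * pd S (Dzb a) f x) = cd S ((1/2) *\<^sub>R W, 0) ((1/2) *\<^sub>R (\<i> *s W), 0) f x"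
  unfolding sum_dzb[OF assms] cd_def dd_scale_vec[OF assms] by (simp add: field_simps)

text \<open>The blocks of the Levi matrix of a form quadratic in the fibre coordinates
  \<open>e A\<close>, with coefficients constant along the fibre. The embedding e is arbitrary
  because this serves twice: for \<open>N0\<close>, quadratic in V, and for u, quadratic in
  \<alpha>.\<close>

lemma levi_quadratic:
  fixes F :: "'i::finite \<Rightarrow> 'i \<Rightarrow> (complex^'k) \<times> real \<Rightarrow> complex" and e :: "'i \<Rightarrow> 'k"
  defines "q \<equiv> \<lambda>x. \<Sum>\<Sum>A C. F A C x * (crd (e A) x * cnj (crd (e C) x))"
  assumes F [simp]: "\<And>A C. smooth_on S (F A C)"
    and vert [simp]: "\<And>A B C. pd S (Dz (e B)) (F A C) = (\<lambda>x. 0)"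
    and vertb [simp]: "\<And>A B C. pd S (Dzb (e B)) (F A C) = (\<lambda>x. 0)"
    and x: "x \<in> S" and e: "inj e" and a: "\<And>A. e A \<noteq> a" and c: "\<And>A. e A \<noteq> c"
  shows "pd S (Dz a) (pd S (Dzb c) q) x =
      (\<Sum>\<Sum>E E'. pd S (Dz a) (pd S (Dzb c) (F E E')) x * (crd (e E) x * cnj (crd (e E') x)))"
    and "pd S (Dz a) (pd S (Dzb (e C)) q) x = (\<Sum>\<Sum>E. pd S (Dz a) (F E C) x * crd (e E) x)"
    and "pd S (Dz (e B)) (pd S (Dzb c) q) x = (\<Sum>\<Sum>E. pd S (Dzb c) (F B E) x * cnj (crd (e E) x))"
    and "pd S (Dz (e B)) (pd S (Dzb (e D)) q) x = F B D x"
    and "pd S Dt q x = (\<Sum>\<Sum>E E'. pd S Dt (F E E') x * (crd (e E) x * cnj (crd (e E') x)))"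
proof -
  note q_def [simp] and a [simp] and c [simp]
  have inj [simp]: "e A = e B \<longleftrightarrow> A = B" for A B
    using e by (simp add: inj_eq)
  have h: "pd S (Dzb c) q =
     (\<lambda>x. \<Sum>\<Sum>E E'. pd S (Dzb c) (F E E') x * (crd (e E) x * cnj (crd (e E') x)))"
    by simp
  have v: "pd S r (pd S (Dzb (e C)) q) = pd S r (\<lambda>x. \<Sum>\<Sum>E. F E C x * crd (e E) x)" for r C
  proof (rule pd_cong)
    fix x assume "x \<in> S"
    have "pd S (Dzb (e C)) q x = (\<Sum>\<Sum>E E'. F E E' x * (crd (e E) x *
        cnj (if x \<in> S \<and> E' = C then 1 else 0)))"
      by simp
    also have "\<dots> = (\<Sum>\<Sum>E E'. if E' = C then F E E' x * crd (e E) x else 0)"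
      using \<open>x \<in> S\<close> by (intro sum.cong refl) auto
    finally show "pd S (Dzb (e C)) q x = (\<Sum>\<Sum>E. F E C x * crd (e E) x)" by simp
  qed
  show "pd S (Dz a) (pd S (Dzb c) q) x =
      (\<Sum>\<Sum>E E'. pd S (Dz a) (pd S (Dzb c) (F E E')) x * (crd (e E) x * cnj (crd (e E') x)))"
    unfolding h by simp
  show "pd S (Dz a) (pd S (Dzb (e C)) q) x = (\<Sum>\<Sum>E. pd S (Dz a) (F E C) x * crd (e E) x)"
    unfolding v by simp
  have vert2: "pd S (Dz (e B)) (pd S (Dzb c) (F E E')) = (\<lambda>x. 0)" for E E'
    using pd_commute[of "F E E'" "Dz (e B)" "Dzb c"] by simp
  have "pd S (Dz (e B)) (pd S (Dzb c) q) x = (\<Sum>\<Sum>E E'. pd S (Dzb c) (F E E') x * ((if x \<in> S \<and> E = B then 1 else 0) * cnj (crd (e E') x)))"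
    unfolding h using vert2 by (simp del: q_def)
  also have "\<dots> = (\<Sum>\<Sum>E E'. if E = B then pd S (Dzb c) (F E E') x * cnj (crd (e E') x) else 0)"
    using x by (intro sum.cong refl) auto
  also have "\<dots> = (\<Sum>\<Sum>E. pd S (Dzb c) (F B E) x * cnj (crd (e E) x))"
    by (subst sum.swap) simp
  finally show "pd S (Dz (e B)) (pd S (Dzb c) q) x = (\<Sum>\<Sum>E. pd S (Dzb c) (F B E) x * cnj (crd (e E) x))" .
  have "pd S (Dz (e B)) (pd S (Dzb (e D)) q) x = (\<Sum>\<Sum>E. F E D x * (if x \<in> S \<and> E = B then 1 else 0))"
    unfolding v by simp
  also have "\<dots> = (\<Sum>\<Sum>E. if E = B then F E D x else 0)"
    using x by (intro sum.cong refl) auto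
  finally show "pd S (Dz (e B)) (pd S (Dzb (e D)) q) x = F B D x" by simp
  show "pd S Dt q x = (\<Sum>\<Sum>E E'. pd S Dt (F E E') x * (crd (e E) x * cnj (crd (e E') x)))"
    by simp
qed

end

section \<open>The flow of the complex Hessian\<close>

lemma sum_swap_2_4:
  "(\<Sum>\<Sum>E F A B C D. f A B C D E F) =
   (\<Sum>\<Sum>A B C D E F. (f A B C D E F :: complex))"
proof -
  have "(\<Sum>\<Sum>F A B C D. g A B C D F) =
   (\<Sum>\<Sum>A B C D F. (g A B C D F :: complex))"
    for g
    by (subst sum.swap, rule sum.cong[OF refl], subst sum.swap, rule sum.cong[OF refl],
        subst sum.swap, rule sum.cong[OF refl], subst sum.swap, rule refl)
  note * = this
  have "(\<Sum>\<Sum>E F A B C D. f A B C D E F)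
    = (\<Sum>\<Sum>E A B C D F. f A B C D E F)"
    by (rule sum.cong[OF refl], rule *)
  also have "\<dots> = (\<Sum>\<Sum>A B C D E F. f A B C D E F)"
    by (rule *)
  finally show ?thesis .
qed

text \<open>The part of the argument that knows nothing of metrics: J is any constant skew matrix, u
  depends on the \<open>Inl\<close> coordinates and time only, and the \<open>Inr\<close>
  coordinates carry the tangent vector V.\<close>

locale hessian_flow = chart_dom S for S :: "((complex^('m::finite + 'm)) \<times> real) set" +
  fixes J :: "'m \<Rightarrow> 'm \<Rightarrow> real" and u :: "(complex^('m + 'm)) \<times> real \<Rightarrow> complex"
  assumes J: "\<And>A B. J B A = - J A B"
    and u: "smooth_on S u"
    and u_real: "\<And>x. x \<in> S \<Longrightarrow> cnj (u x) = u x"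
    and u_vert: "\<And>A. pd S (Dz (Inr A)) u = (\<lambda>x. 0)"
    and flow: "\<And>x. x \<in> S \<Longrightarrow> pd S Dt u x =
      1/2 * (\<Sum>\<Sum>A B C D. of_real (J A B) * of_real (J C D) *
        (pd S (Dz (Inl A)) (pd S (Dzb (Inl C)) u) x * pd S (Dz (Inl B)) (pd S (Dzb (Inl D)) u) x))"
begin

definition P :: "'m \<Rightarrow> 'm \<Rightarrow> (complex^('m + 'm)) \<times> real \<Rightarrow> complex" where
  "P A C = pd S (Dz (Inl A)) (pd S (Dzb (Inl C)) u)"

definition N0 :: "(complex^('m + 'm)) \<times> real \<Rightarrow> complex" where
  "N0 = (\<lambda>x. \<Sum>\<Sum>A C. P A C x * (crd (Inr A) x * cnj (crd (Inr C) x)))"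

definition levi :: "((complex^('m + 'm)) \<times> real \<Rightarrow> complex) \<Rightarrow> (complex^('m + 'm)) \<times> real \<Rightarrow>
    'm + 'm \<Rightarrow> 'm + 'm \<Rightarrow> complex" where
  "levi f x a b = pd S (Dz a) (pd S (Dzb b) f) x"

lemma P_smooth [simp]: "smooth_on S (P A C)"
  by (simp add: P_def u)

lemma N0_smooth: "smooth_on S N0"
  by (simp add: N0_def)

lemma u_vert_bar: "pd S (Dzb (Inr A)) u = (\<lambda>x. 0)"
proof -
  have "pd S (Dzb (Inr A)) u = pd S (Dzb (Inr A)) (\<lambda>x. cnj (u x))"
    by (rule pd_cong) (simp add: u_real)
  then show ?thesis using u by (simp add: u_vert)
qed

lemma P_vert [simp]: "pd S (Dz (Inr B)) (P A C) = (\<lambda>x. 0)" "pd S (Dzb (Inr B)) (P A C) = (\<lambda>x. 0)"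
proof -
  have "pd S q (P A C) = pd S (Dz (Inl A)) (pd S (Dzb (Inl C)) (pd S q u))" for q
    unfolding P_def by (simp add: pd_commute[of _ q] u)
  then show "pd S (Dz (Inr B)) (P A C) = (\<lambda>x. 0)" "pd S (Dzb (Inr B)) (P A C) = (\<lambda>x. 0)"
    by (simp_all add: u_vert u_vert_bar)
qed

text \<open>P is a complex Hessian, so its derivatives are symmetric in all unbarred and in all
  barred indices. This symmetry is what matches gradient terms with the mixed Levi blocks.\<close>

lemma P_swap_z: "pd S (Dz (Inl E)) (P A C) = pd S (Dz (Inl A)) (P E C)"
  unfolding P_def by (rule pd_commute) (simp add: u)

lemma P_swap_zb: "pd S (Dzb (Inl F)) (P A C) = pd S (Dzb (Inl C)) (P A F)"
proof -
  have "pd S (Dzb (Inl F)) (P A C) = pd S (Dz (Inl A)) (pd S (Dzb (Inl F)) (pd S (Dzb (Inl C)) u))"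
    unfolding P_def by (rule pd_commute) (simp add: u)
  also have "pd S (Dzb (Inl F)) (pd S (Dzb (Inl C)) u) = pd S (Dzb (Inl C)) (pd S (Dzb (Inl F)) u)"
    by (rule pd_commute[OF u])
  also have "pd S (Dz (Inl A)) \<dots> = pd S (Dzb (Inl C)) (P A F)"
    unfolding P_def by (rule pd_commute) (simp add: u)
  finally show ?thesis .
qed

lemma P_hermitian: "P C A x = cnj (P A C x)"
  unfolding P_def by (rule levi_form_hermitian[OF u u_real])

lemma N0_real: "cnj (N0 x) = N0 x"
proof -
  have "cnj (N0 x) = (\<Sum>\<Sum>A C. P C A x * (crd (Inr C) x * cnj (crd (Inr A) x)))"
    by (simp add: N0_def P_hermitian[symmetric] mult_ac)
  also have "\<dots> = N0 x" unfolding N0_def by (rule sum.swap)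
  finally show ?thesis .
qed

lemma levi_N0:
  assumes x: "x \<in> S"
  shows "levi N0 x (Inl A) (Inl C) =
      (\<Sum>\<Sum>E F. pd S (Dz (Inl A)) (pd S (Dzb (Inl C)) (P E F)) x * (crd (Inr E) x * cnj (crd (Inr F) x)))"
    and "levi N0 x (Inl A) (Inr C) = (\<Sum>\<Sum>E. pd S (Dz (Inl A)) (P E C) x * crd (Inr E) x)"
    and "levi N0 x (Inr B) (Inl D) = (\<Sum>\<Sum>F. pd S (Dzb (Inl D)) (P B F) x * cnj (crd (Inr F) x))"
    and "levi N0 x (Inr B) (Inr D) = P B D x"
  unfolding levi_def N0_def
  by (rule levi_quadratic(1)[of P Inr] levi_quadratic(2)[of P Inr _ _ "Inl A"]
      levi_quadratic(3)[of P Inr _ "Inl D"] levi_quadratic(4)[of P Inr _ "Inl A" "Inl A"]; simp add: x)+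

text \<open>Two derivatives of the product of P A C and P B D give four terms. They agree in pairs
  under exchanging (A, C) with (B, D), as the two signs from J cancel; this uses up the factor 1/2
  of the flow.\<close>

lemma pd_Dt_P:
  assumes x: "x \<in> S"
  shows "pd S Dt (P E F) x = (\<Sum>\<Sum>A B C D. of_real (J A B) * of_real (J C D) *
    (pd S (Dz (Inl E)) (pd S (Dzb (Inl F)) (P A C)) x * P B D x
     + pd S (Dz (Inl E)) (P A C) x * pd S (Dzb (Inl F)) (P B D) x))"
proof -
  let ?c = "\<lambda>A B C D. complex_of_real (J A B) * of_real (J C D)"
  have alg: "c * (a * p + b * d + (e * f + q * g)) = c * (a * p + e * f) + c * (g * q + d * b)"
    for a b c d e f g p q :: complex
    by (simp add: algebra_simps)
  have 1: "pd S Dt (P E F) = pd S (Dz (Inl E)) (pd S (Dzb (Inl F)) (pd S Dt u))"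
    unfolding P_def by (simp add: pd_commute[of _ Dt] u)
  have 2: "pd S (Dzb (Inl F)) (pd S Dt u) = pd S (Dzb (Inl F)) (\<lambda>x. 1/2 * (\<Sum>\<Sum>A B C D. ?c A B C D * (P A C x * P B D x)))"
    by (rule pd_cong) (simp only: flow P_def)
  have "pd S Dt (P E F) x = 1/2 * (\<Sum>\<Sum>A B C D. ?c A B C D *
      (pd S (Dz (Inl E)) (pd S (Dzb (Inl F)) (P A C)) x * P B D x
       + pd S (Dzb (Inl F)) (P A C) x * pd S (Dz (Inl E)) (P B D) x
       + (pd S (Dz (Inl E)) (P A C) x * pd S (Dzb (Inl F)) (P B D) x
       + P A C x * pd S (Dz (Inl E)) (pd S (Dzb (Inl F)) (P B D)) x)))"
    unfolding 1 2 by simp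
  also have "\<dots> = 1/2 * ((\<Sum>\<Sum>A B C D. ?c A B C D *
      (pd S (Dz (Inl E)) (pd S (Dzb (Inl F)) (P A C)) x * P B D x
       + pd S (Dz (Inl E)) (P A C) x * pd S (Dzb (Inl F)) (P B D) x))
     + (\<Sum>\<Sum>A B C D. ?c A B C D *
      (pd S (Dz (Inl E)) (pd S (Dzb (Inl F)) (P B D)) x * P A C x
       + pd S (Dz (Inl E)) (P B D) x * pd S (Dzb (Inl F)) (P A C) x)))"
    (is "_ = 1/2 * (?L + ?R)")
    unfolding sum.distrib[symmetric] 
    by (rule arg_cong[where f = "\<lambda>z. 1/2 * z"]) (intro sum.cong refl, rule alg)
  also have "?R = (\<Sum>\<Sum>B A D C. ?c A B C D *
      (pd S (Dz (Inl E)) (pd S (Dzb (Inl F)) (P B D)) x * P A C x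
       + pd S (Dz (Inl E)) (P B D) x * pd S (Dzb (Inl F)) (P A C) x))"
    by (subst sum.swap, rule sum.cong[OF refl], rule sum.cong[OF refl], rule sum.swap)
  also have "\<dots> = ?L"
  proof (intro sum.cong refl)
    fix A B C D
    show "?c B A D C * (pd S (Dz (Inl E)) (pd S (Dzb (Inl F)) (P A C)) x * P B D x
       + pd S (Dz (Inl E)) (P A C) x * pd S (Dzb (Inl F)) (P B D) x)
      = ?c A B C D * (pd S (Dz (Inl E)) (pd S (Dzb (Inl F)) (P A C)) x * P B D x
       + pd S (Dz (Inl E)) (P A C) x * pd S (Dzb (Inl F)) (P B D) x)"
      by (simp add: J[of A B] J[of C D])
  qed
  finally show ?thesis by simp
qed

text \<open>The indices E, F contracted with V come from the outer derivatives. Symmetry of the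
  derivatives of u exchanges them with indices of P, after which each factor is a block of the Levi
  matrix of \<open>N0\<close>. V is independent of x, so it contributes no derivatives of its
  own.\<close>

lemma N0_evolution:
  assumes x: "x \<in> S"
  shows "pd S Dt N0 x = bform J (levi N0 x) (levi N0 x)"
proof -
  let ?c = "\<lambda>A B C D. complex_of_real (J A B) * of_real (J C D)"
  let ?V = "\<lambda>E. crd (Inr E) x"
  have swap2: "pd S (Dz (Inl E)) (pd S (Dzb (Inl F)) (P A C)) = pd S (Dz (Inl A)) (pd S (Dzb (Inl C)) (P E F))" for A C E F
  proof -
    have "pd S (Dz (Inl E)) (pd S (Dzb (Inl F)) (P A C)) = pd S (Dzb (Inl C)) (pd S (Dz (Inl E)) (P A F))"
      unfolding P_swap_zb[of F A C] by (rule pd_commute) simp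
    also have "\<dots> = pd S (Dz (Inl A)) (pd S (Dzb (Inl C)) (P E F))"
      unfolding P_swap_z[of E A F] by (rule pd_commute) simp
    finally show ?thesis .
  qed
  have "pd S Dt N0 x = (\<Sum>\<Sum>E F. pd S Dt (P E F) x * (?V E * cnj (?V F)))"
    unfolding N0_def by simp
  also have "\<dots> = (\<Sum>\<Sum>E F A B C D. ?c A B C D *
    (pd S (Dz (Inl E)) (pd S (Dzb (Inl F)) (P A C)) x * P B D x
     + pd S (Dz (Inl E)) (P A C) x * pd S (Dzb (Inl F)) (P B D) x) * (?V E * cnj (?V F)))"
    unfolding pd_Dt_P[OF x] sum_distrib_right ..
  also have "\<dots> = (\<Sum>\<Sum>A B C D E F. ?c A B C D *
    (pd S (Dz (Inl E)) (pd S (Dzb (Inl F)) (P A C)) x * P B D x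
     + pd S (Dz (Inl E)) (P A C) x * pd S (Dzb (Inl F)) (P B D) x) * (?V E * cnj (?V F)))"
    by (rule sum_swap_2_4)
  also have "\<dots> = bform J (levi N0 x) (levi N0 x)"
    unfolding bform_def levi_N0[OF x]
  proof (intro sum.cong refl)
    fix A B C D
    have "(\<Sum>\<Sum>E F. ?c A B C D *
    (pd S (Dz (Inl E)) (pd S (Dzb (Inl F)) (P A C)) x * P B D x
     + pd S (Dz (Inl E)) (P A C) x * pd S (Dzb (Inl F)) (P B D) x) * (?V E * cnj (?V F)))
     = (\<Sum>\<Sum>E F. ?c A B C D *
    (pd S (Dz (Inl A)) (pd S (Dzb (Inl C)) (P E F)) x * (?V E * cnj (?V F)) * P B D x
     + (pd S (Dz (Inl A)) (P E C) x * ?V E) * (pd S (Dzb (Inl D)) (P B F) x * cnj (?V F))))"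
      unfolding swap2[of _ _ A C] P_swap_z[of _ A C] P_swap_zb[of _ B D]
      by (intro sum.cong refl) (simp add: algebra_simps)
    also have "\<dots> = ?c A B C D *
     ((\<Sum>\<Sum>E F. pd S (Dz (Inl A)) (pd S (Dzb (Inl C)) (P E F)) x * (?V E * cnj (?V F))) * P B D x
       + (\<Sum>\<Sum>E. pd S (Dz (Inl A)) (P E C) x * ?V E) * (\<Sum>\<Sum>F. pd S (Dzb (Inl D)) (P B F) x * cnj (?V F)))"
      unfolding sum_product unfolding sum_distrib_right sum.distrib[symmetric] sum_distrib_left ..
    finally show "(\<Sum>\<Sum>E F. ?c A B C D *
    (pd S (Dz (Inl E)) (pd S (Dzb (Inl F)) (P A C)) x * P B D x
     + pd S (Dz (Inl E)) (P A C) x * pd S (Dzb (Inl F)) (P B D) x) * (?V E * cnj (?V F))) = \<dots>" .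
  qed
  finally show ?thesis .
qed

text \<open>At a spatial minimum of \<open>N0 + \<delta> K\<close> the Levi matrix \<open>levi N0 + \<delta> levi K\<close> is positive
  semidefinite; the error of replacing it by \<open>levi N0\<close> in the quadratic reaction term is what remains.\<close>

lemma critical_point_inequality:
  fixes \<delta> :: real and K :: "(complex^('m + 'm)) \<times> real \<Rightarrow> complex"
  assumes K: "smooth_on S K" and K_real: "\<And>x. x \<in> S \<Longrightarrow> cnj (K x) = K x"
    and x: "(y, t) \<in> interior S" and r: "0 < r"
    and min: "\<And>y'. dist y' y < r \<Longrightarrow> Re (N0 (y, t) + \<delta> * K (y, t)) \<le> Re (N0 (y', t) + \<delta> * K (y', t))"
  shows "0 \<le> Re (pd S Dt N0 (y, t)) +
     \<delta> * Re (bform J (levi N0 (y, t)) (levi K (y, t)) + bform J (levi K (y, t)) (levi N0 (y, t)))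
     + \<delta>\<^sup>2 * Re (bform J (levi K (y, t)) (levi K (y, t)))"
proof -
  let ?x = "(y, t)" and ?N = "\<lambda>x. N0 x + of_real \<delta> * K x"
  have xS: "?x \<in> S" using x interior_subset by blast
  have N: "smooth_on S ?N" using K N0_smooth by simp
  have N_real: "cnj (?N x) = ?N x" if "x \<in> S" for x
    using that by (simp add: N0_real K_real)
  have M: "levi ?N ?x = (\<lambda>a b. levi N0 ?x a b + of_real \<delta> * levi K ?x a b)"
    using K N0_smooth by (simp add: levi_def fun_eq_iff)
  have "0 \<le> Re (bform J (levi ?N ?x) (levi ?N ?x))"
  proof (rule bform_psd_nonneg[OF J])
    show "levi ?N ?x b a = cnj (levi ?N ?x a b)" for a b
      unfolding levi_def by (rule levi_form_hermitian[OF N N_real])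
    show "0 \<le> Re (\<Sum>\<Sum>a b. levi ?N ?x a b * w a * cnj (w b))" for w
      unfolding levi_def by (rule levi_form_nonneg_at_local_min[OF N x r min])
  qed
  also have "bform J (levi ?N ?x) (levi ?N ?x) = pd S Dt N0 ?x
      + of_real \<delta> * (bform J (levi N0 ?x) (levi K ?x) + bform J (levi K ?x) (levi N0 ?x))
      + of_real \<delta> * (of_real \<delta> * bform J (levi K ?x) (levi K ?x))"
    unfolding M bform_add_left bform_add_right bform_scale_left bform_scale_right N0_evolution[OF xS]
    by (simp add: algebra_simps)
  finally show ?thesis by (simp add: power2_eq_square)
qed

end

section \<open>The evolution of the inverse metric\<close>

text \<open>Conjugate linear in the first vector, so that a left factor moves into that argument as
  its adjoint (\<open>qf_mult_left\<close>).\<close>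

definition qf :: "complex^'n^'n \<Rightarrow> complex^'n \<Rightarrow> complex^'n \<Rightarrow> complex" where
  "qf X a b = (\<Sum>\<Sum>i j. cnj (a $ i) * X $ i $ j * b $ j)"

lemma sum_swap_2_2:
  "(\<Sum>\<Sum>m n p s. f p s m n)
     = (\<Sum>\<Sum>m n p s. f m n p s :: complex)"
proof -
  have "(\<Sum>\<Sum>n p s. f p s m n) = (\<Sum>\<Sum>p s n. f p s m n)" for m
    by (subst sum.swap, rule sum.cong[OF refl], rule sum.swap)
  then have "(\<Sum>\<Sum>m n p s. f p s m n)
      = (\<Sum>\<Sum>m p s n. f p s m n)" by simp
  also have "\<dots> = (\<Sum>\<Sum>p s m n. f p s m n)"
    by (subst sum.swap, rule sum.cong[OF refl], rule sum.swap)
  finally show ?thesis .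
qed

lemma qf_mult_right: "qf (X ** Y) a b = qf X a (Y *v b)"
proof -
  have "(\<Sum>\<Sum>j. cnj (a $ i) * (\<Sum>\<Sum>k. X $ i $ k * Y $ k $ j) * b $ j)
      = (\<Sum>\<Sum>k. cnj (a $ i) * X $ i $ k * (\<Sum>\<Sum>j. Y $ k $ j * b $ j))" for i
    unfolding sum_distrib_left sum_distrib_right
    by (subst sum.swap) (simp add: mult_ac)
  then show ?thesis
    unfolding qf_def matrix_matrix_mult_def matrix_vector_mult_def by simp
qed

lemma qf_mult_left:
  assumes "\<And>i j. X' $ j $ i = cnj (X $ i $ j)"
  shows "qf (X ** Y) a b = qf Y (X' *v a) b"
proof -
  have "qf (X ** Y) a b = (\<Sum>\<Sum>j i k. cnj (a $ i) * X $ i $ k * Y $ k $ j * b $ j)"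
    unfolding qf_def matrix_matrix_mult_def
    by (subst sum.swap) (simp add: sum_distrib_left sum_distrib_right mult_ac)
  also have "\<dots> = (\<Sum>\<Sum>j k i. cnj (a $ i) * X $ i $ k * Y $ k $ j * b $ j)"
    by (rule sum.cong[OF refl], rule sum.swap)
  also have "\<dots> = qf Y (X' *v a) b"
    unfolding qf_def matrix_vector_mult_def
    by (subst (2) sum.swap) (simp add: sum_distrib_left sum_distrib_right mult_ac assms)
  finally show ?thesis .
qed

lemma qf_add: "qf (X + Y) a b = qf X a b + qf Y a b"
  and qf_diff: "qf (X - Y) a b = qf X a b - qf Y a b"
  and qf_minus: "qf (- X) a b = - qf X a b"
  unfolding qf_def sum.distrib[symmetric] sum_subtractf[symmetric] sum_negf[symmetric]
  by (intro sum.cong refl; simp add: algebra_simps)+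

lemma qf_diff_left: "qf X (a - a') b = qf X a b - qf X a' b"
  and qf_diff_right: "qf X a (b - b') = qf X a b - qf X a b'"
  unfolding qf_def sum.distrib[symmetric] sum_subtractf[symmetric] sum_negf[symmetric]
  by (intro sum.cong refl; simp add: algebra_simps)+

text \<open>On the left stands the complex Hessian of u at (v, \<beta>), with the derivatives of H
  expressed by those of its inverse G. The term \<open>H ** G2 ** H ** G1 ** H\<close> is the norm
  of \<open>G1 *v (H *v \<alpha>)\<close> and completes the square in \<beta>; what remains is the
  Chern curvature matrix at \<open>H *v \<alpha>\<close>.\<close>

lemma levi_square_completion:
  fixes H G1 G2 G12 :: "complex^'n^'n"
  assumes H: "\<And>i j. H $ j $ i = cnj (H $ i $ j)"
    and G: "\<And>i j. G1 $ j $ i = cnj (G2 $ i $ j)"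
  shows "qf (H ** G1 ** H ** G2 ** H + H ** G2 ** H ** G1 ** H - H ** G12 ** H) \<alpha> \<alpha>
      + qf (- (H ** G1 ** H)) \<beta> \<alpha> + qf (- (H ** G2 ** H)) \<alpha> \<beta> + qf H \<beta> \<beta>
    = qf (G1 ** H ** G2 - G12) (H *v \<alpha>) (H *v \<alpha>)
      + qf H (\<beta> - G1 *v (H *v \<alpha>)) (\<beta> - G1 *v (H *v \<alpha>))"
proof -
  let ?a = "H *v \<alpha>"
  note qH = qf_mult_left[of H H, OF H] and qG = qf_mult_left[of G1 G2, OF G]
  have "qf (H ** G1 ** H ** G2 ** H) \<alpha> \<alpha> = qf (H ** (G1 ** H ** G2 ** H)) \<alpha> \<alpha>"
    by (simp only: matrix_mul_assoc)
  then have 1: "qf (H ** G1 ** H ** G2 ** H) \<alpha> \<alpha> = qf (G1 ** H ** G2) ?a ?a"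
    unfolding qH by (simp only: qf_mult_right[of _ H])
  have "qf (H ** G2 ** H ** G1 ** H) \<alpha> \<alpha> = qf (H ** (G2 ** (H ** G1 ** H))) \<alpha> \<alpha>"
    by (simp only: matrix_mul_assoc)
  also have "\<dots> = qf (H ** G1 ** H) (G1 *v ?a) \<alpha>"
    by (subst qH, subst qG) (rule refl)
  finally have 2: "qf (H ** G2 ** H ** G1 ** H) \<alpha> \<alpha> = qf H (G1 *v ?a) (G1 *v ?a)"
    by (simp only: qf_mult_right)
  have "qf (H ** G12 ** H) \<alpha> \<alpha> = qf (H ** (G12 ** H)) \<alpha> \<alpha>"
    by (simp only: matrix_mul_assoc)
  then have 3: "qf (H ** G12 ** H) \<alpha> \<alpha> = qf G12 ?a ?a"
    unfolding qH by (simp only: qf_mult_right[of _ H])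
  have 4: "qf (H ** G1 ** H) \<beta> \<alpha> = qf H \<beta> (G1 *v ?a)"
    by (simp only: qf_mult_right)
  have "qf (H ** G2 ** H) \<alpha> \<beta> = qf (H ** (G2 ** H)) \<alpha> \<beta>"
    by (simp only: matrix_mul_assoc)
  then have 5: "qf (H ** G2 ** H) \<alpha> \<beta> = qf H (G1 *v ?a) \<beta>"
    unfolding qH qG .
  note 1 2 3 4 5
  then show ?thesis
    by (simp add: qf_add qf_diff qf_minus qf_diff_left qf_diff_right)
qed

lemma sandwich_entry: "(H ** X ** H) $ a $ b = (\<Sum>\<Sum>i j. H $ a $ i * X $ i $ j * (H :: complex^'n^'n) $ j $ b)"
  unfolding matrix_matrix_mult_def by (simp add: sum_distrib_right) (rule sum.swap)

lemma sandwich_add_diff: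
  fixes H :: "complex^'n^'n"
  shows "(H ** (X + Y - Z) ** H) $ a $ b = (H ** X ** H) $ a $ b + (H ** Y ** H) $ a $ b - (H ** Z ** H) $ a $ b"
  unfolding sandwich_entry sum.distrib[symmetric] sum_subtractf[symmetric]
  by (intro sum.cong refl) (simp add: algebra_simps)

lemma sandwich_sum:
  fixes H :: "complex^'n^'n"
  shows "(\<Sum>\<Sum>i j. H $ a $ i * (\<Sum>m\<in>I. \<Sum>n\<in>K. c m n * X m n $ i $ j) * H $ j $ b)
    = (\<Sum>m\<in>I. \<Sum>n\<in>K. c m n * (H ** X m n ** H) $ a $ b)"
proof -
  have "(\<Sum>\<Sum>i j. H $ a $ i * (\<Sum>m\<in>I. \<Sum>n\<in>K. c m n * X m n $ i $ j) * H $ j $ b)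
    = (\<Sum>\<Sum>i j. \<Sum>m\<in>I. \<Sum>n\<in>K. c m n * (H $ a $ i * X m n $ i $ j * H $ j $ b))"
    by (simp add: sum_distrib_left sum_distrib_right mult_ac)
  also have "\<dots> = (\<Sum>\<Sum>i. \<Sum>m\<in>I. \<Sum>\<Sum>j. \<Sum>n\<in>K. c m n * (H $ a $ i * X m n $ i $ j * H $ j $ b))"
    by (rule sum.cong[OF refl], rule sum.swap)
  also have "\<dots> = (\<Sum>m\<in>I. \<Sum>\<Sum>i j. \<Sum>n\<in>K. c m n * (H $ a $ i * X m n $ i $ j * H $ j $ b))"
    by (rule sum.swap)
  also have "\<dots> = (\<Sum>m\<in>I. \<Sum>\<Sum>i. \<Sum>n\<in>K. \<Sum>\<Sum>j. c m n * (H $ a $ i * X m n $ i $ j * H $ j $ b))"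
    by (rule sum.cong[OF refl], rule sum.cong[OF refl], rule sum.swap)
  also have "\<dots> = (\<Sum>m\<in>I. \<Sum>n\<in>K. \<Sum>\<Sum>i j. c m n * (H $ a $ i * X m n $ i $ j * H $ j $ b))"
    by (rule sum.cong[OF refl], rule sum.swap)
  finally show ?thesis
    unfolding sandwich_entry sum_distrib_left .
qed

lemma sandwich_torsion:
  fixes H :: "complex^'n^'n"
  shows "(\<Sum>\<Sum>i j. H $ a $ i * (\<Sum>\<Sum>m s n p. H $ n $ m * H $ s $ p * G1 m $ p $ j * G2 s $ i $ n) * H $ j $ b)
    = (\<Sum>\<Sum>m s. (H ** G2 s ** H) $ a $ m * (H ** G1 m ** H) $ s $ b)"
proof -
  have "(\<Sum>\<Sum>i j. H $ a $ i * (\<Sum>\<Sum>m s n p. H $ n $ m * H $ s $ p * G1 m $ p $ j * G2 s $ i $ n) * H $ j $ b)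
    = (\<Sum>\<Sum>i j m s n p. (H $ a $ i * G2 s $ i $ n * H $ n $ m) * (H $ s $ p * G1 m $ p $ j * H $ j $ b))"
    by (simp add: sum_distrib_left sum_distrib_right mult_ac)
  also have "\<dots> = (\<Sum>\<Sum>m s n p i j. (H $ a $ i * G2 s $ i $ n * H $ n $ m) * (H $ s $ p * G1 m $ p $ j * H $ j $ b))"
    by (rule sum_swap_2_4)
  also have "\<dots> = (\<Sum>\<Sum>m s. (\<Sum>\<Sum>n i. H $ a $ i * G2 s $ i $ n * H $ n $ m)
      * (\<Sum>\<Sum>p j. H $ s $ p * G1 m $ p $ j * H $ j $ b))"
  proof (rule sum.cong[OF refl], rule sum.cong[OF refl])
    fix m s
    show "(\<Sum>\<Sum>n p i j. (H $ a $ i * G2 s $ i $ n * H $ n $ m) * (H $ s $ p * G1 m $ p $ j * H $ j $ b))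
     = (\<Sum>\<Sum>n i. H $ a $ i * G2 s $ i $ n * H $ n $ m)
      * (\<Sum>\<Sum>p j. H $ s $ p * G1 m $ p $ j * H $ j $ b)"
      unfolding sum_product ..
  qed
  also have "\<dots> = (\<Sum>\<Sum>m s. (H ** G2 s ** H) $ a $ m * (H ** G1 m ** H) $ s $ b)"
    unfolding sandwich_entry by (subst (3) sum.swap) (rule refl)
  finally show ?thesis .
qed

text \<open>The inverse metric \<open>H\<close> evolves by the "Lie bracket square" of itself: the terms of \<open>S2\<close> and of
  the torsion quadratic combine, after lowering both indices, into the second derivatives of \<open>H\<close>.\<close>

lemma inverse_metric_flow_algebra:
  fixes H :: "complex^'n^'n" and G1 G2 :: "'n \<Rightarrow> complex^'n^'n" and G12 :: "'n \<Rightarrow> 'n \<Rightarrow> complex^'n^'n"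
  defines "S \<equiv> \<lambda>i j. \<Sum>\<Sum>m n. H $ n $ m * (G1 m ** H ** G2 n - G12 m n) $ i $ j"
    and "Q \<equiv> \<lambda>i j. 1/2 * (\<Sum>\<Sum>m n p s. H $ n $ m * H $ s $ p *
        (G1 m $ p $ j - G1 p $ m $ j) * (G2 n $ i $ s - G2 s $ i $ n))"
  shows "(H ** (\<chi> i j. S i j + Q i j) ** H) $ a $ b =
     (\<Sum>\<Sum>m n. H $ n $ m *
        (H ** G1 m ** H ** G2 n ** H + H ** G2 n ** H ** G1 m ** H - H ** G12 m n ** H) $ a $ b)
     - (\<Sum>\<Sum>m n. (H ** G1 m ** H) $ n $ b * (H ** G2 n ** H) $ a $ m)"
proof -
  define q where "q i j = (\<Sum>\<Sum>m n p s. H $ n $ m * H $ s $ p *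
        G1 m $ p $ j * (G2 n $ i $ s - G2 s $ i $ n))" for i j
  \<comment> \<open>The product of two antisymmetrised factors is invariant under exchanging (m, n)
    with (p, s). So one factor may be left unsymmetrised at the price of the 1/2.\<close>
  have Qq: "Q i j = q i j" for i j
  proof -
    have "2 * Q i j = (\<Sum>\<Sum>m n p s. H $ n $ m * H $ s $ p *
        (G1 m $ p $ j - G1 p $ m $ j) * (G2 n $ i $ s - G2 s $ i $ n))"
      by (simp add: Q_def)
    also have "\<dots> = q i j + (\<Sum>\<Sum>m n p s. H $ s $ p * H $ n $ m *
        G1 p $ m $ j * (G2 s $ i $ n - G2 n $ i $ s))"
      unfolding q_def sum.distrib[symmetric] by (intro sum.cong refl) (simp add: algebra_simps)
    also have "(\<Sum>\<Sum>m n p s. H $ s $ p * H $ n $ m *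
        G1 p $ m $ j * (G2 s $ i $ n - G2 n $ i $ s)) = q i j"
      unfolding q_def by (rule sum_swap_2_2)
    finally show ?thesis by simp
  qed
  \<comment> \<open>The first sum supplies the ordering G2 H G1 that S2 lacks for becoming a second
    derivative of H; the second one becomes the product of first derivatives of H.\<close>
  have q_split: "q i j = (\<Sum>\<Sum>m n. H $ n $ m * (G2 n ** H ** G1 m) $ i $ j)
     - (\<Sum>\<Sum>m s n p. H $ n $ m * H $ s $ p * G1 m $ p $ j * G2 s $ i $ n)" for i j
  proof -
    have "q i j = (\<Sum>\<Sum>m n p s. H $ n $ m * (G2 n $ i $ s * H $ s $ p * G1 m $ p $ j))
      - (\<Sum>\<Sum>m n p s. H $ n $ m * H $ s $ p * G1 m $ p $ j * G2 s $ i $ n)"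
      unfolding q_def sum_subtractf[symmetric] by (intro sum.cong refl) (simp add: algebra_simps)
    also have "(\<Sum>\<Sum>m n p s. H $ n $ m * (G2 n $ i $ s * H $ s $ p * G1 m $ p $ j))
      = (\<Sum>\<Sum>m n. H $ n $ m * (G2 n ** H ** G1 m) $ i $ j)"
      unfolding matrix_matrix_mult_def by (simp add: sum_distrib_left sum_distrib_right)
    also have "(\<Sum>\<Sum>m n p s. H $ n $ m * H $ s $ p * G1 m $ p $ j * G2 s $ i $ n)
      = (\<Sum>\<Sum>m s n p. H $ n $ m * H $ s $ p * G1 m $ p $ j * G2 s $ i $ n)"
    proof (rule sum.cong[OF refl])
      fix m
      have "(\<Sum>\<Sum>n p s. H $ n $ m * H $ s $ p * G1 m $ p $ j * G2 s $ i $ n)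
        = (\<Sum>\<Sum>n s p. H $ n $ m * H $ s $ p * G1 m $ p $ j * G2 s $ i $ n)"
        by (rule sum.cong[OF refl], rule sum.swap)
      also have "\<dots> = (\<Sum>\<Sum>s n p. H $ n $ m * H $ s $ p * G1 m $ p $ j * G2 s $ i $ n)"
        by (rule sum.swap)
      finally show "(\<Sum>\<Sum>n p s. H $ n $ m * H $ s $ p * G1 m $ p $ j * G2 s $ i $ n) = \<dots>" .
    qed
    finally show ?thesis .
  qed
  let ?R = "\<lambda>i j. \<Sum>\<Sum>m s n p. H $ n $ m * H $ s $ p * G1 m $ p $ j * G2 s $ i $ n"
  have SQ: "S i j + Q i j = (\<Sum>\<Sum>m n. H $ n $ m * (G1 m ** H ** G2 n + G2 n ** H ** G1 m - G12 m n) $ i $ j)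
    - ?R i j" for i j
    unfolding S_def Qq q_split by (simp add: algebra_simps sum.distrib sum_subtractf)
  have "(H ** (\<chi> i j. S i j + Q i j) ** H) $ a $ b
    = (\<Sum>\<Sum>i j. H $ a $ i * (\<Sum>\<Sum>m n. H $ n $ m * (G1 m ** H ** G2 n + G2 n ** H ** G1 m - G12 m n) $ i $ j) * H $ j $ b)
      - (\<Sum>\<Sum>i j. H $ a $ i * ?R i j * H $ j $ b)"
    unfolding sandwich_entry vec_lambda_beta SQ by (simp only: right_diff_distrib left_diff_distrib sum_subtractf)
  also have "\<dots> = (\<Sum>\<Sum>m n. H $ n $ m * (H ** (G1 m ** H ** G2 n + G2 n ** H ** G1 m - G12 m n) ** H) $ a $ b)
      - (\<Sum>\<Sum>m s. (H ** G2 s ** H) $ a $ m * (H ** G1 m ** H) $ s $ b)"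
    unfolding sandwich_sum sandwich_torsion ..
  finally show ?thesis
    by (simp add: sandwich_add_diff matrix_mul_assoc mult.commute)
qed

section \<open>Space-time cylinders as domains of differentiation\<close>

lemma time_int_interior: "0 < t \<Longrightarrow> ereal t < \<tau> \<Longrightarrow> t \<in> interior (time_int \<tau>)"
proof -
  assume t: "0 < t" "ereal t < \<tau>"
  obtain c where c: "ereal t < ereal c" "ereal c < \<tau>"
    using t(2) ereal_dense2 by blast
  have "{0<..<c} \<subseteq> time_int \<tau>"
    using c(2) order.strict_trans[of "ereal _" "ereal c" \<tau>] by (auto simp: time_int_def)
  moreover have "t \<in> {0<..<c}" using t c by simp
  ultimately show ?thesis using interior_maximal open_greaterThanLessThan by blast
qed

text \<open>The interval is open on the right, so a small forward step is possible at every time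
  including t = 0, and it always lands in the interior.\<close>

lemma time_int_right:
  assumes "t \<in> time_int \<tau>" "0 < e"
  shows "\<exists>d. 0 < d \<and> d < e \<and> t + d \<in> time_int \<tau> \<and> t + d \<in> interior (time_int \<tau>)"
proof -
  obtain c where c: "ereal t < ereal c" "ereal c < \<tau>"
    using assms(1) ereal_dense2 unfolding time_int_def by blast
  define d where "d = min e (c - t) / 2"
  have d: "0 < d" "d < e" "t + d < c" using assms(2) c(1) by (auto simp: d_def min_def field_simps)
  have "ereal (t + d) < \<tau>" using d(3) c(2) by (meson ereal_less_eq(3) less_imp_le order.strict_trans1)
  moreover have "0 < t + d" using assms(1) d(1) by (simp add: time_int_def add_nonneg_pos)
  ultimately have "t + d \<in> interior (time_int \<tau>)" by (intro time_int_interior)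
  then show ?thesis using d interior_subset by blast
qed

lemma smooth_dom_cylinder:
  fixes U :: "'e::euclidean_space set"
  assumes U: "open U"
  shows "smooth_dom (U \<times> time_int \<tau>)"
proof
  fix x i :: "'e \<times> real" and e :: real
  assume x: "x \<in> U \<times> time_int \<tau>" and i: "i \<in> Basis" and e: "0 < e"
  obtain z t where [simp]: "x = (z, t)" by (cases x)
  have z: "z \<in> U" and t: "t \<in> time_int \<tau>" using x by auto
  from i consider j where "j \<in> Basis" "i = (j, 0)" | "i = (0, 1)"
    by (auto simp: Basis_prod_def)
  then show "\<exists>d. 0 < \<bar>d\<bar> \<and> \<bar>d\<bar> < e \<and> x + d *\<^sub>R i \<in> U \<times> time_int \<tau>"
  proof cases
    case 1
    obtain r where r: "0 < r" "ball z r \<subseteq> U" using U z open_contains_ball by blast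
    define d where "d = min e r / 2"
    have d: "0 < d" "d < e" "d < r" using e r by (auto simp: d_def min_def)
    have "z + d *\<^sub>R j \<in> ball z r" using d 1 by (simp add: dist_norm)
    then show ?thesis using d r t 1 by (intro exI[of _ d]) auto
  next
    case 2
    obtain d where "0 < d" "d < e" "t + d \<in> time_int \<tau>" using time_int_right[OF t e] by blast
    then show ?thesis using 2 z by (intro exI[of _ d]) auto
  qed
next
  show "U \<times> time_int \<tau> \<subseteq> closure (interior (U \<times> time_int \<tau>))"
  proof
    fix x assume x: "x \<in> U \<times> time_int \<tau>"
    have "snd x \<in> closure (interior (time_int \<tau>))"
      unfolding closure_approachable
    proof (intro allI impI)
      fix e :: real assume "0 < e"
      then obtain d where "0 < d" "d < e" "snd x + d \<in> interior (time_int \<tau>)"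
        using time_int_right[of "snd x" \<tau> e] x by auto
      then show "\<exists>y\<in>interior (time_int \<tau>). dist y (snd x) < e"
        by (intro bexI[of _ "snd x + d"]) (auto simp: dist_real_def)
    qed
    moreover have "fst x \<in> closure U" using x closure_subset[of U] by auto
    ultimately show "x \<in> closure (interior (U \<times> time_int \<tau>))"
      unfolding interior_Times interior_open[OF U] closure_Times by (simp add: mem_Times_iff)
  qed
qed

text \<open>Differentiation is done on families of entry functions, algebra on matrices;
  \<open>mx\<close> passes from the first to the second.\<close>

definition mx :: "('n \<Rightarrow> 'n \<Rightarrow> 'x \<Rightarrow> complex) \<Rightarrow> 'x \<Rightarrow> complex^'n^'n" where
  "mx F x = (\<chi> i j. F i j x)"

lemma mx_nth [simp]: "mx F x $ i $ j = F i j x"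
  by (simp add: mx_def)

text \<open>Cramer's rule exhibits the entries of the inverse as rational functions of the entries
  of A; smoothness of the inverse metric is read off from it.\<close>

lemma matrix_inverse_cramer:
  fixes A B :: "complex^'n^'n"
  assumes "B ** A = mat 1" "A ** B = mat 1"
  shows "det A \<noteq> 0" "B $ p $ j = det (\<chi> i l. if l = p then (if i = j then 1 else 0) else A $ i $ l) / det A"
proof -
  have "det A * det B = 1" using assms(2) det_mul det_I by metis
  then show d: "det A \<noteq> 0" by auto
  have "A *v (B *v axis j 1) = axis j 1"
    by (simp add: matrix_vector_mul_assoc assms(2) matrix_vector_mul_lid)
  then have "B *v axis j 1 = (\<chi> k. det (\<chi> i l. if l = k then axis j 1 $ i else A $ i $ l) / det A)"
    using cramer[OF d] by blast
  then have "(B *v axis j 1) $ p = det (\<chi> i l. if l = p then axis j 1 $ i else A $ i $ l) / det A"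
    by simp
  moreover have "(B *v axis j 1) $ p = B $ p $ j"
    by (simp add: matrix_vector_mult_def axis_def if_distrib cong: if_cong)
  ultimately show "B $ p $ j = det (\<chi> i l. if l = p then (if i = j then 1 else 0) else A $ i $ l) / det A"
    by (simp add: axis_def cong: if_cong)
qed

section \<open>Families of Hermitian matrices and their inverses\<close>

locale herm_family =
  fixes U :: "(complex^'n::finite) set" and \<tau> :: ereal and G :: "'n \<Rightarrow> 'n \<Rightarrow> (complex^'n) \<times> real \<Rightarrow> complex"
  assumes U: "open U"
    and G_smooth [simp]: "smooth_on (U \<times> time_int \<tau>) (G i j)"
    and G_herm: "x \<in> U \<times> time_int \<tau> \<Longrightarrow> cnj (G i j x) = G j i x"
    and G_pos: "x \<in> U \<times> time_int \<tau> \<Longrightarrow> v \<noteq> 0 \<Longrightarrow> 0 < Re (qf (mx G x) v v)"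
begin

abbreviation D0 :: "((complex^'n) \<times> real) set" where "D0 \<equiv> U \<times> time_int \<tau>"

sublocale b: chart_dom D0
  by (simp add: chart_dom_def smooth_dom_cylinder U)

text \<open>The plain inverse matrix. In the normalisation of \<open>met_inv\<close> the component
  of index k and barred index l is \<open>H l k\<close>, hence the transposed indices in later
  sums.\<close>

definition H :: "'n \<Rightarrow> 'n \<Rightarrow> (complex^'n) \<times> real \<Rightarrow> complex" where
  "H i j x = matrix_inv (mx G x) $ i $ j"

text \<open>The complex direction is a parameter so that the same formulas for derivatives of H
  serve coordinate directions and directions given by a vector v.\<close>

definition dm :: "((complex^'n) \<times> real) \<times> ((complex^'n) \<times> real) \<Rightarrow>
    ('n \<Rightarrow> 'n \<Rightarrow> (complex^'n) \<times> real \<Rightarrow> complex) \<Rightarrow> (complex^'n) \<times> real \<Rightarrow> complex^'n^'n" where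
  "dm q F = mx (\<lambda>i j. cd D0 (fst q) (snd q) (F i j))"

definition ddm :: "((complex^'n) \<times> real) \<times> ((complex^'n) \<times> real) \<Rightarrow>
    ((complex^'n) \<times> real) \<times> ((complex^'n) \<times> real) \<Rightarrow>
    ('n \<Rightarrow> 'n \<Rightarrow> (complex^'n) \<times> real \<Rightarrow> complex) \<Rightarrow> (complex^'n) \<times> real \<Rightarrow> complex^'n^'n" where
  "ddm q q' F = mx (\<lambda>i j. cd D0 (fst q) (snd q) (cd D0 (fst q') (snd q') (F i j)))"

lemma H_G:
  assumes "x \<in> D0"
  shows "mx H x ** mx G x = mat 1" "mx G x ** mx H x = mat 1"
proof -
  have "v = 0" if "mx G x *v v = 0" for v
  proof (rule ccontr)
    assume "v \<noteq> 0"
    have "qf (mx G x) v v = qf (mat 1 ** mx G x) v v" by simp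
    also have "\<dots> = 0" unfolding qf_mult_right that by (simp add: qf_def)
    finally show False using G_pos[OF assms \<open>v \<noteq> 0\<close>] by simp
  qed
  then have "invertible (mx G x)"
    using matrix_left_invertible_ker invertible_left_inverse by blast
  then have "mx G x ** matrix_inv (mx G x) = mat 1 \<and> matrix_inv (mx G x) ** mx G x = mat 1"
    unfolding invertible_def matrix_inv_def by (rule someI_ex)
  moreover have "mx H x = matrix_inv (mx G x)"
    by (simp add: vec_eq_iff H_def)
  ultimately show "mx H x ** mx G x = mat 1" "mx G x ** mx H x = mat 1"
    by simp_all
qed

lemma H_herm:
  assumes x: "x \<in> D0"
  shows "H j i x = cnj (H i j x)"
proof -
  define H' where "H' = (\<chi> i j. cnj (H j i x))"
  have "(H' ** mx G x) $ i $ j = cnj ((mx G x ** mx H x) $ j $ i)" for i j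
    using x by (simp add: H'_def matrix_matrix_mult_def G_herm mult.commute)
  then have "H' ** mx G x = mat 1"
    unfolding H_G(2)[OF x] by (simp add: vec_eq_iff mat_def)
  then have "H' ** (mx G x ** mx H x) = mx H x"
    by (simp add: matrix_mul_assoc matrix_mul_lid)
  then have "H' = mx H x"
    by (simp add: H_G(2)[OF x] matrix_mul_rid)
  then have "H' $ j $ i = H j i x" by simp
  then show ?thesis by (simp add: H'_def)
qed

lemma det_smooth:
  assumes "\<And>i j. smooth_on D0 (F i j)"
  shows "smooth_on D0 (\<lambda>x. det (mx F x))"
  unfolding det_def using assms
  by (intro b.smooth_sum b.smooth_mult b.smooth_on_const b.smooth_prod) simp

lemma H_smooth [simp]: "smooth_on D0 (H p j)"
proof -
  define F where "F i l x = (if l = p then (if i = j then 1 else 0) else G i l x)" for i l x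
  have F: "smooth_on D0 (F i l)" for i l
  proof -
    have "F i l = (if l = p then (\<lambda>x. if i = j then 1 else 0) else G i l)"
      by (auto simp: F_def fun_eq_iff)
    then show ?thesis by simp
  qed
  have "H p j x = det (mx F x) * inverse (det (mx G x))" if "x \<in> D0" for x
  proof -
    have "(\<chi> i l. if l = p then (if i = j then 1 else 0) else mx G x $ i $ l) = mx F x"
      by (simp add: vec_eq_iff F_def)
    then show ?thesis
      using matrix_inverse_cramer(2)[OF H_G[OF that], of p j] by (simp add: divide_inverse)
  qed
  moreover have "smooth_on D0 (\<lambda>x. det (mx F x) * inverse (det (mx G x)))"
    using matrix_inverse_cramer(1)[OF H_G]
    by (intro b.smooth_mult b.smooth_inverse det_smooth F G_smooth) auto
  ultimately show ?thesis
    using smooth_on_cong by (metis (no_types, lifting))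
qed

lemma H_G_sum: "x \<in> D0 \<Longrightarrow> (\<Sum>\<Sum>l. H i l x * G l j x) = (if i = j then 1 else 0)"
  using arg_cong[OF H_G(1), of x "\<lambda>M. M $ i $ j"] by (simp add: matrix_matrix_mult_def mat_def)

lemma mult_right_inverse_eq:
  assumes "x \<in> D0" "A ** mx G x = B"
  shows "A = B ** mx H x"
  using assms H_G(2)[OF assms(1)] by (metis matrix_mul_assoc matrix_mul_rid)

text \<open>Differentiates H G = 1. The identity holds on \<open>D0\<close> only, which suffices
  because derivatives within \<open>D0\<close> ignore other values.\<close>

lemma dm_H:
  assumes x: "x \<in> D0"
  shows "dm q H x = - (mx H x ** dm q G x ** mx H x)"
proof -
  have "cd D0 (fst q) (snd q) (\<lambda>x. \<Sum>\<Sum>l. H i l x * G l j x) = cd D0 (fst q) (snd q) (\<lambda>x. if i = j then 1 else 0)" for i j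
    by (rule b.cd_cong) (rule H_G_sum)
  then have "cd D0 (fst q) (snd q) (\<lambda>x. \<Sum>\<Sum>l. H i l x * G l j x) x = 0" for i j
    by simp
  then have "(\<Sum>\<Sum>l. cd D0 (fst q) (snd q) (H i l) x * G l j x + H i l x * cd D0 (fst q) (snd q) (G l j) x) = 0" for i j
    by simp
  then have "dm q H x ** mx G x = - (mx H x ** dm q G x)"
    by (simp add: vec_eq_iff matrix_matrix_mult_def dm_def sum.distrib eq_neg_iff_add_eq_0)
  from mult_right_inverse_eq[OF x this]
  show ?thesis by (simp add: vec_eq_iff matrix_matrix_mult_def sum_negf)
qed

lemma ddm_H:
  assumes x: "x \<in> D0"
  shows "ddm q q' H x = mx H x ** dm q G x ** mx H x ** dm q' G x ** mx H x
     + mx H x ** dm q' G x ** mx H x ** dm q G x ** mx H x - mx H x ** ddm q q' G x ** mx H x"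
proof -
  have "cd D0 (fst q') (snd q') (\<lambda>x. \<Sum>\<Sum>l. H i l x * G l j x) = cd D0 (fst q') (snd q') (\<lambda>x. if i = j then 1 else 0)" for i j
    by (rule b.cd_cong) (rule H_G_sum)
  then have "cd D0 (fst q) (snd q) (cd D0 (fst q') (snd q') (\<lambda>x. \<Sum>\<Sum>l. H i l x * G l j x)) x = 0" for i j
    by simp
  then have "(\<Sum>\<Sum>l. cd D0 (fst q) (snd q) (cd D0 (fst q') (snd q') (H i l)) x * G l j x + cd D0 (fst q') (snd q') (H i l) x * cd D0 (fst q) (snd q) (G l j) x
     + (cd D0 (fst q) (snd q) (H i l) x * cd D0 (fst q') (snd q') (G l j) x + H i l x * cd D0 (fst q) (snd q) (cd D0 (fst q') (snd q') (G l j)) x)) = 0" for i j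
    by simp
  then have "ddm q q' H x ** mx G x = - (dm q' H x ** dm q G x) - dm q H x ** dm q' G x - mx H x ** ddm q q' G x"
    by (simp add: vec_eq_iff matrix_matrix_mult_def dm_def ddm_def sum.distrib eq_neg_iff_add_eq_0 eq_diff_eq add_ac)
  from mult_right_inverse_eq[OF x this]
  have "ddm q q' H x = (mx H x ** dm q' G x ** mx H x ** dm q G x + mx H x ** dm q G x ** mx H x ** dm q' G x
     - mx H x ** ddm q q' G x) ** mx H x"
    unfolding dm_H[OF x] by (simp add: vec_eq_iff matrix_matrix_mult_def sum_negf)
  then show ?thesis
    by (simp add: vec_eq_iff matrix_matrix_mult_def algebra_simps sum.distrib sum_subtractf)
qed

end

section \<open>The function \<open>u\<close> on the cotangent bundle\<close>

lemma pullback_linear_on: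
  fixes L :: "'e::euclidean_space \<Rightarrow> 'f::euclidean_space" and f :: "'f \<Rightarrow> complex"
  assumes S: "smooth_dom S" and S': "smooth_dom S'" and L: "bounded_linear L"
    and maps: "\<And>x. x \<in> S' \<Longrightarrow> L x \<in> S" and f: "smooth_on S f"
  shows "smooth_on S' (\<lambda>x. f (L x))"
    "x \<in> S' \<Longrightarrow> dd S' v (\<lambda>x. f (L x)) x = dd S (L v) f (L x)"
proof -
  interpret S: smooth_dom S by (rule S)
  interpret S': smooth_dom S' by (rule S')
  have h: "((\<lambda>x. f (L x)) has_derivative (\<lambda>v. frechet_derivative f (at (L x) within S) (L v))) (at x within S')"
    if "x \<in> S'" "f differentiable_on S" for x and f :: "'f \<Rightarrow> complex"
  proof (rule has_derivative_in_compose[of L L])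
    show "(L has_derivative L) (at x within S')"
      by (rule bounded_linear_imp_has_derivative[OF L])
    show "(f has_derivative (\<lambda>v. frechet_derivative f (at (L x) within S) v)) (at (L x) within L ` S')"
      by (rule has_derivative_subset[OF S.has_frechet_derivative]) (use that maps in auto)
  qed
  have Ck: "Ck_on k S f \<Longrightarrow> Ck_on k S' (\<lambda>x. f (L x))" for k and f :: "'f \<Rightarrow> complex"
  proof (induction k arbitrary: f)
    case 0
    have "continuous_on S' L" using L by (simp add: linear_continuous_on)
    then show ?case using 0 maps by (auto intro: continuous_on_compose2)
  next
    case (Suc k)
    then have d: "f differentiable_on S" by simp
    have "Ck_on k S' (\<lambda>x. frechet_derivative (\<lambda>x. f (L x)) (at x within S') v)
      \<longleftrightarrow> Ck_on k S' (\<lambda>x. frechet_derivative f (at (L x) within S) (L v))" for v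
      by (rule Ck_on_cong) (simp add: S'.fd_eq[OF h[OF _ d]])
    moreover have "(\<lambda>x. f (L x)) differentiable_on S'"
      using h[OF _ d] differentiable_on_def differentiable_def by blast
    moreover have "Ck_on k S' (\<lambda>x. frechet_derivative f (at (L x) within S) (L v))" for v
      using Suc.IH[of "\<lambda>y. frechet_derivative f (at y within S) (L v)"] Suc.prems by simp
    ultimately show ?case by simp
  qed
  then show "smooth_on S' (\<lambda>x. f (L x))" using f by (simp add: smooth_on_def)
  show "dd S' v (\<lambda>x. f (L x)) x = dd S (L v) f (L x)" if "x \<in> S'"
    using S'.dd_eq[OF h[OF that smooth_on_imp_differentiable_on[OF f]] that, of v] maps[OF that]
    by (simp add: dd_def)
qed

text \<open>When S' is the full preimage, the chain rule is an equation between functions, also off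
  the domain, and can be iterated by rewriting. The version for a mere inclusion serves for
  shrinking chart domains.\<close>

lemma pullback_linear:
  fixes L :: "'e::euclidean_space \<Rightarrow> 'f::euclidean_space" and f :: "'f \<Rightarrow> complex"
  assumes S: "smooth_dom S" and S': "smooth_dom S'" and L: "bounded_linear L"
    and iff: "\<And>x. x \<in> S' \<longleftrightarrow> L x \<in> S" and f: "smooth_on S f"
  shows "smooth_on S' (\<lambda>x. f (L x))" "dd S' v (\<lambda>x. f (L x)) = (\<lambda>x. dd S (L v) f (L x))"
proof -
  note * = pullback_linear_on[OF S S' L iffD1[OF iff] f]
  show "smooth_on S' (\<lambda>x. f (L x))" by (rule *(1))
  show "dd S' v (\<lambda>x. f (L x)) = (\<lambda>x. dd S (L v) f (L x))"
  proof
    fix x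
    show "dd S' v (\<lambda>x. f (L x)) x = dd S (L v) f (L x)"
      using *(2)[of x v] by (cases "x \<in> S'") (auto simp: dd_def iff)
  qed
qed

text \<open>
  Coordinates \<open>z\<close> (\<open>Inl \<circ> Inl\<close>) and \<open>\<alpha>\<close> (\<open>Inl \<circ> Inr\<close>) on the cotangent bundle, followed by those of a
  tangent vector \<open>V = (v, \<beta>)\<close> to it (\<open>Inr \<circ> Inl\<close>, \<open>Inr \<circ> Inr\<close>).
\<close>

type_synonym 'n big = "('n + 'n) + ('n + 'n)"

definition prj :: "(complex^('n::finite) big) \<times> real \<Rightarrow> (complex^'n) \<times> real" where
  "prj x = ((\<chi> i. fst x $ Inl (Inl i)), snd x)"

lemma bounded_linear_prj: "bounded_linear prj"
proof -
  have "linear (prj :: _ \<Rightarrow> (complex^'n) \<times> real)"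
    by (rule linearI) (auto simp: prj_def vec_eq_iff)
  then show ?thesis by (simp add: linear_conv_bounded_linear)
qed

lemma prj_axis:
  "prj (axis (Inl (Inl i)) z, t) = (axis i z, t)"
  "prj (axis (Inl (Inr i)) z, t) = (0, t)"
  "prj (axis (Inr k) z, t) = (0, t)"
  "prj (0, t) = (0, t)" "prj 0 = 0"
  by (auto simp: prj_def axis_def vec_eq_iff zero_prod_def)

context herm_family
begin

definition big_dom :: "((complex^'n big) \<times> real) set" where
  "big_dom = {x. prj x \<in> D0}"

lemma big_dom_eq: "big_dom = {y. (\<chi> i. y $ Inl (Inl i)) \<in> U} \<times> time_int \<tau>"
  by (auto simp: big_dom_def prj_def)

lemma open_big: "open {y :: complex^'n big. (\<chi> i. y $ Inl (Inl i)) \<in> U}"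
proof -
  have "continuous_on UNIV (\<lambda>y :: complex^'n big. (\<chi> i. y $ Inl (Inl i)) :: complex^'n)"
    by (intro continuous_intros)
  from open_vimage[OF U this] show ?thesis by (simp add: vimage_def)
qed

sublocale big: chart_dom big_dom
  unfolding big_dom_eq chart_dom_def by (rule smooth_dom_cylinder[OF open_big])

lemma pb_smooth [simp]: "smooth_on D0 f \<Longrightarrow> smooth_on big_dom (\<lambda>x. f (prj x) :: complex)"
  by (rule pullback_linear(1)[OF b.smooth_dom_axioms big.smooth_dom_axioms bounded_linear_prj])
    (simp_all add: big_dom_def)

lemma pb_dd: "smooth_on D0 f \<Longrightarrow> dd big_dom v (\<lambda>x. f (prj x)) = (\<lambda>x. dd D0 (prj v) f (prj x))"
  by (rule pullback_linear(2)[OF b.smooth_dom_axioms big.smooth_dom_axioms bounded_linear_prj])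
    (simp_all add: big_dom_def)

lemma pb_pd [simp]:
  assumes "smooth_on D0 f"
  shows "pd big_dom (Dz (Inl (Inl i))) (\<lambda>x. f (prj x)) = (\<lambda>x. pd D0 (Dz i) f (prj x))"
    "pd big_dom (Dzb (Inl (Inl i))) (\<lambda>x. f (prj x)) = (\<lambda>x. pd D0 (Dzb i) f (prj x))"
    "pd big_dom Dt (\<lambda>x. f (prj x)) = (\<lambda>x. pd D0 Dt f (prj x))"
    "pd big_dom (Dz (Inl (Inr i))) (\<lambda>x. f (prj x)) = (\<lambda>x. 0)"
    "pd big_dom (Dzb (Inl (Inr i))) (\<lambda>x. f (prj x)) = (\<lambda>x. 0)"
    "pd big_dom (Dz (Inr k)) (\<lambda>x. f (prj x)) = (\<lambda>x. 0)"
    "pd big_dom (Dzb (Inr k)) (\<lambda>x. f (prj x)) = (\<lambda>x. 0)"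
  unfolding pd_def cd_def pb_dd[OF assms]
  by (simp_all add: prj_axis b.dd_dir_zero[OF assms] b.dd_dir_zero[OF assms, unfolded zero_prod_def])

abbreviation (input) pm where "pm q F \<equiv> dm (pvec q, ivec q) F"
abbreviation (input) ppm where "ppm q q' F \<equiv> ddm (pvec q, ivec q) (pvec q', ivec q') F"

lemma pm_nth: "pm q F x $ i $ j = pd D0 q (F i j) x"
  by (simp add: dm_def pd_def)

lemma ppm_nth: "ppm q q' F x $ i $ j = pd D0 q (pd D0 q' (F i j)) x"
  by (simp add: ddm_def pd_def)

definition u :: "(complex^'n big) \<times> real \<Rightarrow> complex" where
  "u = (\<lambda>x. \<Sum>\<Sum>i j. H j i (prj x) * (crd (Inl (Inr i)) x * cnj (crd (Inl (Inr j)) x)))"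

lemma u_smooth: "smooth_on big_dom u"
  by (simp add: u_def)

lemma u_real: "x \<in> big_dom \<Longrightarrow> cnj (u x) = u x"
proof -
  assume x: "x \<in> big_dom"
  then have "cnj (u x) = (\<Sum>\<Sum>i j. H i j (prj x) * (crd (Inl (Inr j)) x * cnj (crd (Inl (Inr i)) x)))"
    by (simp add: u_def H_herm[symmetric] big_dom_def mult_ac)
  also have "\<dots> = u x" unfolding u_def by (rule sum.swap)
  finally show ?thesis .
qed

lemma u_vert: "pd big_dom (Dz (Inr A)) u = (\<lambda>x. 0)"
  by (simp add: u_def)

definition sympl :: "'n + 'n \<Rightarrow> 'n + 'n \<Rightarrow> real" where
  "sympl A B = (case (A, B) of (Inl m, Inr k) \<Rightarrow> of_bool (m = k) | (Inr m, Inl k) \<Rightarrow> - of_bool (m = k) | _ \<Rightarrow> 0)"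

lemma sympl_anti: "sympl B A = - sympl A B"
  by (auto simp: sympl_def split: sum.splits)

lemma sum_sum_type: "(\<Sum>A\<in>(UNIV :: ('n + 'n) set). f A) = (\<Sum>\<Sum>m. f (Inl m)) + (\<Sum>\<Sum>m. f (Inr m) :: complex)"
  by (subst UNIV_Plus_UNIV[symmetric], subst sum.Plus) simp_all

lemma sum_sympl: "(\<Sum>\<Sum>A B. of_real (sympl A B) * g A B) = (\<Sum>\<Sum>m. g (Inl m) (Inr m) - g (Inr m) (Inl m) :: complex)"
proof -
  have 1: "(\<Sum>\<Sum>B. of_real (sympl (Inl m) B) * g (Inl m) B) = g (Inl m) (Inr m)" for m
    unfolding sum_sum_type by (simp add: sympl_def of_bool_def if_distrib if_distribR cong: if_cong)
  have 2: "(\<Sum>\<Sum>B. of_real (sympl (Inr m) B) * g (Inr m) B) = - g (Inr m) (Inl m)" for m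
    unfolding sum_sum_type by (simp add: sympl_def of_bool_def if_distrib if_distribR sum_negf cong: if_cong)
  show ?thesis
    unfolding sum_sum_type[of "\<lambda>A. \<Sum>\<Sum>B. of_real (sympl A B) * g A B"] 1 2
    by (simp add: sum_negf sum_subtractf)
qed

text \<open>Contraction with two symplectic forms yields a 2 by 2 minor in the (z, \<alpha>) blocks,
  which is the shape of the right-hand side of the inverse metric flow.\<close>

lemma sum_sympl2:
  "(\<Sum>\<Sum>A B C D. of_real (sympl A B) * of_real (sympl C D) * (P A C * P B D))
   = 2 * (\<Sum>\<Sum>m n. P (Inl m) (Inl n) * P (Inr m) (Inr n) - P (Inl m) (Inr n) * P (Inr m) (Inl n) :: complex)"
proof -
  have "(\<Sum>\<Sum>A B C D. of_real (sympl A B) * of_real (sympl C D) * (P A C * P B D))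
    = (\<Sum>\<Sum>A B. of_real (sympl A B) * (\<Sum>\<Sum>C D. of_real (sympl C D) * (P A C * P B D)))"
    unfolding sum_distrib_left by (simp only: mult.assoc)
  also have "\<dots> = (\<Sum>\<Sum>m n. 2 * (P (Inl m) (Inl n) * P (Inr m) (Inr n) - P (Inl m) (Inr n) * P (Inr m) (Inl n)))"
    unfolding sum_sympl sum_subtractf[symmetric] by (intro sum.cong refl) (simp add: algebra_simps)
  finally show ?thesis by (simp add: sum_distrib_left)
qed

lemma u_hessian:
  assumes x: "x \<in> big_dom"
  defines "P \<equiv> \<lambda>A C. pd big_dom (Dz (Inl A)) (pd big_dom (Dzb (Inl C)) u) x"
  shows "P (Inl m) (Inl n) = (\<Sum>\<Sum>i j. pd D0 (Dz m) (pd D0 (Dzb n) (H j i)) (prj x) *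
        (crd (Inl (Inr i)) x * cnj (crd (Inl (Inr j)) x)))"
    and "P (Inl m) (Inr n) = (\<Sum>\<Sum>i. pd D0 (Dz m) (H n i) (prj x) * crd (Inl (Inr i)) x)"
    and "P (Inr m) (Inl n) = (\<Sum>\<Sum>j. pd D0 (Dzb n) (H j m) (prj x) * cnj (crd (Inl (Inr j)) x))"
    and "P (Inr m) (Inr n) = H n m (prj x)"
    and "pd big_dom Dt u x = (\<Sum>\<Sum>i j. pd D0 Dt (H j i) (prj x) *
        (crd (Inl (Inr i)) x * cnj (crd (Inl (Inr j)) x)))"
proof -
  have inj: "inj (\<lambda>i. Inl (Inr i) :: 'n big)" by (auto intro: injI)
  let ?F = "\<lambda>i j x. H j i (prj x)" and ?e = "\<lambda>i. Inl (Inr i) :: 'n big"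
  note L = big.levi_quadratic[where F = ?F and e = ?e, OF _ _ _ x inj, folded u_def]
  show "P (Inl m) (Inl n) = (\<Sum>\<Sum>i j. pd D0 (Dz m) (pd D0 (Dzb n) (H j i)) (prj x) *
        (crd (Inl (Inr i)) x * cnj (crd (Inl (Inr j)) x)))"
    unfolding P_def by (subst L(1)) simp_all
  show "P (Inl m) (Inr n) = (\<Sum>\<Sum>i. pd D0 (Dz m) (H n i) (prj x) * crd (Inl (Inr i)) x)"
    unfolding P_def by (subst L(2)[where c = "Inl (Inl m)"]) simp_all
  show "P (Inr m) (Inl n) = (\<Sum>\<Sum>j. pd D0 (Dzb n) (H j m) (prj x) * cnj (crd (Inl (Inr j)) x))"
    unfolding P_def by (subst L(3)[where a = "Inl (Inl m)"]) simp_all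
  show "P (Inr m) (Inr n) = H n m (prj x)"
    unfolding P_def by (subst L(4)[where a = "Inl (Inl m)" and c = "Inl (Inl m)"]) simp_all
  show "pd big_dom Dt u x = (\<Sum>\<Sum>i j. pd D0 Dt (H j i) (prj x) *
        (crd (Inl (Inr i)) x * cnj (crd (Inl (Inr j)) x)))"
    by (subst L(5)[where a = "Inl (Inl undefined)" and c = "Inl (Inl undefined)"]) simp_all
qed

end

locale herm_flow = herm_family U \<tau> G
  for U :: "(complex^'n::finite) set" and \<tau> :: ereal and G :: "'n \<Rightarrow> 'n \<Rightarrow> (complex^'n) \<times> real \<Rightarrow> complex" +
  assumes flow: "x \<in> D0 \<Longrightarrow> pd D0 Dt (G i j) x =
    - (\<Sum>\<Sum>m n. mx H x $ n $ m *
        (pm (Dz m) G x ** mx H x ** pm (Dzb n) G x - ppm (Dz m) (Dzb n) G x) $ i $ j)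
    - 1/2 * (\<Sum>\<Sum>m n p s. mx H x $ n $ m * mx H x $ s $ p *
        (pm (Dz m) G x $ p $ j - pm (Dz p) G x $ m $ j) * (pm (Dzb n) G x $ i $ s - pm (Dzb s) G x $ i $ n))"
begin

lemma H_flow:
  assumes x: "x \<in> D0"
  shows "pd D0 Dt (H a b) x = (\<Sum>\<Sum>m n. H n m x * pd D0 (Dz m) (pd D0 (Dzb n) (H a b)) x)
     - (\<Sum>\<Sum>m n. pd D0 (Dz m) (H n b) x * pd D0 (Dzb n) (H a m) x)"
proof -
  let ?H = "mx H x" and ?G1 = "\<lambda>m. pm (Dz m) G x" and ?G2 = "\<lambda>n. pm (Dzb n) G x"
    and ?G12 = "\<lambda>m n. ppm (Dz m) (Dzb n) G x"
  define SQ where "SQ = (\<chi> i j. (\<Sum>\<Sum>m n. ?H $ n $ m * (?G1 m ** ?H ** ?G2 n - ?G12 m n) $ i $ j)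
     + 1/2 * (\<Sum>\<Sum>m n p s. ?H $ n $ m * ?H $ s $ p *
        (?G1 m $ p $ j - ?G1 p $ m $ j) * (?G2 n $ i $ s - ?G2 s $ i $ n)))"
  have "pm Dt G x $ i $ j = (- SQ) $ i $ j" for i j
    unfolding pm_nth flow[OF x] SQ_def
    by (simp only: vector_uminus_component vec_lambda_beta minus_add_distrib diff_conv_add_uminus)
  then have "pm Dt G x = - SQ"
    unfolding vec_eq_iff by blast
  then have "pm Dt H x $ a $ b = (- (?H ** (- SQ) ** ?H)) $ a $ b"
    by (simp only: dm_H[OF x])
  then have "pd D0 Dt (H a b) x = (- (?H ** (- SQ) ** ?H)) $ a $ b"
    by (simp only: pm_nth)
  also have "\<dots> = (?H ** SQ ** ?H) $ a $ b"
    by (simp add: sandwich_entry sum_negf)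
  also have "\<dots> = (\<Sum>\<Sum>m n. ?H $ n $ m *
        (?H ** ?G1 m ** ?H ** ?G2 n ** ?H + ?H ** ?G2 n ** ?H ** ?G1 m ** ?H - ?H ** ?G12 m n ** ?H) $ a $ b)
     - (\<Sum>\<Sum>m n. (?H ** ?G1 m ** ?H) $ n $ b * (?H ** ?G2 n ** ?H) $ a $ m)"
    unfolding SQ_def by (rule inverse_metric_flow_algebra)
  also have "\<dots> = (\<Sum>\<Sum>m n. H n m x * ppm (Dz m) (Dzb n) H x $ a $ b)
     - (\<Sum>\<Sum>m n. pm (Dz m) H x $ n $ b * pm (Dzb n) H x $ a $ m)"
    unfolding ddm_H[OF x] dm_H[OF x] by (simp del: pvec.simps ivec.simps)
  finally show ?thesis unfolding pm_nth ppm_nth .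
qed

text \<open>Since u is quadratic in \<alpha>, its \<alpha>-derivatives give back H and contracted
  derivatives of H. Contracting \<open>H_flow\<close> with \<alpha> and its conjugate therefore
  produces products of second derivatives of u.\<close>

lemma u_flow:
  assumes x: "x \<in> big_dom"
  shows "pd big_dom Dt u x =
      1/2 * (\<Sum>\<Sum>A B C D. of_real (sympl A B) * of_real (sympl C D) *
        (pd big_dom (Dz (Inl A)) (pd big_dom (Dzb (Inl C)) u) x * pd big_dom (Dz (Inl B)) (pd big_dom (Dzb (Inl D)) u) x))"
proof -
  let ?x = "prj x"
  let ?a = "\<lambda>i. crd (Inl (Inr i)) x"
  have xD: "?x \<in> D0" using x by (simp add: big_dom_def)
  have "pd big_dom Dt u x = (\<Sum>\<Sum>i j m n. (pd D0 (Dz m) (pd D0 (Dzb n) (H j i)) ?x * (?a i * cnj (?a j))) * H n m ?x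
     - (pd D0 (Dz m) (H n i) ?x * ?a i) * (pd D0 (Dzb n) (H j m) ?x * cnj (?a j)))"
    unfolding u_hessian(5)[OF x] H_flow[OF xD] sum_subtractf[symmetric] sum_distrib_right
    by (intro sum.cong refl) (simp add: algebra_simps)
  also have "\<dots> = (\<Sum>\<Sum>m n i j. (pd D0 (Dz m) (pd D0 (Dzb n) (H j i)) ?x * (?a i * cnj (?a j))) * H n m ?x
     - (pd D0 (Dz m) (H n i) ?x * ?a i) * (pd D0 (Dzb n) (H j m) ?x * cnj (?a j)))"
    by (rule sum_swap_2_2)
  also have "\<dots> = (\<Sum>\<Sum>m n. (\<Sum>\<Sum>i j. pd D0 (Dz m) (pd D0 (Dzb n) (H j i)) ?x * (?a i * cnj (?a j))) * H n m ?x
     - (\<Sum>\<Sum>i. pd D0 (Dz m) (H n i) ?x * ?a i) * (\<Sum>\<Sum>j. pd D0 (Dzb n) (H j m) ?x * cnj (?a j)))"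
    unfolding sum_product unfolding sum_distrib_right sum_subtractf ..
  finally show ?thesis
    unfolding sum_sympl2 u_hessian[OF x] by simp
qed

sublocale hf: hessian_flow big_dom sympl u
  by unfold_locales (rule sympl_anti u_smooth u_real u_vert u_flow, assumption?)+

end

text \<open>
  Pairs \<open>(p, q)\<close> with \<open>D\<^sub>p + \<i> D\<^sub>q = \<Sum>\<^sub>m v\<^sup>m \<partial>\<^sub>m\<close>, respectively the conjugate operator.
\<close>

definition dzv :: "complex^'n \<Rightarrow> ((complex^'n) \<times> real) \<times> ((complex^'n) \<times> real)" where
  "dzv v = (((1/2) *\<^sub>R v, 0), (- (1/2) *\<^sub>R (\<i> *s v), 0))"

definition dzbv :: "complex^'n \<Rightarrow> ((complex^'n) \<times> real) \<times> ((complex^'n) \<times> real)" where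
  "dzbv v = (((1/2) *\<^sub>R v, 0), ((1/2) *\<^sub>R (\<i> *s v), 0))"

section \<open>The curvature form, the barrier and the minimising lift\<close>

context herm_family
begin

lemma dzv_nth: "smooth_on D0 (F i j) \<Longrightarrow> dm (dzv v) F x $ i $ j = (\<Sum>\<Sum>m. v $ m * pd D0 (Dz m) (F i j) x)"
  by (simp add: dm_def dzv_def b.sum_dz_cd)

lemma dzbv_nth: "smooth_on D0 (F i j) \<Longrightarrow> dm (dzbv v) F x $ i $ j = (\<Sum>\<Sum>m. cnj (v $ m) * pd D0 (Dzb m) (F i j) x)"
  by (simp add: dm_def dzbv_def b.sum_dzb_cd)

lemma ddzv_nth:
  assumes [simp]: "smooth_on D0 (F i j)"
  shows "ddm (dzv v) (dzbv v) F x $ i $ j =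
    (\<Sum>\<Sum>m n. v $ m * cnj (v $ n) * pd D0 (Dz m) (pd D0 (Dzb n) (F i j)) x)"
proof -
  have "(\<lambda>x. \<Sum>\<Sum>n. cnj (v $ n) * pd D0 (Dzb n) (F i j) x) = cd D0 (fst (dzbv v)) (snd (dzbv v)) (F i j)"
    by (simp add: dzbv_def b.sum_dzb_cd)
  then have "ddm (dzv v) (dzbv v) F x $ i $ j = cd D0 (fst (dzv v)) (snd (dzv v)) (\<lambda>x. \<Sum>\<Sum>n. cnj (v $ n) * pd D0 (Dzb n) (F i j) x) x"
    by (simp add: ddm_def)
  also have "\<dots> = (\<Sum>\<Sum>m. v $ m * pd D0 (Dz m) (\<lambda>x. \<Sum>\<Sum>n. cnj (v $ n) * pd D0 (Dzb n) (F i j) x) x)"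
    unfolding dzv_def fst_conv snd_conv by (rule b.sum_dz_cd[symmetric]) simp
  finally show ?thesis by (simp add: sum_distrib_left mult_ac)
qed

text \<open>
  \<open>curv x v a\<close> is \<open>\<Omega>(v, v, \<eta>, \<eta>)\<close> (second and fourth slot conjugated) for \<open>a = cnj \<eta>\<close>.
\<close>

definition curv :: "(complex^'n) \<times> real \<Rightarrow> complex^'n \<Rightarrow> complex^'n \<Rightarrow> complex" where
  "curv x v a = qf (dm (dzv v) G x ** mx H x ** dm (dzbv v) G x - ddm (dzv v) (dzbv v) G x) a a"

definition gf :: "(complex^'n) \<times> real \<Rightarrow> complex^'n \<Rightarrow> complex" where
  "gf x v = (\<Sum>\<Sum>i j. G i j x * (v $ i * cnj (v $ j)))"

text \<open>N after minimising over \<beta>, written in a vector a with \<alpha> = G a. It is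
  homogeneous of degree two in v and in a separately, so unit vectors decide its sign.\<close>

definition Phi :: "real \<Rightarrow> (complex^'n) \<times> real \<Rightarrow> complex^'n \<Rightarrow> complex^'n \<Rightarrow> real" where
  "Phi \<delta> x v a = Re (curv x v a) + \<delta> * Re (gf x v * qf (mx G x) a a)"

lemma dm_G_adj:
  assumes "x \<in> D0"
  shows "dm (dzv v) G x $ j $ i = cnj (dm (dzbv v) G x $ i $ j)"
proof -
  have "cd D0 p q (G j i) = cd D0 p q (\<lambda>x. cnj (G i j x))" for p q
    by (rule b.cd_cong) (simp add: G_herm)
  then show ?thesis by (simp add: dm_def dzv_def dzbv_def)
qed

lemma gf_qf: "gf x v = qf (mx G x) (\<chi> i. cnj (v $ i)) (\<chi> i. cnj (v $ i))"
  by (simp add: gf_def qf_def mult_ac)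

lemma qf_G_real: "x \<in> D0 \<Longrightarrow> cnj (qf (mx G x) a a) = qf (mx G x) a a"
  unfolding qf_def
  by (subst sum.swap) (simp add: G_herm mult_ac)

lemma qf_real_mult: "cnj p = p \<Longrightarrow> Re (p * q) = Re p * Re q"
  by (simp add: complex_eq_iff)

lemma gf_real: "x \<in> D0 \<Longrightarrow> cnj (gf x v) = gf x v"
  unfolding gf_qf by (rule qf_G_real)

lemma gf_pos: "x \<in> D0 \<Longrightarrow> v \<noteq> 0 \<Longrightarrow> 0 < Re (gf x v)"
  unfolding gf_qf by (rule G_pos) (auto simp: vec_eq_iff)

lemma qf_H_nonneg:
  assumes "x \<in> D0"
  shows "0 \<le> Re (qf (mx H x) w w)"
proof -
  have "qf (mx H x) w w = qf (mx H x ** mx G x ** mx H x) w w"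
    by (simp add: H_G(1)[OF assms] matrix_mul_lid)
  also have "\<dots> = qf (mx H x ** (mx G x ** mx H x)) w w"
    by (simp only: matrix_mul_assoc)
  also have "\<dots> = qf (mx G x ** mx H x) (mx H x *v w) w"
    by (rule qf_mult_left) (simp only: mx_nth H_herm[OF assms, symmetric])
  also have "\<dots> = qf (mx G x) (mx H x *v w) (mx H x *v w)"
    by (rule qf_mult_right)
  finally show ?thesis
    using G_pos[OF assms, of "mx H x *v w"] by (cases "mx H x *v w = 0") (auto simp: qf_def)
qed

lemma qf_H_G:
  assumes "x \<in> D0"
  shows "qf (mx H x) (mx G x *v a) (mx G x *v a) = qf (mx G x) a a"
proof -
  have "qf (mx H x) (mx G x *v a) (mx G x *v a) = qf (mx H x ** mx G x) (mx G x *v a) a"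
    by (simp add: qf_mult_right)
  also have "\<dots> = qf (mat 1) (mx G x *v a) a" by (simp add: H_G(1)[OF assms])
  also have "\<dots> = qf (mx G x ** mat 1) a a"
    by (rule qf_mult_left[symmetric]) (simp add: G_herm[OF assms])
  finally show ?thesis by (simp add: matrix_mul_rid)
qed

lemma curv_real:
  assumes x: "x \<in> D0"
  shows "cnj (curv x v a) = curv x v a"
proof -
  let ?M = "dm (dzv v) G x ** mx H x ** dm (dzbv v) G x - ddm (dzv v) (dzbv v) G x"
  have dd: "ddm (dzv v) (dzbv v) G x $ j $ i = cnj (ddm (dzv v) (dzbv v) G x $ i $ j)" for i j
  proof -
    have "cd D0 p q (cd D0 p' q' (G j i)) = cd D0 p q (cd D0 p' q' (\<lambda>x. cnj (G i j x)))" for p q p' q'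
      by (rule arg_cong[where f = "cd D0 p q"], rule b.cd_cong) (simp add: G_herm)
    then show ?thesis
      using b.cd_commute[OF G_smooth, of "fst (dzv v)" "snd (dzv v)" "fst (dzbv v)" "snd (dzbv v)" i j]
      by (simp add: ddm_def dzv_def dzbv_def)
  qed
  let ?A = "dm (dzv v) G x" and ?B = "dm (dzbv v) G x"
  have cA: "cnj (?A $ i $ j) = ?B $ j $ i" and cB: "cnj (?B $ i $ j) = ?A $ j $ i" for i j
    by (simp_all only: dm_G_adj[OF x] complex_cnj_cnj)
  have "cnj ((?A ** mx H x ** ?B) $ i $ j) = (\<Sum>\<Sum>k l. ?B $ l $ i * H k l x * ?A $ j $ k)" for i j
    unfolding matrix_matrix_mult_def
    by (simp add: sum_distrib_right cA cB H_herm[OF x, symmetric])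
  also have "(\<Sum>\<Sum>k l. ?B $ l $ i * H k l x * ?A $ j $ k)
     = (\<Sum>\<Sum>l k. ?B $ l $ i * H k l x * ?A $ j $ k)" for i j
    by (rule sum.swap)
  also have "(\<Sum>\<Sum>l k. ?B $ l $ i * H k l x * ?A $ j $ k) = (?A ** mx H x ** ?B) $ j $ i" for i j
    unfolding matrix_matrix_mult_def by (simp add: sum_distrib_left sum_distrib_right mult_ac)
  finally have "cnj ((?A ** mx H x ** ?B) $ i $ j) = (?A ** mx H x ** ?B) $ j $ i" for i j .
  then have M: "cnj (?M $ i $ j) = ?M $ j $ i" for i j
    using dd[of j i] by (simp only: vector_minus_component complex_cnj_diff)
  have "cnj (qf ?M a a) = (\<Sum>\<Sum>i j. cnj (a $ j) * ?M $ j $ i * a $ i)"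
    unfolding qf_def cnj_sum complex_cnj_mult complex_cnj_cnj M by (simp only: mult_ac)
  also have "\<dots> = qf ?M a a" unfolding qf_def by (rule sum.swap)
  finally show ?thesis by (simp only: curv_def)
qed

definition bv :: "(complex^'n big) \<times> real \<Rightarrow> complex^'n" where "bv x = (\<chi> m. fst x $ Inr (Inl m))"
definition bb :: "(complex^'n big) \<times> real \<Rightarrow> complex^'n" where "bb x = (\<chi> m. fst x $ Inr (Inr m))"
definition ba :: "(complex^'n big) \<times> real \<Rightarrow> complex^'n" where "ba x = (\<chi> m. fst x $ Inl (Inr m))"

lemma crd_big: "crd (Inr (Inl m)) x = bv x $ m" "crd (Inr (Inr m)) x = bb x $ m" "crd (Inl (Inr m)) x = ba x $ m"
  by (simp_all add: crd_def bv_def bb_def ba_def)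

text \<open>Independent of \<beta> and zero for v = 0 or \<alpha> = 0. It still works as a barrier
  because it is evaluated only at lifts of nonzero v and a, where \<open>K_lift\<close> makes it
  positive.\<close>

definition K :: "(complex^'n big) \<times> real \<Rightarrow> complex" where
  "K = (\<lambda>x. (\<Sum>\<Sum>i j. G i j (prj x) * (crd (Inr (Inl i)) x * cnj (crd (Inr (Inl j)) x))) * u x)"

lemma u_qf: "u x = qf (mx H (prj x)) (ba x) (ba x)"
  unfolding u_def qf_def crd_big by (subst sum.swap) (simp add: mult_ac)

lemma K_eq: "K x = gf (prj x) (bv x) * qf (mx H (prj x)) (ba x) (ba x)"
  unfolding K_def u_qf gf_def crd_big ..

lemma K_smooth: "smooth_on big_dom K"
  using u_smooth by (simp add: K_def)

lemma K_real: "x \<in> big_dom \<Longrightarrow> cnj (K x) = K x"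
  unfolding K_eq u_qf[symmetric] using gf_real[of "prj x"] u_real[of x] by (simp add: big_dom_def)

text \<open>
  The \<open>\<beta>\<close>-component minimises \<open>u\<^sub>A\<^sub>C V\<^sup>A cnj V\<^sup>C\<close>, and the minimum is the curvature form.
\<close>

definition lift :: "(complex^'n) \<times> real \<Rightarrow> complex^'n \<Rightarrow> complex^'n \<Rightarrow> (complex^'n big) \<times> real" where
  "lift x v a = ((\<chi> k. case k of Inl (Inl i) \<Rightarrow> fst x $ i | Inl (Inr i) \<Rightarrow> (mx G x *v a) $ i
      | Inr (Inl i) \<Rightarrow> v $ i | Inr (Inr i) \<Rightarrow> (dm (dzv v) G x *v a) $ i), snd x)"

lemma lift_simps: "prj (lift x v a) = x" "bv (lift x v a) = v" "ba (lift x v a) = mx G x *v a"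
    "bb (lift x v a) = dm (dzv v) G x *v a"
  by (simp_all add: lift_def prj_def bv_def ba_def bb_def vec_eq_iff prod_eq_iff)

lemma lift_big: "x \<in> D0 \<Longrightarrow> lift x v a \<in> big_dom"
  by (simp add: big_dom_def lift_simps)

lemma H_G_vec: "x \<in> D0 \<Longrightarrow> mx H x *v (mx G x *v a) = a"
  by (simp add: matrix_vector_mul_assoc H_G(1))

lemma continuous_on_lift: "continuous_on (D0 \<times> UNIV \<times> UNIV) (\<lambda>(x, v, a). lift x v a)"
proof -
  have c: "continuous_on (D0 \<times> (UNIV :: ((complex^'n) \<times> (complex^'n)) set)) (\<lambda>p. f (fst p))"
    if "smooth_on D0 f" for f :: "(complex^'n) \<times> real \<Rightarrow> complex"
    using smooth_on_imp_continuous_on[OF that]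
    by (rule continuous_on_compose2) (auto intro: continuous_intros)
  have k: "continuous_on (D0 \<times> UNIV)
     (\<lambda>p. case k of Inl (Inl i) \<Rightarrow> fst (fst p) $ i | Inl (Inr i) \<Rightarrow> (mx G (fst p) *v snd (snd p)) $ i
      | Inr (Inl i) \<Rightarrow> fst (snd p) $ i | Inr (Inr i) \<Rightarrow> (dm (dzv (fst (snd p))) G (fst p) *v snd (snd p)) $ i)"
    for k :: "'n big"
  proof -
    consider i where "k = Inl (Inl i)" | i where "k = Inl (Inr i)" | i where "k = Inr (Inl i)" | i where "k = Inr (Inr i)"
      by (metis sum.exhaust)
    moreover have "smooth_on D0 (\<lambda>x. fst x $ i)" for i
      using b.smooth_crd[of i] by (simp add: crd_def[abs_def])
    ultimately show ?thesis
      by cases (auto simp: matrix_vector_mult_def dzv_nth intro!: continuous_intros c)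
  qed
  show ?thesis
    unfolding lift_def case_prod_beta UNIV_Times_UNIV by (intro continuous_intros k)
qed

end

section \<open>The maximum principle in one chart\<close>

context herm_flow
begin

text \<open>The four blocks of the Hessian of u, contracted with v and \<beta>, are
  \<open>qf\<close> forms of H and its derivatives; \<open>levi_square_completion\<close> then
  splits off a square. This is the link between Griffiths non-negativity and the Hessian of
  u.\<close>

lemma N0_eq:
  assumes x: "x \<in> big_dom"
  defines "a \<equiv> mx H (prj x) *v ba x"
  shows "hf.N0 x = curv (prj x) (bv x) a +
     qf (mx H (prj x)) (bb x - dm (dzv (bv x)) G (prj x) *v a) (bb x - dm (dzv (bv x)) G (prj x) *v a)"
proof -
  let ?x = "prj x" and ?v = "bv x" and ?b = "bb x" and ?a = "ba x"
  have xD: "?x \<in> D0" using x by (simp add: big_dom_def)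
  note P = u_hessian[OF x, folded hf.P_def, unfolded crd_big]
  have "hf.N0 x = (\<Sum>\<Sum>m n. hf.P (Inl m) (Inl n) x * (?v $ m * cnj (?v $ n)))
     + (\<Sum>\<Sum>m n. hf.P (Inl m) (Inr n) x * (?v $ m * cnj (?b $ n)))
     + (\<Sum>\<Sum>m n. hf.P (Inr m) (Inl n) x * (?b $ m * cnj (?v $ n)))
     + (\<Sum>\<Sum>m n. hf.P (Inr m) (Inr n) x * (?b $ m * cnj (?b $ n)))"
    unfolding hf.N0_def sum_sum_type crd_big sum.distrib by simp
  also have "(\<Sum>\<Sum>m n. hf.P (Inl m) (Inl n) x * (?v $ m * cnj (?v $ n)))
    = qf (ddm (dzv ?v) (dzbv ?v) H ?x) ?a ?a"
  proof -
    have "(\<Sum>\<Sum>m n. hf.P (Inl m) (Inl n) x * (?v $ m * cnj (?v $ n)))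
     = (\<Sum>\<Sum>m n i j. (?v $ m * cnj (?v $ n) * pd D0 (Dz m) (pd D0 (Dzb n) (H j i)) ?x) * (?a $ i * cnj (?a $ j)))"
      unfolding P sum_distrib_right by (intro sum.cong refl) (simp add: mult_ac)
    also have "\<dots> = (\<Sum>\<Sum>i j m n. (?v $ m * cnj (?v $ n) * pd D0 (Dz m) (pd D0 (Dzb n) (H j i)) ?x) * (?a $ i * cnj (?a $ j)))"
      by (rule sum_swap_2_2)
    also have "\<dots> = (\<Sum>\<Sum>i j. ddm (dzv ?v) (dzbv ?v) H ?x $ j $ i * (?a $ i * cnj (?a $ j)))"
      unfolding ddzv_nth[OF H_smooth] sum_distrib_right ..
    also have "\<dots> = qf (ddm (dzv ?v) (dzbv ?v) H ?x) ?a ?a"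
      unfolding qf_def by (subst sum.swap) (simp add: mult_ac)
    finally show ?thesis .
  qed
  also have "(\<Sum>\<Sum>m n. hf.P (Inl m) (Inr n) x * (?v $ m * cnj (?b $ n)))
    = qf (dm (dzv ?v) H ?x) ?b ?a"
  proof -
    have "(\<Sum>\<Sum>m n. hf.P (Inl m) (Inr n) x * (?v $ m * cnj (?b $ n)))
     = (\<Sum>\<Sum>n m i. cnj (?b $ n) * (?v $ m * pd D0 (Dz m) (H n i) ?x) * ?a $ i)"
      unfolding P sum_distrib_right by (subst sum.swap) (intro sum.cong refl, simp add: mult_ac)
    also have "\<dots> = (\<Sum>\<Sum>n i m. cnj (?b $ n) * (?v $ m * pd D0 (Dz m) (H n i) ?x) * ?a $ i)"
      by (rule sum.cong[OF refl], rule sum.swap)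
    finally show ?thesis
      unfolding qf_def dzv_nth[OF H_smooth] sum_distrib_left sum_distrib_right .
  qed
  also have "(\<Sum>\<Sum>m n. hf.P (Inr m) (Inl n) x * (?b $ m * cnj (?v $ n)))
    = qf (dm (dzbv ?v) H ?x) ?a ?b"
  proof -
    have "(\<Sum>\<Sum>m n. hf.P (Inr m) (Inl n) x * (?b $ m * cnj (?v $ n)))
     = (\<Sum>\<Sum>m n j. cnj (?a $ j) * (cnj (?v $ n) * pd D0 (Dzb n) (H j m) ?x) * ?b $ m)"
      unfolding P sum_distrib_right by (intro sum.cong refl) (simp add: mult_ac)
    also have "\<dots> = (\<Sum>\<Sum>m j n. cnj (?a $ j) * (cnj (?v $ n) * pd D0 (Dzb n) (H j m) ?x) * ?b $ m)"
      by (rule sum.cong[OF refl], rule sum.swap)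
    also have "\<dots> = (\<Sum>\<Sum>j m n. cnj (?a $ j) * (cnj (?v $ n) * pd D0 (Dzb n) (H j m) ?x) * ?b $ m)"
      by (rule sum.swap)
    finally show ?thesis
      unfolding qf_def dzbv_nth[OF H_smooth] sum_distrib_left sum_distrib_right .
  qed
  also have "(\<Sum>\<Sum>m n. hf.P (Inr m) (Inr n) x * (?b $ m * cnj (?b $ n))) = qf (mx H ?x) ?b ?b"
    unfolding P qf_def by (subst sum.swap) (simp add: mult_ac)
  also have "qf (ddm (dzv ?v) (dzbv ?v) H ?x) ?a ?a + qf (dm (dzv ?v) H ?x) ?b ?a + qf (dm (dzbv ?v) H ?x) ?a ?b + qf (mx H ?x) ?b ?b
    = curv ?x ?v a + qf (mx H ?x) (?b - dm (dzv ?v) G ?x *v a) (?b - dm (dzv ?v) G ?x *v a)"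
    unfolding dm_H[OF xD] ddm_H[OF xD] a_def curv_def
    by (rule levi_square_completion) (simp_all only: mx_nth H_herm[OF xD, symmetric] dm_G_adj[OF xD])
  finally show ?thesis .
qed

text \<open>Discards the square in \<open>N0_eq\<close>; at a lift that square is zero, which gives
  \<open>N_lift\<close>. So wherever Phi is non-negative nearby, a zero of Phi lifts to a minimum of
  N in all coordinates.\<close>

lemma N_lower:
  assumes x: "x \<in> big_dom"
  shows "Phi \<delta> (prj x) (bv x) (mx H (prj x) *v ba x) \<le> Re (hf.N0 x + \<delta> * K x)"
proof -
  have xD: "prj x \<in> D0" using x by (simp add: big_dom_def)
  have "ba x = mx G (prj x) *v (mx H (prj x) *v ba x)"
    by (simp add: matrix_vector_mul_assoc H_G(2)[OF xD])
  then have "K x = gf (prj x) (bv x) * qf (mx G (prj x)) (mx H (prj x) *v ba x) (mx H (prj x) *v ba x)"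
    unfolding K_eq using qf_H_G[OF xD, of "mx H (prj x) *v ba x"] by simp
  then show ?thesis
    unfolding Phi_def N0_eq[OF x] using qf_H_nonneg[OF xD] by simp
qed

lemma N_lift:
  assumes x: "x \<in> D0"
  shows "Re (hf.N0 (lift x v a) + \<delta> * K (lift x v a)) = Phi \<delta> x v a"
  unfolding N0_eq[OF lift_big[OF x]] K_eq lift_simps H_G_vec[OF x] qf_H_G[OF x] Phi_def
  by (simp add: qf_def)

text \<open>Phi is N composed with \<open>lift\<close>, so continuity follows from smoothness of
  \<open>N0\<close> and K rather than from the curvature formula.\<close>

lemma continuous_on_Phi:
  assumes d: "continuous_on UNIV d"
  shows "continuous_on (D0 \<times> UNIV \<times> UNIV) (\<lambda>(x, v, a). Phi (d (snd x)) x v a)"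
proof -
  have l: "continuous_on (D0 \<times> UNIV \<times> UNIV) (\<lambda>p. f (case p of (x, v, a) \<Rightarrow> lift x v a))"
    if "smooth_on big_dom f" for f :: "_ \<Rightarrow> complex"
    by (rule continuous_on_compose2[OF smooth_on_imp_continuous_on[OF that] continuous_on_lift])
      (auto intro: lift_big)
  have "continuous_on (D0 \<times> UNIV \<times> UNIV) (\<lambda>p. Re (hf.N0 (case p of (x, v, a) \<Rightarrow> lift x v a)
     + d (snd (fst p)) * K (case p of (x, v, a) \<Rightarrow> lift x v a)))"
    by (intro continuous_intros l hf.N0_smooth K_smooth continuous_on_compose2[OF d]) auto
  then show ?thesis
    by (rule continuous_on_eq) (auto simp: N_lift simp del: plus_complex.sel times_complex.sel)
qed

lemma Phi_scale: "Phi \<delta> x (r *\<^sub>R v) (s *\<^sub>R a) = r\<^sup>2 * s\<^sup>2 * Phi \<delta> x v a"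
proof -
  have sc: "(c *\<^sub>R w) $ i = complex_of_real c * w $ i" for c i and w :: "complex^'n"
    by (simp add: complex_eq_iff)
  have 1: "dm (dzv (r *\<^sub>R v)) G x $ i $ j = r * dm (dzv v) G x $ i $ j"
    "dm (dzbv (r *\<^sub>R v)) G x $ i $ j = r * dm (dzbv v) G x $ i $ j" for i j
    by (simp_all add: dzv_nth dzbv_nth sum_distrib_left sc mult_ac del: vector_scaleR_component)
  have 2: "ddm (dzv (r *\<^sub>R v)) (dzbv (r *\<^sub>R v)) G x $ i $ j = r\<^sup>2 * ddm (dzv v) (dzbv v) G x $ i $ j" for i j
    by (simp add: ddzv_nth sum_distrib_left sc power2_eq_square mult_ac del: vector_scaleR_component)
  let ?M = "\<lambda>v. dm (dzv v) G x ** mx H x ** dm (dzbv v) G x - ddm (dzv v) (dzbv v) G x"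
  have M: "?M (r *\<^sub>R v) $ i $ j = r\<^sup>2 * ?M v $ i $ j" for i j
    by (simp add: matrix_matrix_mult_def 1 2 sum_distrib_left sum_distrib_right power2_eq_square algebra_simps)
  have q: "qf X (s *\<^sub>R a) (s *\<^sub>R a) = s\<^sup>2 * qf X a a" for X
    by (simp add: qf_def sum_distrib_left sc power2_eq_square mult_ac del: vector_scaleR_component)
  have "curv x (r *\<^sub>R v) (s *\<^sub>R a) = s\<^sup>2 * qf (?M (r *\<^sub>R v)) a a"
    unfolding curv_def q ..
  also have "qf (?M (r *\<^sub>R v)) a a = r\<^sup>2 * qf (?M v) a a"
    unfolding qf_def M by (simp only: sum_distrib_left mult_ac)
  finally have c: "curv x (r *\<^sub>R v) (s *\<^sub>R a) = of_real (r\<^sup>2 * s\<^sup>2) * curv x v a"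
    by (simp add: curv_def)
  have "gf x (r *\<^sub>R v) = r\<^sup>2 * gf x v"
    by (simp add: gf_def sum_distrib_left sc power2_eq_square mult_ac del: vector_scaleR_component)
  then have g: "gf x (r *\<^sub>R v) * qf (mx G x) (s *\<^sub>R a) (s *\<^sub>R a) = of_real (r\<^sup>2 * s\<^sup>2) * (gf x v * qf (mx G x) a a)"
    by (simp add: q)
  show ?thesis
    unfolding Phi_def c g by (simp add: algebra_simps)
qed

lemma K_lift: "x \<in> D0 \<Longrightarrow> v \<noteq> 0 \<Longrightarrow> a \<noteq> 0 \<Longrightarrow> 0 < Re (K (lift x v a))"
  unfolding K_eq lift_simps qf_H_G qf_real_mult[OF gf_real]
  by (intro mult_pos_pos gf_pos G_pos)

text \<open>Everything that the growth rate of the barrier has to beat: the cross terms of the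
  reaction, the term quadratic in K, and the time derivative of K.\<close>

definition err :: "(complex^'n big) \<times> real \<Rightarrow> real" where
  "err x = \<bar>Re (bform sympl (hf.levi hf.N0 x) (hf.levi K x) + bform sympl (hf.levi K x) (hf.levi hf.N0 x))\<bar>
     + \<bar>Re (bform sympl (hf.levi K x) (hf.levi K x))\<bar> + \<bar>Re (pd big_dom Dt K x)\<bar>"

lemma continuous_on_err: "continuous_on big_dom err"
proof -
  have l: "continuous_on big_dom (\<lambda>x. hf.levi f x i j)" if "smooth_on big_dom f" for f i j
    unfolding hf.levi_def by (intro smooth_on_imp_continuous_on big.pd_smooth that)
  have k: "continuous_on big_dom (pd big_dom Dt K)"
    by (intro smooth_on_imp_continuous_on big.pd_smooth K_smooth)
  show ?thesis
    unfolding err_def bform_def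
    by (intro continuous_intros l k K_smooth hf.N0_smooth)
qed

lemma big_interior:
  assumes "(y, t) \<in> big_dom" "0 < t"
  shows "(y, t) \<in> interior big_dom"
  using assms time_int_interior[of t \<tau>] unfolding big_dom_eq interior_Times interior_open[OF open_big]
  by (auto simp: time_int_def)

text \<open>A positive time derivative would make the function negative just before t.\<close>

lemma time_derivative_at_first_zero:
  assumes x: "(y, t) \<in> big_dom" "0 < t" and f: "smooth_on big_dom f" and k: "smooth_on big_dom k"
    and \<delta>: "(\<delta> has_real_derivative \<delta>') (at t)"
    and nonneg: "\<And>s. 0 \<le> s \<Longrightarrow> s \<le> t \<Longrightarrow> 0 \<le> Re (f (y, s)) + \<delta> s * Re (k (y, s))"
    and zero: "Re (f (y, t)) + \<delta> t * Re (k (y, t)) = 0"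
  shows "Re (pd big_dom Dt f (y, t)) + \<delta>' * Re (k (y, t)) + \<delta> t * Re (pd big_dom Dt k (y, t)) \<le> 0"
proof (rule ccontr)
  assume neg: "\<not> ?thesis"
  note int = big_interior[OF x]
  have pd: "pd big_dom Dt g (y, t) = dd big_dom (0, 1) g (y, t)" if "smooth_on big_dom g" for g
    using big.dd_dir_zero[OF that] by (simp add: pd_def cd_def zero_prod_def)
  have d: "((\<lambda>s. Re (g (y, t + s))) has_real_derivative Re (pd big_dom Dt g (y, t))) (at 0)"
    if "smooth_on big_dom g" for g
    using big.has_real_derivative_dd[OF that int bounded_linear_Re, of "(0, 1)"] pd[OF that] by simp
  have \<delta>0: "((\<lambda>s. \<delta> (t + s)) has_real_derivative \<delta>') (at 0)"
    using \<delta> DERIV_shift[of \<delta> \<delta>' 0 t] by (simp add: add.commute)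
  have "((\<lambda>s. Re (f (y, t + s)) + \<delta> (t + s) * Re (k (y, t + s))) has_real_derivative
     Re (pd big_dom Dt f (y, t)) + (\<delta>' * Re (k (y, t + 0)) + Re (pd big_dom Dt k (y, t)) * \<delta> (t + 0))) (at 0)"
    by (intro DERIV_add DERIV_mult d f k \<delta>0)
  from DERIV_pos_inc_left[OF this] neg obtain e where e: "0 < e"
    "\<And>h. 0 < h \<Longrightarrow> h < e \<Longrightarrow> Re (f (y, t + (0 - h))) + \<delta> (t + (0 - h)) * Re (k (y, t + (0 - h)))
       < Re (f (y, t + 0)) + \<delta> (t + 0) * Re (k (y, t + 0))"
    by (auto simp: algebra_simps)
  define h where "h = min e t / 2"
  have h: "0 < h" "h < e" "h < t" using e(1) x(2) by (auto simp: h_def min_def)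
  show False using e(2)[OF h(1,2)] nonneg[of "t - h"] h zero by simp
qed

text \<open>At a first zero the spatial minimum bounds the time derivative of \<open>N0\<close> from
  below, and the time test bounds it from above by terms containing - C times the barrier. Comparing
  the two and dividing by \<delta> gives C Re K \<le> err, where \<delta> \<le> 1 absorbs the
  quadratic term. A C above the maximum of err / Re K over the lift of Q is impossible; this
  threshold does not depend on \<epsilon>.\<close>

lemma no_first_zero:
  assumes Q: "compact Q" "Q \<subseteq> D0 \<times> UNIV \<times> UNIV"
    and nz: "\<And>x v a. (x, v, a) \<in> Q \<Longrightarrow> v \<noteq> 0 \<and> a \<noteq> 0"
  shows "\<exists>C\<^sub>0. \<forall>C>C\<^sub>0. \<forall>\<epsilon> z t v a r. 0 < \<epsilon> \<longrightarrow> ((z, t), v, a) \<in> Q \<longrightarrow> 0 < t \<longrightarrow> \<epsilon> * exp (C * t) \<le> 1 \<longrightarrow> 0 < r \<longrightarrow>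
     (\<forall>s z' v' a'. 0 \<le> s \<longrightarrow> s \<le> t \<longrightarrow> z' \<in> U \<longrightarrow> dist z' z < r \<longrightarrow> 0 \<le> Phi (\<epsilon> * exp (C * s)) (z', s) v' a') \<longrightarrow>
     Phi (\<epsilon> * exp (C * t)) (z, t) v a \<noteq> 0"
proof -
  let ?l = "\<lambda>(x, v, a). lift x v a"
  have cl: "continuous_on Q ?l"
    using continuous_on_subset[OF continuous_on_lift Q(2)] .
  have lQ: "?l ` Q \<subseteq> big_dom" using Q(2) lift_big by auto
  have cK: "continuous_on big_dom (\<lambda>x. Re (K x))"
    by (intro continuous_intros smooth_on_imp_continuous_on K_smooth)
  have Kpos: "0 < Re (K (?l p))" if "p \<in> Q" for p
    using that Q(2) nz K_lift by (cases p) auto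
  have "continuous_on Q (\<lambda>p. err (?l p) / Re (K (?l p)))"
    using Kpos
    by (intro continuous_on_divide continuous_on_compose2[OF continuous_on_err cl lQ]
        continuous_on_compose2[OF cK cl lQ]) fastforce
  then have "bounded ((\<lambda>p. err (?l p) / Re (K (?l p))) ` Q)"
    by (intro compact_imp_bounded compact_continuous_image Q(1))
  then obtain C where "\<forall>r\<in>(\<lambda>p. err (?l p) / Re (K (?l p))) ` Q. norm r \<le> C"
    unfolding bounded_iff by blast
  then have C: "\<bar>err (?l p) / Re (K (?l p))\<bar> \<le> C" if "p \<in> Q" for p
    using that by (simp only: ball_simps real_norm_def)
  show ?thesis
  proof (intro exI[of _ C] allI impI notI)
    fix C' \<epsilon> z t v a r
    assume C': "C < C'" and \<epsilon>: "0 < \<epsilon>" and Qp: "((z, t), v, a) \<in> Q" and t: "0 < t" and small: "\<epsilon> * exp (C' * t) \<le> 1"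
      and r: "0 < r"
      and nonneg: "\<forall>s z' v' a'. 0 \<le> s \<longrightarrow> s \<le> t \<longrightarrow> z' \<in> U \<longrightarrow> dist z' z < r \<longrightarrow>
         0 \<le> Phi (\<epsilon> * exp (C' * s)) (z', s) v' a'"
      and zero: "Phi (\<epsilon> * exp (C' * t)) (z, t) v a = 0"
    define \<delta> where "\<delta> s = \<epsilon> * exp (C' * s)" for s
    have xD: "(z, t) \<in> D0" using Qp Q(2) by auto
    define x where "x = lift (z, t) v a"
    obtain y where y: "x = (y, t)" by (simp add: x_def lift_def)
    have xB: "(y, t) \<in> big_dom" using lift_big[OF xD, of v a] y x_def by simp
    have prj_y: "prj (y', s) = ((\<chi> i. y' $ Inl (Inl i)), s)" for y' s by (simp add: prj_def)
    have z: "(\<chi> i. y $ Inl (Inl i)) = z"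
      using lift_simps(1)[of "(z, t)" v a] y prj_y[of y t] by (simp add: x_def)
    \<comment> \<open>The fibre coordinates of y' are unrestricted: Phi is non-negative for all
      vectors, and \<open>N_lower\<close> removes \<beta>. So the minimum below is one in every
      coordinate.\<close>
    have N: "0 \<le> Re (hf.N0 (y', s) + \<delta> s * K (y', s))"
      if "0 \<le> s" "s \<le> t" "(\<chi> i. y' $ Inl (Inl i)) \<in> U" "dist (\<chi> i. y' $ Inl (Inl i)) z < r" for y' s
    proof -
      have "ereal s < \<tau>" using xD that(2) le_less_trans[of "ereal s" "ereal t" \<tau>] by (auto simp: time_int_def)
      then have "(y', s) \<in> big_dom" using that by (simp add: big_dom_def prj_y time_int_def)
      from N_lower[OF this, of "\<delta> s"] show ?thesis
        using nonneg that unfolding prj_y \<delta>_def by (meson order_trans)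
    qed
    have N0: "Re (hf.N0 (y, t) + \<delta> t * K (y, t)) = 0"
      using N_lift[OF xD, of v a "\<delta> t"] zero y by (simp add: x_def \<delta>_def)
    obtain B where B: "0 < B" "\<And>w :: (complex^'n big) \<times> real. norm (prj w) \<le> norm w * B"
      using bounded_linear.pos_bounded[OF bounded_linear_prj] by blast
    obtain r' where r': "0 < r'" "ball z r' \<subseteq> U"
      using U xD open_contains_ball by blast
    \<comment> \<open>B bounds the projection to the base, so moving by less than \<rho> upstairs
      keeps the base point in U and within r of z.\<close>
    define \<rho> where "\<rho> = min r r' / B"
    have \<rho>: "0 < \<rho>" using r r' B by (simp add: \<rho>_def)
    have near: "(\<chi> i. y' $ Inl (Inl i)) \<in> U" "dist (\<chi> i. y' $ Inl (Inl i)) z < r" if "dist y' y < \<rho>" for y'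
    proof -
      have "prj (y' - y, 0) = ((\<chi> i. y' $ Inl (Inl i)) - z, 0)"
        unfolding z[symmetric] by (simp add: prj_def vec_eq_iff)
      then have "dist (\<chi> i. y' $ Inl (Inl i)) z \<le> dist y' y * B"
        using B(2)[of "(y' - y, 0)"] by (simp add: dist_norm norm_Pair)
      also have "\<dots> < \<rho> * B" using that B(1) by simp
      also have "\<dots> = min r r'" using B(1) by (simp add: \<rho>_def)
      finally have *: "dist (\<chi> i. y' $ Inl (Inl i)) z < min r r'" .
      then show "dist (\<chi> i. y' $ Inl (Inl i)) z < r" by simp
      show "(\<chi> i. y' $ Inl (Inl i)) \<in> U"
        using * r'(2) by (auto simp: dist_commute)
    qed
    have 1: "0 \<le> Re (pd big_dom Dt hf.N0 (y, t)) +
       \<delta> t * Re (bform sympl (hf.levi hf.N0 (y, t)) (hf.levi K (y, t)) + bform sympl (hf.levi K (y, t)) (hf.levi hf.N0 (y, t)))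
       + (\<delta> t)\<^sup>2 * Re (bform sympl (hf.levi K (y, t)) (hf.levi K (y, t)))"
    proof (rule hf.critical_point_inequality[OF K_smooth K_real big_interior[OF xB t] \<rho>])
      fix y' assume "dist y' y < \<rho>"
      from N[OF _ _ near[OF this], of t] t N0
      show "Re (hf.N0 (y, t) + \<delta> t * K (y, t)) \<le> Re (hf.N0 (y', t) + \<delta> t * K (y', t))" by simp
    qed
    have 2: "Re (pd big_dom Dt hf.N0 (y, t)) + C' * \<delta> t * Re (K (y, t)) + \<delta> t * Re (pd big_dom Dt K (y, t)) \<le> 0"
    proof (rule time_derivative_at_first_zero[OF xB t hf.N0_smooth K_smooth])
      show "(\<delta> has_real_derivative C' * \<delta> t) (at t)"
        unfolding \<delta>_def[abs_def] by (auto intro!: derivative_eq_intros)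
      show "0 \<le> Re (hf.N0 (y, s)) + \<delta> s * Re (K (y, s))" if "0 \<le> s" "s \<le> t" for s
        using N[OF that, of y] near[of y] \<rho> by simp
      show "Re (hf.N0 (y, t)) + \<delta> t * Re (K (y, t)) = 0"
        using N0 by simp
    qed
    have \<delta>t: "0 < \<delta> t" "\<delta> t \<le> 1" using \<epsilon> small by (auto simp: \<delta>_def)
    define E1 where "E1 = Re (bform sympl (hf.levi hf.N0 (y, t)) (hf.levi K (y, t)) + bform sympl (hf.levi K (y, t)) (hf.levi hf.N0 (y, t)))"
    define E2 where "E2 = Re (bform sympl (hf.levi K (y, t)) (hf.levi K (y, t)))"
    define K' where "K' = Re (pd big_dom Dt K (y, t))"
    have "\<delta> t * (C' * Re (K (y, t))) \<le> \<delta> t * (E1 + \<delta> t * E2 - K')"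
      using 1 2 unfolding E1_def[symmetric] E2_def[symmetric] K'_def[symmetric]
      by (simp add: algebra_simps power2_eq_square)
    then have "C' * Re (K (y, t)) \<le> E1 + \<delta> t * E2 - K'" using \<delta>t by simp
    also have "\<dots> \<le> \<bar>E1\<bar> + \<bar>E2\<bar> + \<bar>K'\<bar>"
    proof -
      have "\<delta> t * E2 \<le> \<bar>E2\<bar>"
        using mult_mono[of "\<delta> t" 1 E2 "\<bar>E2\<bar>"] mult_left_mono[of E2 "\<bar>E2\<bar>" "\<delta> t"]
          mult_right_mono[of "\<delta> t" 1 "\<bar>E2\<bar>"] \<delta>t by linarith
      then show ?thesis by linarith
    qed
    also have "\<dots> = err (y, t)" by (simp add: err_def E1_def E2_def K'_def)
    also have "\<dots> \<le> C * Re (K (y, t))"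
    proof -
      have "0 < Re (K (y, t))" "\<bar>err (y, t) / Re (K (y, t))\<bar> \<le> C"
        using Kpos[OF Qp] C[OF Qp] y by (simp_all add: x_def)
      then show ?thesis by (simp add: divide_le_eq abs_le_iff)
    qed
    finally show False using mult_strict_right_mono[OF C' Kpos[OF Qp]] y by (simp add: x_def)
  qed
qed

end

section \<open>Change of holomorphic coordinates\<close>

definition hol_fun :: "(complex^'n::finite \<Rightarrow> complex) \<Rightarrow> (complex^'n) set \<Rightarrow> bool" where
  "hol_fun f W \<longleftrightarrow> (\<forall>z\<in>W. \<exists>D. (f has_derivative D) (at z) \<and> (\<forall>v. D (\<i> *s v) = \<i> * D v))"

lemma complex_linear_scale:
  fixes D :: "complex^'n \<Rightarrow> complex"
  assumes D: "linear D" and i: "\<And>v. D (\<i> *s v) = \<i> * D v"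
  shows "D (c *s v) = c * D v"
proof -
  have "c *s v = Re c *\<^sub>R v + Im c *\<^sub>R (\<i> *s v)"
    by (simp add: vec_eq_iff complex_eq_iff)
  then have "D (c *s v) = Re c *\<^sub>R D v + Im c *\<^sub>R (\<i> * D v)"
    by (simp only: linear_add[OF D] linear_scale[OF D] i)
  also have "\<dots> = c * D v" by (simp add: complex_eq_iff)
  finally show ?thesis .
qed

lemma hol_fun_frechet:
  assumes "hol_fun f W" "z \<in> W"
  shows "(f has_derivative frechet_derivative f (at z)) (at z)"
    "frechet_derivative f (at z) (c *s v) = c * frechet_derivative f (at z) v"
proof -
  obtain D where D: "(f has_derivative D) (at z)" "\<forall>v. D (\<i> *s v) = \<i> * D v"
    using assms hol_fun_def by blast
  have eq: "frechet_derivative f (at z) = D" using frechet_derivative_at[OF D(1)] by simp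
  show "(f has_derivative frechet_derivative f (at z)) (at z)" using D(1) eq by simp
  show "frechet_derivative f (at z) (c *s v) = c * frechet_derivative f (at z) v"
    unfolding eq using complex_linear_scale[OF has_derivative_linear[OF D(1)]] D(2) by blast
qed

lemma hol_fun_line:
  assumes f: "hol_fun f W" and z: "z + \<zeta> *s w \<in> W"
  shows "((\<lambda>\<zeta>. f (z + \<zeta> *s w)) has_field_derivative frechet_derivative f (at (z + \<zeta> *s w)) w) (at \<zeta>)"
proof -
  have bl: "bounded_linear (\<lambda>\<zeta>. \<zeta> *s w)"
    by (rule linear_conv_bounded_linear[THEN iffD1], rule linearI)
      (simp_all add: vec_eq_iff algebra_simps)
  have "((\<lambda>\<zeta>. z + \<zeta> *s w) has_derivative (\<lambda>h. h *s w)) (at \<zeta>)"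
    using has_derivative_add[OF has_derivative_const bounded_linear_imp_has_derivative[OF bl]] by simp
  from has_derivative_compose[OF this hol_fun_frechet(1)[OF f z]]
  have "((\<lambda>\<zeta>. f (z + \<zeta> *s w)) has_derivative (\<lambda>h. frechet_derivative f (at (z + \<zeta> *s w)) (h *s w))) (at \<zeta>)" .
  then show ?thesis
    unfolding has_field_derivative_def hol_fun_frechet(2)[OF f z]
    by (simp add: mult.commute[of _ "frechet_derivative f (at (z + \<zeta> *s w)) w"])
qed

definition circ :: "real \<Rightarrow> complex" where "circ x = exp (2 * of_real pi * \<i> * of_real x)"

lemma norm_circ [simp]: "norm (circ x) = 1"
proof -
  have "circ x = exp (\<i> * of_real (2 * pi * x))" by (simp add: circ_def mult_ac)
  then show ?thesis by (simp only: norm_exp_i_times)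
qed

lemma continuous_circ [continuous_intros]: "continuous_on A f \<Longrightarrow> continuous_on A (\<lambda>x. circ (f x))"
  unfolding circ_def by (intro continuous_intros)

lemma norm_scale_vec: "norm (c *s v) = norm c * norm (v :: complex^'n)"
  by (simp add: norm_vec_def norm_mult L2_set_right_distrib)

text \<open>
  Differentiability at every point is all that is assumed of the transition maps; their smoothness comes
  from differentiating Cauchy's formula along complex lines under the integral.
\<close>

lemma Cauchy_directional_derivative:
  assumes f: "hol_fun f W" and r: "0 < r" and disc: "\<And>\<zeta>. norm \<zeta> \<le> r \<Longrightarrow> z + \<zeta> *s w \<in> W"
  shows "frechet_derivative f (at z) w = integral {0..1} (\<lambda>x. f (z + (r * circ x) *s w) / (r * circ x))"
proof -
  define g where "g \<zeta> = f (z + \<zeta> *s w)" for \<zeta>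
  have g': "(g has_field_derivative frechet_derivative f (at (z + \<zeta> *s w)) w) (at \<zeta>)" if "norm \<zeta> \<le> r" for \<zeta>
    unfolding g_def by (rule hol_fun_line[OF f disc[OF that]])
  have c: "continuous_on (cball 0 r) g"
    using DERIV_isCont[OF g'] by (intro continuous_at_imp_continuous_on) auto
  have h: "g holomorphic_on ball 0 r"
    using g' by (intro holomorphic_onI) (meson field_differentiable_at_within field_differentiable_def less_imp_le mem_ball_0)
  have 0: "(0::complex) \<in> ball 0 r" using r by simp
  have "(g has_field_derivative (1 / (2 * of_real pi * \<i>) * contour_integral (circlepath 0 r) (\<lambda>u. g u / (u - 0)\<^sup>2))) (at 0)"
    by (rule Cauchy_derivative_integral_circlepath(2)[OF c h 0])
  then have "frechet_derivative f (at z) w = 1 / (2 * of_real pi * \<i>) * contour_integral (circlepath 0 r) (\<lambda>u. g u / u\<^sup>2)"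
    using DERIV_unique[OF _ g'[of 0]] r by simp
  also have "contour_integral (circlepath 0 r) (\<lambda>u. g u / u\<^sup>2)
    = integral {0..1} (\<lambda>x. (2 * of_real pi * \<i>) * (g (r * circ x) / (r * circ x)))"
    unfolding contour_integral_integral
  proof (rule integral_cong)
    fix x :: real
    have "circ x \<noteq> 0" by (simp add: circ_def)
    then show "g (circlepath 0 r x) / (circlepath 0 r x)\<^sup>2 * vector_derivative (circlepath 0 r) (at x)
      = 2 * of_real pi * \<i> * (g (r * circ x) / (r * circ x))"
      using r unfolding vector_derivative_circlepath unfolding circlepath circ_def[symmetric]
      by (simp add: power2_eq_square field_simps)
  qed
  also have "1 / (2 * of_real pi * \<i>) * \<dots> = integral {0..1} (\<lambda>x. g (r * circ x) / (r * circ x))"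
    unfolding integral_mult_right by simp
  finally show ?thesis unfolding g_def .
qed

text \<open>Continuity of f alone makes the Cauchy integral depend continuously on z. This has to
  come before \<open>hol_fun_deriv\<close>, whose differentiation under the integral requires a
  continuous derivative.\<close>

lemma hol_fun_deriv_continuous:
  assumes f: "hol_fun f W" and R: "0 < R" and sub: "ball z0 (R + d) \<subseteq> W" and d: "0 < d"
  shows "continuous_on (ball z0 R) (\<lambda>z. frechet_derivative f (at z) w)"
proof -
  \<comment> \<open>Gives r |w| < d, so the discs around points of the ball of radius R stay in the
    ball of radius R + d; the summand 1 covers w = 0.\<close>
  define r where "r = d / (norm w + 1) / 2"
  have nw: "0 < norm w + 1" by (simp add: add_nonneg_pos)
  have r: "0 < r" using d nw by (simp add: r_def)
  have rw: "r * norm w < d"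
  proof -
    have "r * norm w \<le> r * (norm w + 1)" using r by simp
    also have "\<dots> = d / 2" using nw unfolding r_def by (simp add: field_simps)
    also have "\<dots> < d" using d by simp
    finally show ?thesis .
  qed
  have inW: "z + \<zeta> *s w \<in> W" if "z \<in> ball z0 R" "norm \<zeta> \<le> r" for z \<zeta>
  proof -
    have "norm (\<zeta> *s w) \<le> r * norm w" unfolding norm_scale_vec using that(2) by (intro mult_right_mono) auto
    then have "dist z0 (z + \<zeta> *s w) < R + d"
      using that(1) rw dist_triangle[of z0 "z + \<zeta> *s w" z] by (simp add: dist_norm)
    then show ?thesis using sub by auto
  qed
  have cf: "continuous_on (ball z0 (R + d)) f"
    using hol_fun_frechet(1)[OF f] sub has_derivative_continuous
    by (intro continuous_at_imp_continuous_on) blast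
  have m: "z + (r * circ x) *s w \<in> ball z0 (R + d)" if "z \<in> ball z0 R" for z x
  proof -
    have "norm ((r * circ x) *s w) \<le> r * norm w" unfolding norm_scale_vec using r by (simp add: norm_mult)
    then show ?thesis
      using that rw dist_triangle[of z0 "z + (r * circ x) *s w" z] by (simp add: dist_norm)
  qed
  have c: "continuous_on (ball z0 R) (\<lambda>z. integral (cbox 0 1) (\<lambda>x. f (z + (r * circ x) *s w) / (r * circ x)))"
  proof (rule integral_continuous_on_param)
    have s: "continuous_on A (\<lambda>p. c p *s w)" if "continuous_on A c" for A and c :: "_ \<Rightarrow> complex"
      unfolding vector_scalar_mult_def by (intro continuous_intros that)
    show "continuous_on (ball z0 R \<times> cbox 0 1) (\<lambda>(z, x). f (z + (r * circ x) *s w) / (r * circ x))"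
      unfolding case_prod_beta using m r
      by (intro continuous_on_divide continuous_on_compose2[OF cf] continuous_intros s) (auto simp: circ_def)
  qed
  show ?thesis
  proof (rule continuous_on_eq[OF c])
    fix z assume "z \<in> ball z0 R"
    show "integral (cbox 0 1) (\<lambda>x. f (z + (r * circ x) *s w) / (r * circ x)) = frechet_derivative f (at z) w"
      unfolding box_real(2)
      by (rule Cauchy_directional_derivative[OF f r inW[OF \<open>z \<in> ball z0 R\<close>], symmetric])
  qed
qed

text \<open>The class \<open>hol_fun\<close> is closed under directional derivatives, which is the
  induction step for smoothness of all orders.\<close>

lemma hol_fun_deriv:
  assumes f: "hol_fun f W" and W: "open W"
  shows "hol_fun (\<lambda>z. frechet_derivative f (at z) v) W"
  unfolding hol_fun_def
proof
  fix z0 assume "z0 \<in> W"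
  then obtain e where e: "0 < e" "ball z0 e \<subseteq> W" using W open_contains_ball by blast
  \<comment> \<open>One third for z itself, one for the Cauchy circle in direction v, and one for
    the circles that give continuity of the derivative at points of that circle.\<close>
  define R where "R = e / 3"
  have R: "0 < R" "ball z0 (R + R + R) \<subseteq> W" using e by (auto simp: R_def)
  define r where "r = R / (norm v + 1) / 2"
  have nv: "0 < norm v + 1" by (simp add: add_nonneg_pos)
  have r: "0 < r" using R nv by (simp add: r_def)
  have rv: "r * norm v < R"
  proof -
    have "r * norm v \<le> r * (norm v + 1)" using r by simp
    also have "\<dots> = R / 2" using nv unfolding r_def by (simp add: field_simps)
    also have "\<dots> < R" using R by simp
    finally show ?thesis .
  qed
  have m: "z + \<zeta> *s v \<in> ball z0 (R + R)" if "z \<in> ball z0 R" "norm \<zeta> \<le> r" for z \<zeta>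
  proof -
    have "norm (\<zeta> *s v) \<le> r * norm v" unfolding norm_scale_vec using that(2) by (intro mult_right_mono) auto
    then show ?thesis
      using that(1) rv dist_triangle[of z0 "z + \<zeta> *s v" z] by (simp add: dist_norm)
  qed
  have sub2: "ball z0 (R + R) \<subseteq> W" using R by auto
  have sub1: "ball z0 R \<subseteq> W" using R by auto
  define F where "F z = Blinfun (frechet_derivative f (at z))" for z
  have F: "blinfun_apply (F z) = frechet_derivative f (at z)" if "z \<in> W" for z
    unfolding F_def using hol_fun_frechet(1)[OF f that] has_derivative_bounded_linear
    by (intro bounded_linear_Blinfun_apply) blast
  \<comment> \<open>The Leibniz rule needs the derivative as an operator-valued continuous map; in
    finite dimension continuity may be checked vector by vector.\<close>
  have cF: "continuous_on (ball z0 (R + R)) F"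
  proof (rule continuous_on_blinfun_componentwise)
    fix i :: "complex^'a"
    have "continuous_on (ball z0 (R + R)) (\<lambda>z. frechet_derivative f (at z) i)"
      using hol_fun_deriv_continuous[OF f _ R(2), of i] R by simp
    then show "continuous_on (ball z0 (R + R)) (\<lambda>z. blinfun_apply (F z) i)"
      by (rule continuous_on_eq) (use F sub2 in auto)
  qed
  define c where "c x = inverse (r * circ x)" for x
  define fx where "fx z x = blinfun_mult_right (c x) o\<^sub>L F (z + (r * circ x) *s v)" for z x
  have mc: "z + (r * circ x) *s v \<in> ball z0 (R + R)" if "z \<in> ball z0 R" for z x
    by (rule m[OF that]) (use r in \<open>simp add: norm_mult\<close>)
  have s: "continuous_on A (\<lambda>p. c p *s v)" if "continuous_on A c" for A and c :: "_ \<Rightarrow> complex"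
    unfolding vector_scalar_mult_def by (intro continuous_intros that)
  have cf: "continuous_on (ball z0 (R + R)) f"
    using hol_fun_frechet(1)[OF f] sub2 has_derivative_continuous
    by (intro continuous_at_imp_continuous_on) blast
  have cc: "continuous_on A c" for A
    unfolding c_def using r by (intro continuous_intros) (auto simp: circ_def)
  have cfx: "continuous_on (ball z0 R \<times> cbox 0 1) (\<lambda>(z, x). fx z x)"
  proof -
    have "continuous_on (ball z0 R \<times> cbox 0 1) (\<lambda>p. F (fst p + (r * circ (snd p)) *s v))"
      using mc by (intro continuous_on_compose2[OF cF] continuous_intros s) auto
    moreover have "continuous_on (ball z0 R \<times> cbox 0 1) (\<lambda>p. c (snd p))"
      by (intro continuous_on_compose2[OF cc] continuous_intros) auto
    ultimately show ?thesis
      unfolding fx_def case_prod_beta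
      by (intro bounded_bilinear.continuous_on[OF bounded_bilinear_blinfun_compose]
          bounded_linear.continuous_on[OF bounded_linear_blinfun_mult_right])
  qed
  have "((\<lambda>z. integral (cbox 0 1) (\<lambda>x. c x * f (z + (r * circ x) *s v))) has_derivative
      blinfun_apply (integral (cbox 0 1) (fx z0))) (at z0 within ball z0 R)"
  proof (rule leibniz_rule[OF _ _ cfx])
    fix z x assume z: "z \<in> ball z0 R"
    have W': "z + (r * circ x) *s v \<in> W" using mc[OF z] sub2 by auto
    have "((\<lambda>z. z + (r * circ x) *s v) has_derivative (\<lambda>h. h)) (at z within ball z0 R)"
      by (auto intro!: derivative_eq_intros)
    from has_derivative_compose[OF this hol_fun_frechet(1)[OF f W']]
    have "((\<lambda>z. f (z + (r * circ x) *s v)) has_derivative (\<lambda>h. frechet_derivative f (at (z + (r * circ x) *s v)) h)) (at z within ball z0 R)" .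
    from has_derivative_mult_right[OF this, of "c x"]
    show "((\<lambda>z. c x * f (z + (r * circ x) *s v)) has_derivative blinfun_apply (fx z x)) (at z within ball z0 R)"
      by (simp add: fx_def F[OF W'] blinfun_compose.rep_eq o_def)
  next
    fix z assume z: "z \<in> ball z0 R"
    show "(\<lambda>x. c x * f (z + (r * circ x) *s v)) integrable_on cbox 0 1"
      using mc[OF z] by (intro integrable_continuous continuous_on_mult cc continuous_on_compose2[OF cf] continuous_intros s) auto
  qed (use R in auto)
  then have "((\<lambda>z. integral (cbox 0 1) (\<lambda>x. c x * f (z + (r * circ x) *s v))) has_derivative
      blinfun_apply (integral (cbox 0 1) (fx z0))) (at z0)"
    using R at_within_open[of z0 "ball z0 R"] by simp
  then have D: "((\<lambda>z. frechet_derivative f (at z) v) has_derivative blinfun_apply (integral (cbox 0 1) (fx z0))) (at z0)"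
  proof (rule has_derivative_transform_within_open)
    show "open (ball z0 R)" "z0 \<in> ball z0 R" using R by auto
    fix z assume z: "z \<in> ball z0 R"
    have "frechet_derivative f (at z) v = integral {0..1} (\<lambda>x. f (z + (r * circ x) *s v) / (r * circ x))"
      by (rule Cauchy_directional_derivative[OF f r]) (use m[OF z] sub2 in auto)
    then show "integral (cbox 0 1) (\<lambda>x. c x * f (z + (r * circ x) *s v)) = frechet_derivative f (at z) v"
      by (simp add: c_def divide_inverse mult.commute)
  qed
  have int: "fx z0 integrable_on cbox 0 1"
  proof (rule integrable_continuous)
    have "continuous_on (cbox 0 1) (\<lambda>x. (\<lambda>(z, x). fx z x) (z0, x))"
      by (rule continuous_on_compose2[OF cfx]) (use R in \<open>auto intro!: continuous_intros\<close>)
    then show "continuous_on (cbox 0 1) (fx z0)" by simp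
  qed
  have "blinfun_apply (integral (cbox 0 1) (fx z0)) (\<i> *s w) = \<i> * blinfun_apply (integral (cbox 0 1) (fx z0)) w" for w
  proof -
    have "blinfun_apply (fx z0 x) (\<i> *s w) = \<i> * blinfun_apply (fx z0 x) w" for x
    proof -
      have W': "z0 + (r * circ x) *s v \<in> W" using mc[of z0] R sub2 by auto
      show ?thesis
        by (simp add: fx_def F[OF W'] hol_fun_frechet(2)[OF f W'] blinfun_compose.rep_eq)
    qed
    then show ?thesis
      unfolding blinfun_apply_integral[OF int] by simp
  qed
  with D show "\<exists>D. ((\<lambda>z. frechet_derivative f (at z) v) has_derivative D) (at z0) \<and> (\<forall>v. D (\<i> *s v) = \<i> * D v)"
    by blast
qed

section \<open>Invariance of the curvature form under holomorphic coordinate changes\<close>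

definition mp :: "('n::finite \<Rightarrow> 'n \<Rightarrow> 'x \<Rightarrow> complex) \<Rightarrow> ('n \<Rightarrow> 'n \<Rightarrow> 'x \<Rightarrow> complex) \<Rightarrow> 'n \<Rightarrow> 'n \<Rightarrow> 'x \<Rightarrow> complex" where
  "mp F F' i j x = (\<Sum>\<Sum>k. F i k x * F' k j x)"

lemma mx_mp: "mx (mp F F') x = mx F x ** mx F' x"
  by (simp add: vec_eq_iff mp_def matrix_matrix_mult_def)

lemma matrix_mult_add_right: "(B + C) ** A = B ** A + C ** (A :: complex^'n^'n)"
  by (simp add: vec_eq_iff matrix_matrix_mult_def sum.distrib algebra_simps)

lemma matrix_mult_diff: "(B - C) ** A = B ** A - C ** (A :: complex^'n^'n)" "A ** (B - C) = A ** B - A ** C"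
  by (simp_all add: vec_eq_iff matrix_matrix_mult_def sum_subtractf algebra_simps)

context herm_family
begin

definition dF :: "((complex^'n) \<times> real) \<times> ((complex^'n) \<times> real) \<Rightarrow>
    ('n \<Rightarrow> 'n \<Rightarrow> (complex^'n) \<times> real \<Rightarrow> complex) \<Rightarrow> 'n \<Rightarrow> 'n \<Rightarrow> (complex^'n) \<times> real \<Rightarrow> complex" where
  "dF q F i j = cd D0 (fst q) (snd q) (F i j)"

lemma dm_dF: "dm q F x = mx (dF q F) x"
  by (simp add: dm_def dF_def mx_def)

lemma ddm_dF: "ddm q q' F x = mx (dF q (dF q' F)) x"
  by (simp add: ddm_def dF_def mx_def)

lemma dF_smooth [simp]: "(\<And>i j. smooth_on D0 (F i j)) \<Longrightarrow> smooth_on D0 (dF q F i j)"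
  by (simp add: dF_def)

lemma mp_smooth [simp]: "(\<And>i j. smooth_on D0 (F i j)) \<Longrightarrow> (\<And>i j. smooth_on D0 (F' i j)) \<Longrightarrow> smooth_on D0 (mp F F' i j)"
  unfolding mp_def[abs_def] by simp

lemma dF_mp:
  assumes "\<And>i j. smooth_on D0 (F i j)" "\<And>i j. smooth_on D0 (F' i j)"
  shows "dF q (mp F F') = (\<lambda>i j x. mp (dF q F) F' i j x + mp F (dF q F') i j x)"
  using assms by (simp add: dF_def mp_def[abs_def] fun_eq_iff sum.distrib)

lemma dF_add:
  assumes "\<And>i j. smooth_on D0 (F i j)" "\<And>i j. smooth_on D0 (F' i j)"
  shows "dF q (\<lambda>i j x. F i j x + F' i j x) = (\<lambda>i j x. dF q F i j x + dF q F' i j x)"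
  using assms by (intro ext) (simp add: dF_def)

lemma dF_cong: "(\<And>i j x. x \<in> D0 \<Longrightarrow> F i j x = F' i j x) \<Longrightarrow> dF q F = dF q F'"
  unfolding dF_def by (intro ext) (metis b.cd_cong)

lemma dF_zero: "dF q (\<lambda>i j x. 0) = (\<lambda>i j x. 0)"
  by (simp add: dF_def fun_eq_iff)

end

lemma mp_zero: "mp (\<lambda>i j x. 0) F = (\<lambda>i j x. 0)" "mp F (\<lambda>i j x. 0) = (\<lambda>i j x. 0)"
  by (simp_all add: mp_def fun_eq_iff)

lemma mx_add: "mx (\<lambda>i j x. F i j x + F' i j x) x = mx F x + mx F' x"
  by (simp add: vec_eq_iff)

locale chart_change =
  A: herm_family W \<tau> G + B: herm_family W' \<tau> G'
  for W W' :: "(complex^'n::finite) set" and \<tau> and G G' :: "'n \<Rightarrow> 'n \<Rightarrow> (complex^'n) \<times> real \<Rightarrow> complex" +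
  fixes \<phi> :: "complex^'n \<Rightarrow> complex^'n"
  assumes hol: "hol_fun (\<lambda>z. \<phi> z $ a) W"
    and maps: "z \<in> W \<Longrightarrow> \<phi> z \<in> W'"
    and G_eq: "z \<in> W \<Longrightarrow> t \<in> time_int \<tau> \<Longrightarrow> G i j (z, t) = (\<Sum>\<Sum>a b. frechet_derivative (\<lambda>z. \<phi> z $ a) (at z) (axis i 1) * G' a b (\<phi> z, t) *
        cnj (frechet_derivative (\<lambda>z. \<phi> z $ b) (at z) (axis j 1)))"
begin

abbreviation DA where "DA \<equiv> W \<times> time_int \<tau>"
abbreviation DB where "DB \<equiv> W' \<times> time_int \<tau>"

definition jac :: "'n \<Rightarrow> 'n \<Rightarrow> complex^'n \<Rightarrow> complex" where
  "jac a i z = frechet_derivative (\<lambda>z. \<phi> z $ a) (at z) (axis i 1)"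

definition psi :: "(complex^'n) \<times> real \<Rightarrow> (complex^'n) \<times> real" where
  "psi x = (\<phi> (fst x), snd x)"

lemma psi_DB: "x \<in> DA \<Longrightarrow> psi x \<in> DB"
  using maps by (auto simp: psi_def)

lemma hol_fst_has_derivative:
  assumes "hol_fun f W" "x \<in> DA"
  shows "((\<lambda>x. f (fst x)) has_derivative (\<lambda>w. frechet_derivative f (at (fst x)) (fst w))) (at x within DA)"
  by (rule has_derivative_compose[OF has_derivative_fst[OF has_derivative_ident]])
    (use assms hol_fun_frechet(1) in auto)

lemma hol_fst_smooth [simp]:
  assumes "hol_fun f W"
  shows "smooth_on DA (\<lambda>x. f (fst x))"
proof -
  have "Ck_on k DA (\<lambda>x. f (fst x))" for k
    using assms
  proof (induction k arbitrary: f)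
    case 0
    have "continuous (at x within DA) (\<lambda>x. f (fst x))" if "x \<in> DA" for x
      using hol_fst_has_derivative[OF 0 that] has_derivative_continuous by blast
    then show ?case by (simp add: continuous_on_eq_continuous_within)
  next
    case (Suc k)
    have "Ck_on k DA (\<lambda>x. frechet_derivative (\<lambda>x. f (fst x)) (at x within DA) w)
      \<longleftrightarrow> Ck_on k DA (\<lambda>x. frechet_derivative f (at (fst x)) (fst w))" for w
      by (rule Ck_on_cong) (simp only: A.b.fd_eq[OF hol_fst_has_derivative[OF Suc.prems]])
    moreover have "Ck_on k DA (\<lambda>x. frechet_derivative f (at (fst x)) (fst w))" for w
      by (rule Suc.IH[of "\<lambda>z. frechet_derivative f (at z) (fst w)"])
        (rule hol_fun_deriv[OF Suc.prems A.U])
    moreover have "(\<lambda>x. f (fst x)) differentiable_on DA"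
      using hol_fst_has_derivative[OF Suc.prems] differentiable_on_def differentiable_def by blast
    ultimately show ?case unfolding Ck_on.simps by blast
  qed
  then show ?thesis by (simp add: smooth_on_def)
qed

lemma hol_fst_dd:
  assumes "hol_fun f W"
  shows "dd DA w (\<lambda>x. f (fst x)) = (\<lambda>x. if x \<in> DA then frechet_derivative f (at (fst x)) (fst w) else 0)"
  by (rule A.b.dd_ext) (rule hol_fst_has_derivative[OF assms])

lemma axis_scale: "axis i z = z *s axis i (1 :: complex)"
  by (simp add: vec_eq_iff axis_def)

lemma frechet_axis:
  assumes "hol_fun f W" "z \<in> W"
  shows "frechet_derivative f (at z) (axis i c) = c * frechet_derivative f (at z) (axis i 1)"
  using hol_fun_frechet(2)[OF assms, of c "axis i 1"] axis_scale[of i c] by simp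

lemma hol_fst_pd:
  assumes f: "hol_fun f W"
  shows "pd DA (Dzb i) (\<lambda>x. f (fst x)) = (\<lambda>x. 0)"
  unfolding pd_def cd_def hol_fst_dd[OF f]
  by (auto simp: fun_eq_iff frechet_axis[OF f, of _ _ "1/2"] frechet_axis[OF f, of _ _ "\<i>/2"])

lemma jac_hol: "hol_fun (jac a i) W"
  unfolding jac_def[abs_def] by (rule hol_fun_deriv[OF hol A.U])

text \<open>The metric factors as \<open>Bt\<close>, \<open>Gp\<close>, \<open>Bb\<close>:
  transposed Jacobian, pulled back metric, conjugate Jacobian. The point of the splitting is that
  the barred derivatives of \<open>Bt\<close> and the unbarred ones of \<open>Bb\<close>
  vanish.\<close>

definition Bt where "Bt i a x = jac a i (fst x)"
definition Bb where "Bb b j x = cnj (jac b j (fst x))"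
definition Gp where "Gp a b x = G' a b (psi x)"

lemma psi_has_derivative:
  assumes x: "x \<in> DA"
  shows "(psi has_derivative (\<lambda>w. ((\<chi> a. frechet_derivative (\<lambda>z. \<phi> z $ a) (at (fst x)) (fst w)), snd w))) (at x within DA)"
proof -
  have "((\<lambda>x. \<phi> (fst x)) has_derivative (\<lambda>w. \<chi> a. frechet_derivative (\<lambda>z. \<phi> z $ a) (at (fst x)) (fst w))) (at x within DA)"
  proof -
    have "((\<lambda>x. \<Sum>\<Sum>a. axis a (\<phi> (fst x) $ a)) has_derivative
      (\<lambda>w. \<Sum>\<Sum>a. axis a (frechet_derivative (\<lambda>z. \<phi> z $ a) (at (fst x)) (fst w)))) (at x within DA)"
    proof (rule has_derivative_sum)
      fix a
      have bl: "bounded_linear (axis a :: complex \<Rightarrow> complex^'n)"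
        by (rule linear_conv_bounded_linear[THEN iffD1], rule linearI) (auto simp: vec_eq_iff axis_def)
      show "((\<lambda>x. axis a (\<phi> (fst x) $ a)) has_derivative
       (\<lambda>w. axis a (frechet_derivative (\<lambda>z. \<phi> z $ a) (at (fst x)) (fst w)))) (at x within DA)"
        by (rule bounded_linear.has_derivative[OF bl hol_fst_has_derivative[OF hol x]])
    qed
    moreover have "(\<Sum>\<Sum>a. axis a (c a)) = (\<chi> a. c a)" for c :: "'n \<Rightarrow> complex"
      by (simp add: vec_eq_iff axis_def)
    ultimately show ?thesis by simp
  qed
  then show ?thesis
    unfolding psi_def[abs_def] by (intro has_derivative_Pair has_derivative_snd has_derivative_ident)
qed

lemma pullback_has_derivative:
  assumes f: "smooth_on DB f" and x: "x \<in> DA"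
  shows "((\<lambda>x. f (psi x)) has_derivative
    (\<lambda>w. dd DB ((\<chi> a. frechet_derivative (\<lambda>z. \<phi> z $ a) (at (fst x)) (fst w)), snd w) f (psi x))) (at x within DA)"
proof (rule has_derivative_in_compose[OF psi_has_derivative[OF x]])
  show "(f has_derivative (\<lambda>v. dd DB v f (psi x))) (at (psi x) within psi ` DA)"
    by (rule has_derivative_subset[OF B.b.has_derivative_dd[OF f psi_DB[OF x]]]) (rule image_subsetI, rule psi_DB)
qed

text \<open>A derivative of the composite is a combination of pulled back derivatives of f, covered
  by the induction hypothesis, with coefficients smooth by holomorphy.\<close>

lemma pullback_smooth:
  fixes f :: "(complex^'n) \<times> real \<Rightarrow> complex"
  assumes "smooth_on DB f"
  shows "smooth_on DA (\<lambda>x. f (psi x))"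
proof -
  have "Ck_on k DA (\<lambda>x. f (psi x))" for k
    using assms
  proof (induction k arbitrary: f)
    case 0
    have "continuous (at x within DA) (\<lambda>x. f (psi x))" if "x \<in> DA" for x
      using pullback_has_derivative[OF 0 that] has_derivative_continuous by blast
    then show ?case by (simp add: continuous_on_eq_continuous_within)
  next
    case (Suc k)
    note f = Suc.prems
    let ?c = "\<lambda>a w x. frechet_derivative (\<lambda>z. \<phi> z $ a) (at (fst x)) (fst w)"
    \<comment> \<open>Real and imaginary parts of the Jacobian coefficients are expressed by c and
      \<open>cnj c\<close>, so that every coefficient remains a complex-valued smooth
      function.\<close>
    have "Ck_on k DA (\<lambda>x. frechet_derivative (\<lambda>x. f (psi x)) (at x within DA) w)
      \<longleftrightarrow> Ck_on k DA (\<lambda>x. (\<Sum>\<Sum>a. (?c a w x + cnj (?c a w x)) * (1/2) * dd DB (axis a 1, 0) f (psi x)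
         + (?c a w x - cnj (?c a w x)) * (1 / (2 * \<i>)) * dd DB (axis a \<i>, 0) f (psi x))
         + of_real (snd w) * dd DB (0, 1) f (psi x))" for w
    proof (rule Ck_on_cong)
      fix x assume x: "x \<in> DA"
      have re: "(c + cnj c) * (1/2) * d = Re c *\<^sub>R d" and im: "(c - cnj c) * (1 / (2 * \<i>)) * d = Im c *\<^sub>R d" for c d
        by (simp_all add: complex_eq_iff)
      have "(v, s) = (v, 0) + s *\<^sub>R (0, 1)" for v :: "complex^'n" and s :: real by simp
      then have split: "dd DB (v, s) f (psi x) = dd DB (v, 0) f (psi x) + s *\<^sub>R dd DB (0, 1) f (psi x)" for v s
        by (metis B.b.dd_dir_add[OF f] B.b.dd_dir_scale[OF f])
      have full: "dd DB (v, s) f (psi x) = (\<Sum>\<Sum>a. Re (v $ a) *\<^sub>R dd DB (axis a 1, 0) f (psi x) + Im (v $ a) *\<^sub>R dd DB (axis a \<i>, 0) f (psi x))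
         + of_real s * dd DB (0, 1) f (psi x)" for v s
        by (simp only: split[of v s] B.b.dd_vec[OF f, of v] scaleR_conv_of_real)
      show "frechet_derivative (\<lambda>x. f (psi x)) (at x within DA) w =
         (\<Sum>\<Sum>a. (?c a w x + cnj (?c a w x)) * (1/2) * dd DB (axis a 1, 0) f (psi x)
         + (?c a w x - cnj (?c a w x)) * (1 / (2 * \<i>)) * dd DB (axis a \<i>, 0) f (psi x))
         + of_real (snd w) * dd DB (0, 1) f (psi x)"
        unfolding A.b.fd_eq[OF pullback_has_derivative[OF f x] x] re im
        by (simp only: full[of "\<chi> a. ?c a w x" "snd w"] vec_lambda_beta)
    qed
    moreover have "Ck_on k DA (\<lambda>x. (\<Sum>\<Sum>a. (?c a w x + cnj (?c a w x)) * (1/2) * dd DB (axis a 1, 0) f (psi x)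
         + (?c a w x - cnj (?c a w x)) * (1 / (2 * \<i>)) * dd DB (axis a \<i>, 0) f (psi x))
         + of_real (snd w) * dd DB (0, 1) f (psi x))" for w
    proof -
      have c: "smooth_on DA (\<lambda>x. ?c a w x)" for a
        by (rule hol_fst_smooth[of "\<lambda>z. frechet_derivative (\<lambda>z. \<phi> z $ a) (at z) (fst w)"])
          (rule hol_fun_deriv[OF hol A.U])
      have s: "Ck_on k DA h" if "smooth_on DA h" for h :: "_ \<Rightarrow> complex"
        using that by (simp add: smooth_on_def)
      have d: "Ck_on k DA (\<lambda>x. dd DB v f (psi x))" for v
        by (rule Suc.IH) (rule B.b.dd_smooth[OF f])
      have sum: "Ck_on k DA (\<lambda>x. \<Sum>a\<in>I. h a x)" if "\<And>a. Ck_on k DA (h a)" for I and h :: "'n \<Rightarrow> _ \<Rightarrow> complex"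
        using that by (induction I rule: infinite_finite_induct) (auto intro: A.b.Ck_on_add A.b.Ck_on_const)
      show ?thesis
        by (intro A.b.Ck_on_add sum A.b.Ck_on_mult d s A.b.smooth_mult A.b.smooth_add A.b.smooth_diff
            A.b.smooth_cnj A.b.smooth_on_const c)
    qed
    moreover have "(\<lambda>x. f (psi x)) differentiable_on DA"
      using pullback_has_derivative[OF f] differentiable_on_def differentiable_def by blast
    ultimately show ?case unfolding Ck_on.simps by blast
  qed
  then show ?thesis by (simp add: smooth_on_def)
qed

lemma pullback_pd:
  assumes f: "smooth_on DB f" and x: "x \<in> DA"
  shows "pd DA (Dz i) (\<lambda>x. f (psi x)) x = (\<Sum>\<Sum>a. jac a i (fst x) * pd DB (Dz a) f (psi x))"
    and "pd DA (Dzb i) (\<lambda>x. f (psi x)) x = (\<Sum>\<Sum>a. cnj (jac a i (fst x)) * pd DB (Dzb a) f (psi x))"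
proof -
  let ?b = "\<chi> a. jac a i (fst x)"
  have z: "fst x \<in> W" using x by auto
  have d: "dd DA (axis i c, 0) (\<lambda>x. f (psi x)) x = dd DB (c *s ?b, 0) f (psi x)" for c
  proof -
    have "(\<chi> a. frechet_derivative (\<lambda>z. \<phi> z $ a) (at (fst x)) (axis i c)) = c *s ?b"
      by (simp add: vec_eq_iff jac_def frechet_axis[OF hol z, where i = i and c = c])
    then show ?thesis
      using A.b.dd_eq[OF pullback_has_derivative[OF f x] x, of "(axis i c, 0)"] by simp
  qed
  have s: "(1/2) *s ?b = (1/2) *\<^sub>R ?b" "(- \<i>/2) *s ?b = - (1/2) *\<^sub>R (\<i> *s ?b)" "(\<i>/2) *s ?b = (1/2) *\<^sub>R (\<i> *s ?b)"
    by (simp_all add: vec_eq_iff complex_eq_iff)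
  show "pd DA (Dz i) (\<lambda>x. f (psi x)) x = (\<Sum>\<Sum>a. jac a i (fst x) * pd DB (Dz a) f (psi x))"
    using B.b.sum_dz_cd[OF f, of ?b "psi x"] unfolding pd_def cd_def pvec.simps ivec.simps d s by simp
  show "pd DA (Dzb i) (\<lambda>x. f (psi x)) x = (\<Sum>\<Sum>a. cnj (jac a i (fst x)) * pd DB (Dzb a) f (psi x))"
    using B.b.sum_dzb_cd[OF f, of ?b "psi x"] unfolding pd_def cd_def pvec.simps ivec.simps d s by simp
qed

lemma Bt_smooth [simp]: "smooth_on DA (Bt i a)"
  unfolding Bt_def[abs_def] by (rule hol_fst_smooth[OF jac_hol])

lemma Bb_smooth [simp]: "smooth_on DA (Bb b j)"
  unfolding Bb_def[abs_def] by (intro A.b.smooth_cnj hol_fst_smooth[OF jac_hol])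

lemma Gp_smooth [simp]: "smooth_on DA (Gp a b)"
  unfolding Gp_def[abs_def] by (rule pullback_smooth[OF B.G_smooth])

lemma dF_Bt: "A.dF (dzbv v) Bt = (\<lambda>i j x. 0)"
proof (intro ext)
  fix i a x
  have "A.dF (dzbv v) Bt i a x = (\<Sum>\<Sum>m. cnj (v $ m) * pd DA (Dzb m) (Bt i a) x)"
    unfolding A.dF_def dzbv_def fst_conv snd_conv by (rule A.b.sum_dzb_cd[symmetric]) simp
  also have "\<dots> = 0" unfolding Bt_def[abs_def] hol_fst_pd[OF jac_hol] by simp
  finally show "A.dF (dzbv v) Bt i a x = 0" .
qed

lemma dF_Bb: "A.dF (dzv v) Bb = (\<lambda>i j x. 0)"
proof (intro ext)
  fix b j x
  have "A.dF (dzv v) Bb b j x = (\<Sum>\<Sum>m. v $ m * pd DA (Dz m) (Bb b j) x)"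
    unfolding A.dF_def dzv_def fst_conv snd_conv by (rule A.b.sum_dz_cd[symmetric]) simp
  also have "\<dots> = 0"
    unfolding Bb_def[abs_def] A.b.pd_cnj[OF hol_fst_smooth[OF jac_hol]] cdir.simps hol_fst_pd[OF jac_hol] by simp
  finally show "A.dF (dzv v) Bb b j x = 0" .
qed

lemma dF_dF_Bb: "A.dF (dzv v) (A.dF (dzbv v) Bb) = (\<lambda>i j x. 0)"
proof -
  have "A.dF (dzv v) (A.dF (dzbv v) Bb) = A.dF (dzbv v) (A.dF (dzv v) Bb)"
    unfolding A.dF_def by (intro ext) (metis A.b.cd_commute Bb_smooth)
  then show ?thesis by (simp add: dF_Bb A.dF_zero)
qed

lemma G_factor: "x \<in> DA \<Longrightarrow> G i j x = mp (mp Bt Gp) Bb i j x"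
proof -
  assume "x \<in> DA"
  then obtain z t where x: "x = (z, t)" "z \<in> W" "t \<in> time_int \<tau>" by auto
  have "G i j x = (\<Sum>\<Sum>b a. Bt i a x * Gp a b x * Bb b j x)"
    unfolding x(1) G_eq[OF x(2,3)] Bt_def Gp_def Bb_def psi_def jac_def fst_conv snd_conv by (rule sum.swap)
  then show ?thesis by (simp add: mp_def sum_distrib_right)
qed

lemma dF_G: "A.dF q G = A.dF q (mp (mp Bt Gp) Bb)"
  by (rule A.dF_cong) (rule G_factor)

context
  fixes x :: "(complex^'n) \<times> real" and v :: "complex^'n"
  assumes x: "x \<in> DA"
begin

text \<open>The push-forward of v by the coordinate change.\<close>

definition Bv :: "complex^'n" where "Bv = (\<chi> a. \<Sum>\<Sum>m. jac a m (fst x) * v $ m)"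

lemma dGp: "mx (A.dF (dzv v) Gp) x = B.dm (dzv Bv) G' (psi x)"
proof -
  have "A.dF (dzv v) Gp a b x = B.dm (dzv Bv) G' (psi x) $ a $ b" for a b
  proof -
    have "A.dF (dzv v) Gp a b x = (\<Sum>\<Sum>m. v $ m * pd DA (Dz m) (Gp a b) x)"
      unfolding A.dF_def dzv_def fst_conv snd_conv by (rule A.b.sum_dz_cd[symmetric]) simp
    also have "\<dots> = (\<Sum>\<Sum>m c. jac c m (fst x) * v $ m * pd DB (Dz c) (G' a b) (psi x))"
      unfolding Gp_def[abs_def] pullback_pd(1)[OF B.G_smooth x] by (simp add: sum_distrib_left mult_ac)
    also have "\<dots> = (\<Sum>\<Sum>c m. jac c m (fst x) * v $ m * pd DB (Dz c) (G' a b) (psi x))"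
      by (rule sum.swap)
    finally show ?thesis
      unfolding B.dzv_nth[OF B.G_smooth] Bv_def by (simp add: sum_distrib_right)
  qed
  then show ?thesis by (simp add: vec_eq_iff)
qed

lemma dGp_bar: "mx (A.dF (dzbv v) Gp) x = B.dm (dzbv Bv) G' (psi x)"
proof -
  have "A.dF (dzbv v) Gp a b x = B.dm (dzbv Bv) G' (psi x) $ a $ b" for a b
  proof -
    have "A.dF (dzbv v) Gp a b x = (\<Sum>\<Sum>m. cnj (v $ m) * pd DA (Dzb m) (Gp a b) x)"
      unfolding A.dF_def dzbv_def fst_conv snd_conv by (rule A.b.sum_dzb_cd[symmetric]) simp
    also have "\<dots> = (\<Sum>\<Sum>m c. cnj (jac c m (fst x) * v $ m) * pd DB (Dzb c) (G' a b) (psi x))"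
      unfolding Gp_def[abs_def] pullback_pd(2)[OF B.G_smooth x] by (simp add: sum_distrib_left mult_ac)
    also have "\<dots> = (\<Sum>\<Sum>c m. cnj (jac c m (fst x) * v $ m) * pd DB (Dzb c) (G' a b) (psi x))"
      by (rule sum.swap)
    finally show ?thesis
      unfolding B.dzbv_nth[OF B.G_smooth] Bv_def by (simp add: sum_distrib_right)
  qed
  then show ?thesis by (simp add: vec_eq_iff)
qed

text \<open>No derivative of the Jacobian appears: the barred derivative leaves its conjugate in
  front, and that is annihilated by unbarred derivatives.\<close>

lemma ddGp: "mx (A.dF (dzv v) (A.dF (dzbv v) Gp)) x = B.ddm (dzv Bv) (dzbv Bv) G' (psi x)"
proof -
  have "A.dF (dzv v) (A.dF (dzbv v) Gp) a b x = B.ddm (dzv Bv) (dzbv Bv) G' (psi x) $ a $ b" for a b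
  proof -
    have pdzb: "pd DA (Dz m) (pd DA (Dzb n) (Gp a b)) x
      = (\<Sum>\<Sum>d c. cnj (jac d n (fst x)) * (jac c m (fst x) * pd DB (Dz c) (pd DB (Dzb d) (G' a b)) (psi x)))" for m n
    proof -
      have 1: "pd DA (Dz m) (pd DA (Dzb n) (Gp a b)) = pd DA (Dz m) (\<lambda>x. \<Sum>\<Sum>d. Bb d n x * pd DB (Dzb d) (G' a b) (psi x))"
        by (rule A.b.pd_cong) (simp add: Gp_def[abs_def] pullback_pd(2)[OF B.G_smooth] Bb_def)
      have 2: "pd DA (Dz m) (\<lambda>x. \<Sum>\<Sum>d. Bb d n x * pd DB (Dzb d) (G' a b) (psi x)) x
        = (\<Sum>\<Sum>d. Bb d n x * pd DA (Dz m) (\<lambda>x. pd DB (Dzb d) (G' a b) (psi x)) x)"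
      proof -
        have "pd DA (Dz m) (Bb d n) = (\<lambda>x. 0)" for d
          unfolding Bb_def[abs_def] A.b.pd_cnj[OF hol_fst_smooth[OF jac_hol]] cdir.simps hol_fst_pd[OF jac_hol] by simp
        then show ?thesis by (simp add: pullback_smooth)
      qed
      show ?thesis
        unfolding 1 2 by (simp add: pullback_pd(1)[OF _ x] Bb_def sum_distrib_left)
    qed
    have "A.dF (dzv v) (A.dF (dzbv v) Gp) a b x
       = (\<Sum>\<Sum>m n. v $ m * cnj (v $ n) * pd DA (Dz m) (pd DA (Dzb n) (Gp a b)) x)"
      using A.ddzv_nth[where F = Gp and i = a and j = b, OF Gp_smooth, of v x] by (simp add: A.ddm_dF)
    also have "\<dots> = (\<Sum>\<Sum>m n c d. (jac c m (fst x) * v $ m) * cnj (jac d n (fst x) * v $ n)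
        * pd DB (Dz c) (pd DB (Dzb d) (G' a b)) (psi x))"
      unfolding pdzb sum_distrib_left
      by (rule sum.cong[OF refl], rule sum.cong[OF refl], subst sum.swap) (simp add: mult_ac)
    also have "\<dots> = (\<Sum>\<Sum>c d m n. (jac c m (fst x) * v $ m) * cnj (jac d n (fst x) * v $ n)
        * pd DB (Dz c) (pd DB (Dzb d) (G' a b)) (psi x))"
      by (rule sum_swap_2_2)
    also have "\<dots> = B.ddm (dzv Bv) (dzbv Bv) G' (psi x) $ a $ b"
      unfolding B.ddzv_nth[OF B.G_smooth] Bv_def vec_lambda_beta cnj_sum
      unfolding sum_product unfolding sum_distrib_right ..
    finally show ?thesis .
  qed
  then show ?thesis by (simp add: vec_eq_iff)
qed

lemma metric_factor: "mx G x = mx Bt x ** mx G' (psi x) ** mx Bb x"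
proof -
  have "mx Gp x = mx G' (psi x)" by (simp add: vec_eq_iff Gp_def)
  moreover have "mx G x = mx (mp (mp Bt Gp) Bb) x"
    using G_factor[OF x] by (simp add: vec_eq_iff)
  ultimately show ?thesis by (simp add: mx_mp)
qed

lemma inverse_factor: "mx Bb x ** mx A.H x ** mx Bt x = mx B.H (psi x)"
proof -
  have "(mx A.H x ** mx Bt x ** mx G' (psi x)) ** mx Bb x = mat 1"
    using A.H_G(1)[OF x] by (simp add: metric_factor matrix_mul_assoc)
  then have "mx Bb x ** (mx A.H x ** mx Bt x ** mx G' (psi x)) = mat 1"
    using matrix_left_right_inverse by blast
  then have "(mx Bb x ** mx A.H x ** mx Bt x) ** mx G' (psi x) = mat 1"
    by (simp add: matrix_mul_assoc)
  from B.mult_right_inverse_eq[OF psi_DB[OF x] this] show ?thesis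
    by (simp add: matrix_mul_lid)
qed

text \<open>Tensoriality of the Chern curvature: derivatives of the Jacobian factors enter the
  quadratic term and the second derivative of G in the same way and cancel in the
  difference.\<close>

lemma curv_matrix_factor:
  "A.dm (dzv v) G x ** mx A.H x ** A.dm (dzbv v) G x - A.ddm (dzv v) (dzbv v) G x
   = mx Bt x ** (B.dm (dzv Bv) G' (psi x) ** mx B.H (psi x) ** B.dm (dzbv Bv) G' (psi x)
       - B.ddm (dzv Bv) (dzbv Bv) G' (psi x)) ** mx Bb x"
proof -
  let ?q = "dzv v" and ?r = "dzbv v"
  have Gp: "mx Gp x = mx G' (psi x)" by (simp add: vec_eq_iff Gp_def)
  let ?dBt = "mx (A.dF ?q Bt) x" and ?dBb = "mx (A.dF ?r Bb) x"
  let ?Bt = "mx Bt x" and ?Bb = "mx Bb x" and ?G = "mx G' (psi x)" and ?H = "mx B.H (psi x)"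
  let ?d = "B.dm (dzv Bv) G' (psi x)" and ?e = "B.dm (dzbv Bv) G' (psi x)" and ?de = "B.ddm (dzv Bv) (dzbv Bv) G' (psi x)"
  have 1: "A.dm ?q G x = (?dBt ** ?G + ?Bt ** ?d) ** ?Bb"
    unfolding A.dm_dF dF_G
    by (simp add: A.dF_mp dF_Bb mp_zero mx_mp mx_add Gp dGp)
  have fam: "A.dF ?r G = (\<lambda>i j x. mp (mp Bt (A.dF ?r Gp)) Bb i j x + mp (mp Bt Gp) (A.dF ?r Bb) i j x)"
    unfolding dF_G by (simp add: A.dF_mp dF_Bt mp_zero)
  have 2: "A.dm ?r G x = ?Bt ** (?e ** ?Bb + ?G ** ?dBb)"
    unfolding A.dm_dF fam by (simp add: mx_mp mx_add Gp dGp_bar matrix_add_ldistrib matrix_mul_assoc)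
  have 3: "A.ddm ?q ?r G x = (?dBt ** ?e + ?Bt ** ?de) ** ?Bb + (?dBt ** ?G + ?Bt ** ?d) ** ?dBb"
    unfolding A.ddm_dF fam
    by (simp add: A.dF_add A.dF_mp dF_Bb dF_dF_Bb mp_zero mx_mp mx_add Gp dGp dGp_bar ddGp)
  have GH: "?G ** ?H = mat 1" "?H ** ?G = mat 1" by (rule B.H_G[OF psi_DB[OF x]])+
  have "A.dm ?q G x ** mx A.H x ** A.dm ?r G x
    = (?dBt ** ?G + ?Bt ** ?d) ** (?Bb ** mx A.H x ** ?Bt) ** (?e ** ?Bb + ?G ** ?dBb)"
    unfolding 1 2 by (simp only: matrix_mul_assoc)
  also have "\<dots> = (?dBt ** (?G ** ?H) + ?Bt ** ?d ** ?H) ** (?e ** ?Bb + ?G ** ?dBb)"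
    unfolding inverse_factor by (simp only: matrix_mult_add_right matrix_mul_assoc)
  also have "\<dots> = ?dBt ** ?e ** ?Bb + ?dBt ** ?G ** ?dBb + ?Bt ** ?d ** ?H ** ?e ** ?Bb + ?Bt ** ?d ** (?H ** ?G) ** ?dBb"
    unfolding GH(1) by (simp only: matrix_mul_rid matrix_mult_add_right matrix_add_ldistrib matrix_mul_assoc add_ac)
  finally show ?thesis
    unfolding 3 GH(2)
    by (simp add: matrix_mul_rid matrix_mult_add_right matrix_add_ldistrib matrix_mult_diff matrix_mul_assoc)
qed

lemma qf_factor: "qf (mx Bt x ** M ** mx Bb x) a b = qf M (mx Bb x *v a) (mx Bb x *v b)"
  by (subst qf_mult_right, rule qf_mult_left) (simp add: Bt_def Bb_def)

lemma Phi_invariant: "A.Phi \<delta> x v a = B.Phi \<delta> (psi x) Bv (mx Bb x *v a)"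
proof -
  have "A.curv x v a = B.curv (psi x) Bv (mx Bb x *v a)"
    unfolding A.curv_def B.curv_def curv_matrix_factor qf_factor ..
  moreover have "qf (mx G x) a a = qf (mx G' (psi x)) (mx Bb x *v a) (mx Bb x *v a)"
    unfolding metric_factor qf_factor ..
  moreover have "mx Bb x *v (\<chi> i. cnj (v $ i)) = (\<chi> i. cnj (Bv $ i))"
    by (simp add: vec_eq_iff matrix_vector_mult_def Bb_def Bv_def)
  then have "A.gf x v = B.gf (psi x) Bv"
    unfolding A.gf_qf B.gf_qf metric_factor qf_factor by simp
  ultimately show ?thesis
    unfolding A.Phi_def B.Phi_def by simp
qed

end

end

text \<open>A coordinate change lives on the overlap of two charts, while the form of a chart is
  defined with its whole domain. Derivatives are local, so the two agree.\<close>

lemma herm_family_restrict: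
  fixes U W :: "(complex^'n::finite) set"
  assumes "herm_family U \<tau> G" "W \<subseteq> U" "open W"
  shows "herm_family W \<tau> G"
    and "x \<in> W \<times> time_int \<tau> \<Longrightarrow> herm_family.Phi W \<tau> G \<delta> x v a = herm_family.Phi U \<tau> G \<delta> x v a"
proof -
  interpret U: herm_family U \<tau> G by (rule assms)
  have sW: "smooth_dom (W \<times> time_int \<tau>)" by (rule smooth_dom_cylinder[OF assms(3)])
  note sub = pullback_linear_on[OF U.b.smooth_dom_axioms sW bounded_linear_ident]
  have maps: "x \<in> U \<times> time_int \<tau>" if "x \<in> W \<times> time_int \<tau>" for x
    using that assms(2) by auto
  show W: "herm_family W \<tau> G"
    using assms(3) sub(1)[OF maps U.G_smooth] U.G_herm[OF maps] U.G_pos[OF maps]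
    by (simp add: herm_family_def)
  interpret W: herm_family W \<tau> G by (rule W)
  have cd1: "cd (W \<times> time_int \<tau>) p q f x = cd (U \<times> time_int \<tau>) p q f x"
    if "smooth_on (U \<times> time_int \<tau>) f" "x \<in> W \<times> time_int \<tau>" for f x p q
    using sub(2)[OF maps that] by (simp add: cd_def)
  show "herm_family.Phi W \<tau> G \<delta> x v a = herm_family.Phi U \<tau> G \<delta> x v a" if x: "x \<in> W \<times> time_int \<tau>"
  proof -
    have dm: "W.dm q G x = U.dm q G x" for q
      by (simp add: W.dm_def U.dm_def vec_eq_iff cd1[OF U.G_smooth x])
    have "cd (W \<times> time_int \<tau>) p q (cd (W \<times> time_int \<tau>) p' q' (G i j)) x
      = cd (U \<times> time_int \<tau>) p q (cd (U \<times> time_int \<tau>) p' q' (G i j)) x" for p q p' q' i j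
    proof -
      have "cd (W \<times> time_int \<tau>) p q (cd (W \<times> time_int \<tau>) p' q' (G i j))
        = cd (W \<times> time_int \<tau>) p q (cd (U \<times> time_int \<tau>) p' q' (G i j))"
        by (rule W.b.cd_cong) (rule cd1[OF U.G_smooth])
      then show ?thesis using cd1[OF U.b.cd_smooth[OF U.G_smooth] x] by simp
    qed
    then have ddm: "W.ddm q q' G x = U.ddm q q' G x" for q q'
      by (simp add: W.ddm_def U.ddm_def vec_eq_iff)
    show ?thesis
      unfolding W.Phi_def U.Phi_def W.curv_def U.curv_def dm ddm ..
  qed
qed

section \<open>Hermitian curvature flow on a compact manifold\<close>

text \<open>The complex bilinear extension of b at (v - i J v) / 2 and (w + i J w) / 2. Arbitrary
  vectors are allowed because a coordinate change does not map basis vectors to basis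
  vectors.\<close>

definition herm_ext :: "(complex^'n \<Rightarrow> complex^'n \<Rightarrow> real) \<Rightarrow> complex^'n \<Rightarrow> complex^'n \<Rightarrow> complex" where
  "herm_ext b v w = (complex_of_real (b v w) + complex_of_real (b (Jst v) (Jst w))
     + \<i> * (complex_of_real (b v (Jst w)) - complex_of_real (b (Jst v) w))) / 4"

lemma herm_comp_ext: "herm_comp b i j = herm_ext b (axis i 1) (axis j 1)"
  by (simp add: herm_comp_def herm_ext_def Let_def)

lemma Jst_Jst: "Jst (Jst v) = - v"
  by (simp add: Jst_def vec_eq_iff)

lemma Jst_linear: "Jst (v + w) = Jst v + Jst w" "Jst (r *\<^sub>R v) = r *\<^sub>R Jst v"
  by (simp_all add: Jst_def vec_eq_iff algebra_simps)

lemma herm_ext_scale: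
  assumes b: "bilinear b"
  shows "herm_ext b (c *s v) w = c * herm_ext b v w" "herm_ext b v (c *s w) = cnj c * herm_ext b v w"
    and "herm_ext b (v + v') w = herm_ext b v w + herm_ext b v' w"
    and "herm_ext b v (w + w') = herm_ext b v w + herm_ext b v w'"
proof -
  note bs = bilinear_ladd[OF b] bilinear_radd[OF b] bilinear_lmul[OF b] bilinear_rmul[OF b]
    bilinear_lneg[OF b] bilinear_rneg[OF b]
  have l: "linear (\<lambda>v. herm_ext b v w)" for w
    by (rule linearI) (simp_all add: herm_ext_def bs Jst_linear complex_eq_iff field_simps)
  have r: "linear (\<lambda>w. cnj (herm_ext b v w))" for v
    by (rule linearI) (simp_all add: herm_ext_def bs Jst_linear complex_eq_iff field_simps)
  have li: "herm_ext b (\<i> *s v) w = \<i> * herm_ext b v w" for v w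
    unfolding Jst_def[symmetric] by (simp add: herm_ext_def bs Jst_Jst complex_eq_iff)
  have ri: "cnj (herm_ext b v (\<i> *s w)) = \<i> * cnj (herm_ext b v w)" for v w
    unfolding Jst_def[symmetric] by (simp add: herm_ext_def bs Jst_Jst complex_eq_iff)
  show "herm_ext b (c *s v) w = c * herm_ext b v w"
    by (rule complex_linear_scale[OF l li])
  have "cnj (herm_ext b v (c *s w)) = c * cnj (herm_ext b v w)"
    by (rule complex_linear_scale[OF r ri])
  then show "herm_ext b v (c *s w) = cnj c * herm_ext b v w"
    by (metis complex_cnj_cnj complex_cnj_mult)
  show "herm_ext b (v + v') w = herm_ext b v w + herm_ext b v' w"
    using linear_add[OF l] .
  show "herm_ext b v (w + w') = herm_ext b v w + herm_ext b v w'"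
    using linear_add[OF r, of v w w'] by (metis complex_cnj_add complex_cnj_cnj)
qed

lemma herm_ext_sum:
  assumes b: "bilinear b"
  shows "herm_ext b v w = (\<Sum>\<Sum>i j. v $ i * herm_comp b i j * cnj (w $ j))"
proof -
  have zero: "herm_ext b 0 w = 0" "herm_ext b v 0 = 0" for v w
    using herm_ext_scale(1)[OF b, of 0 0 w] herm_ext_scale(2)[OF b, of v 0 0] by simp_all
  have suml: "herm_ext b (\<Sum>i\<in>I. f i) w = (\<Sum>i\<in>I. herm_ext b (f i) w)" for f w and I :: "'a set"
    by (induction I rule: infinite_finite_induct) (simp_all add: zero herm_ext_scale(3)[OF b])
  have sumr: "herm_ext b v (\<Sum>i\<in>I. f i) = (\<Sum>i\<in>I. herm_ext b v (f i))" for f v and I :: "'a set"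
    by (induction I rule: infinite_finite_induct) (simp_all add: zero herm_ext_scale(4)[OF b])
  have e: "u = (\<Sum>\<Sum>i. u $ i *s axis i 1)" for u :: "complex^'a"
    by (simp add: vec_eq_iff axis_def if_distrib cong: if_cong)
  have "herm_ext b v w = (\<Sum>\<Sum>i j. herm_ext b (v $ i *s axis i 1) (w $ j *s axis j 1))"
    by (simp only: suml[symmetric] sumr[symmetric] e[symmetric])
  then show ?thesis
    by (simp add: herm_ext_scale[OF b] herm_comp_ext mult_ac)
qed

lemma herm_ext_diag: "(\<And>v w. b v w = b w v) \<Longrightarrow> (\<And>v w. b (Jst v) (Jst w) = b v w) \<Longrightarrow> herm_ext b v v = of_real (b v v / 2)"
  by (simp add: herm_ext_def complex_eq_iff)

lemma herm_comp_cnj: "(\<And>v w. b v w = b w v) \<Longrightarrow> cnj (herm_comp b i j) = herm_comp b j i"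
  unfolding herm_comp_ext herm_ext_def
  by (simp add: complex_eq_iff)

section \<open>Curvature and torsion of a time slice in terms of space-time derivatives\<close>

context herm_family
begin

lemma slice_derivative:
  assumes F: "smooth_on D0 F" and x: "(z, t) \<in> D0"
  shows "((\<lambda>z. F (z, t)) has_derivative (\<lambda>v. dd D0 (v, 0) F (z, t))) (at z)"
proof -
  have "((\<lambda>z. F (z, t)) has_derivative (\<lambda>v. dd D0 (v, 0) F (z, t))) (at z within U)"
  proof (rule has_derivative_in_compose[where f = "\<lambda>z. (z, t)"])
    show "((\<lambda>z. (z, t)) has_derivative (\<lambda>v. (v, 0))) (at z within U)"
      by (auto intro!: derivative_eq_intros)
    show "(F has_derivative (\<lambda>v. dd D0 v F (z, t))) (at (z, t) within (\<lambda>z. (z, t)) ` U)"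
      by (rule has_derivative_subset[OF b.has_derivative_dd[OF F x]]) (use x in auto)
  qed
  then show ?thesis using x at_within_open[OF _ U] by simp
qed

lemma wirt_pd:
  assumes F: "smooth_on D0 F" and x: "(z, t) \<in> D0"
  shows "wirt i (\<lambda>z. F (z, t)) z = pd D0 (Dz i) F (z, t)"
    and "wirt_bar i (\<lambda>z. F (z, t)) z = pd D0 (Dzb i) F (z, t)"
proof -
  have f: "frechet_derivative (\<lambda>z. F (z, t)) (at z) = (\<lambda>v. dd D0 (v, 0) F (z, t))"
    using frechet_derivative_at[OF slice_derivative[OF F x]] by simp
  have J: "Jst (axis i 1) = axis i \<i>" by (simp add: Jst_def vec_eq_iff axis_def)
  show "wirt i (\<lambda>z. F (z, t)) z = pd D0 (Dz i) F (z, t)"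
    unfolding wirt_def f J pd_def cd_def pvec.simps ivec.simps
      b.dd_axis[OF F, of _ "1/2"] b.dd_axis[OF F, of _ "- \<i>/2"]
    by (simp add: complex_eq_iff field_simps)
  show "wirt_bar i (\<lambda>z. F (z, t)) z = pd D0 (Dzb i) F (z, t)"
    unfolding wirt_bar_def f J pd_def cd_def pvec.simps ivec.simps
      b.dd_axis[OF F, of _ "1/2"] b.dd_axis[OF F, of _ "\<i>/2"]
    by (simp add: complex_eq_iff field_simps)
qed

lemma wirt_wirt_bar_pd:
  assumes F: "smooth_on D0 F" and x: "(z, t) \<in> D0"
  shows "wirt i (wirt_bar j (\<lambda>z. F (z, t))) z = pd D0 (Dz i) (pd D0 (Dzb j) F) (z, t)"
proof -
  have eq: "wirt_bar j (\<lambda>z. F (z, t)) z' = pd D0 (Dzb j) F (z', t)" if "z' \<in> U" for z'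
    using wirt_pd(2)[OF F] x that by simp
  have "((\<lambda>z. pd D0 (Dzb j) F (z, t)) has_derivative (\<lambda>v. dd D0 (v, 0) (pd D0 (Dzb j) F) (z, t))) (at z)"
    by (rule slice_derivative[OF b.pd_smooth[OF F] x])
  then have "(wirt_bar j (\<lambda>z. F (z, t)) has_derivative (\<lambda>v. dd D0 (v, 0) (pd D0 (Dzb j) F) (z, t))) (at z)"
    \<comment> \<open>The inner identity is known on U only; openness of U lets it pass under the
      outer derivative.\<close>
    by (rule has_derivative_transform_within_open[OF _ U]) (use x eq in auto)
  then have "frechet_derivative (wirt_bar j (\<lambda>z. F (z, t))) (at z)
     = frechet_derivative (\<lambda>z. pd D0 (Dzb j) F (z, t)) (at z)"
    using frechet_derivative_at slice_derivative[OF b.pd_smooth[OF F] x] by metis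
  then show ?thesis
    using wirt_pd(1)[OF b.pd_smooth[OF F] x] by (simp add: wirt_def)
qed

text \<open>At t = 0 both derivatives are one-sided; they agree because every time is a limit point
  of the interval.\<close>

lemma time_derivative:
  assumes F: "smooth_on D0 F" and x: "(z, t) \<in> D0"
    and D: "((\<lambda>s. F (z, s)) has_vector_derivative D) (at t within time_int \<tau>)"
  shows "pd D0 Dt F (z, t) = D"
proof -
  have "((\<lambda>s. F (z, s)) has_derivative (\<lambda>s. dd D0 (0, s) F (z, t))) (at t within time_int \<tau>)"
  proof (rule has_derivative_in_compose[where f = "\<lambda>s. (z, s)"])
    show "((\<lambda>s. (z, s)) has_derivative (\<lambda>s. (0, s))) (at t within time_int \<tau>)"
      by (auto intro!: derivative_eq_intros)
    show "(F has_derivative (\<lambda>v. dd D0 v F (z, t))) (at (z, t) within (\<lambda>s. (z, s)) ` time_int \<tau>)"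
      by (rule has_derivative_subset[OF b.has_derivative_dd[OF F x]]) (use x in auto)
  qed
  moreover have "(\<lambda>s. dd D0 (0, s) F (z, t)) = (\<lambda>s. s *\<^sub>R dd D0 (0, 1) F (z, t))"
  proof
    fix s
    show "dd D0 (0, s) F (z, t) = s *\<^sub>R dd D0 (0, 1) F (z, t)"
      using b.dd_dir_scale[OF F, of s "(0, 1)" "(z, t)"] by simp
  qed
  ultimately have "((\<lambda>s. F (z, s)) has_vector_derivative dd D0 (0, 1) F (z, t)) (at t within time_int \<tau>)"
    unfolding has_vector_derivative_def by (rule back_subst)
  moreover have "at t within time_int \<tau> \<noteq> bot"
  proof -
    have "t islimpt time_int \<tau>"
      unfolding islimpt_approachable
    proof (intro allI impI)
      fix e :: real assume "0 < e"
      then obtain d where "0 < d" "d < e" "t + d \<in> time_int \<tau>"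
        using time_int_right[of t \<tau> e] x by auto
      then show "\<exists>x'\<in>time_int \<tau>. x' \<noteq> t \<and> dist x' t < e"
        by (intro bexI[of _ "t + d"]) (auto simp: dist_real_def)
    qed
    then show ?thesis by (simp add: trivial_limit_within)
  qed
  ultimately have "dd D0 (0, 1) F (z, t) = D"
    using vector_derivative_unique_within D by blast
  moreover have "dd D0 (0, 0) F (z, t) = 0"
    using b.dd_dir_zero[OF F, of "(z, t)"] by (simp add: zero_prod_def)
  ultimately show ?thesis
    by (simp add: pd_def cd_def)
qed

context
  fixes h :: "complex^'n \<Rightarrow> complex^'n^'n" and z :: "complex^'n" and t :: real
  assumes x: "(z, t) \<in> D0" and h: "\<And>z. h z = mx G (z, t)"
begin

lemma h_nth: "(\<lambda>x. h x $ k $ l) = (\<lambda>x. G k l (x, t))"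
  by (simp add: h)

lemma met_inv_H: "met_inv (h z) p s = H s p (z, t)"
  by (simp add: met_inv_def h H_def)

lemma chern_curv_pd: "chern_curv h z i j k l =
    (\<Sum>\<Sum>p s. pd D0 (Dz i) (G k s) (z, t) * H s p (z, t) * pd D0 (Dzb j) (G p l) (z, t))
    - pd D0 (Dz i) (pd D0 (Dzb j) (G k l)) (z, t)"
  unfolding chern_curv_def h_nth met_inv_H wirt_pd[OF G_smooth x] wirt_wirt_bar_pd[OF G_smooth x]
  by (simp add: mult_ac)

lemma chern_curv_mx: "chern_curv h z i j k l =
    (pm (Dz i) G (z, t) ** mx H (z, t) ** pm (Dzb j) G (z, t) - ppm (Dz i) (Dzb j) G (z, t)) $ k $ l"
  unfolding chern_curv_pd vector_minus_component ppm_nth matrix_matrix_mult_def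
  by (simp add: pm_nth sum_distrib_right del: pvec.simps ivec.simps)

lemma griffiths_form_curv:
  "(\<Sum>\<Sum>i j k l. chern_curv h z i j k l * (\<xi> $ i) * cnj (\<xi> $ j) * (\<eta> $ k) * cnj (\<eta> $ l))
   = curv (z, t) \<xi> (\<chi> k. cnj (\<eta> $ k))"
proof -
  let ?x = "(z, t)"
  let ?M = "dm (dzv \<xi>) G ?x ** mx H ?x ** dm (dzbv \<xi>) G ?x - ddm (dzv \<xi>) (dzbv \<xi>) G ?x"
  have M: "?M $ k $ l = (\<Sum>\<Sum>i j. \<xi> $ i * cnj (\<xi> $ j) * chern_curv h z i j k l)" for k l
  proof -
    have "(dm (dzv \<xi>) G ?x ** mx H ?x ** dm (dzbv \<xi>) G ?x) $ k $ l
      = (\<Sum>\<Sum>p s. (\<Sum>\<Sum>i. \<xi> $ i * pd D0 (Dz i) (G k s) ?x) * H s p ?x * (\<Sum>\<Sum>j. cnj (\<xi> $ j) * pd D0 (Dzb j) (G p l) ?x))"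
      unfolding matrix_matrix_mult_def by (simp add: dzv_nth dzbv_nth sum_distrib_right)
    also have "\<dots> = (\<Sum>\<Sum>p s i j. \<xi> $ i * cnj (\<xi> $ j) *
        (pd D0 (Dz i) (G k s) ?x * H s p ?x * pd D0 (Dzb j) (G p l) ?x))"
    proof (rule sum.cong[OF refl], rule sum.cong[OF refl])
      fix p s
      have "(\<Sum>\<Sum>i. \<xi> $ i * pd D0 (Dz i) (G k s) ?x) * H s p ?x * (\<Sum>\<Sum>j. cnj (\<xi> $ j) * pd D0 (Dzb j) (G p l) ?x)
        = H s p ?x * ((\<Sum>\<Sum>i. \<xi> $ i * pd D0 (Dz i) (G k s) ?x) * (\<Sum>\<Sum>j. cnj (\<xi> $ j) * pd D0 (Dzb j) (G p l) ?x))"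
        by (simp only: mult_ac)
      also have "\<dots> = (\<Sum>\<Sum>i j. \<xi> $ i * cnj (\<xi> $ j) *
        (pd D0 (Dz i) (G k s) ?x * H s p ?x * pd D0 (Dzb j) (G p l) ?x))"
        unfolding sum_product by (simp add: sum_distrib_left mult_ac)
      finally show "(\<Sum>\<Sum>i. \<xi> $ i * pd D0 (Dz i) (G k s) ?x) * H s p ?x * (\<Sum>\<Sum>j. cnj (\<xi> $ j) * pd D0 (Dzb j) (G p l) ?x) = \<dots>" .
    qed
    also have "\<dots> = (\<Sum>\<Sum>i j p s. \<xi> $ i * cnj (\<xi> $ j) *
        (pd D0 (Dz i) (G k s) ?x * H s p ?x * pd D0 (Dzb j) (G p l) ?x))"
      by (rule sum_swap_2_2)
    finally show ?thesis
      unfolding vector_minus_component ddzv_nth[OF G_smooth] chern_curv_pd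
      by (simp add: right_diff_distrib sum_subtractf sum_distrib_left)
  qed
  have "curv ?x \<xi> (\<chi> k. cnj (\<eta> $ k)) = (\<Sum>\<Sum>k l i j. chern_curv h z i j k l * (\<xi> $ i) * cnj (\<xi> $ j) * (\<eta> $ k) * cnj (\<eta> $ l))"
    unfolding curv_def qf_def M by (simp add: sum_distrib_left sum_distrib_right mult_ac)
  also have "\<dots> = (\<Sum>\<Sum>i j k l. chern_curv h z i j k l * (\<xi> $ i) * cnj (\<xi> $ j) * (\<eta> $ k) * cnj (\<eta> $ l))"
    by (rule sum_swap_2_2)
  finally show ?thesis by simp
qed

text \<open>Lowering the index undoes the inverse metric in \<open>torsion\<close>, leaving the
  antisymmetrised derivative of the metric.\<close>

lemma torsion_low_pd: "torsion_low h z i j l = pd D0 (Dz i) (G j l) (z, t) - pd D0 (Dz j) (G i l) (z, t)"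
proof -
  let ?x = "(z, t)"
  let ?d = "\<lambda>q. pd D0 (Dz i) (G j q) ?x - pd D0 (Dz j) (G i q) ?x"
  have "torsion_low h z i j l = (\<Sum>\<Sum>k q. ?d q * (H q k ?x * G k l ?x))"
    unfolding torsion_low_def torsion_def h_nth met_inv_H wirt_pd[OF G_smooth x] sum_distrib_right
    by (simp add: h mult_ac)
  also have "\<dots> = (\<Sum>\<Sum>q. ?d q * (\<Sum>\<Sum>k. H q k ?x * G k l ?x))"
    by (subst sum.swap) (simp add: sum_distrib_left)
  also have "\<dots> = ?d l"
    unfolding H_G_sum[OF x] by (simp add: if_distrib cong: if_cong)
  finally show ?thesis .
qed

lemma pd_G_cnj: "cnj (pd D0 (Dz i) (G j k) (z, t)) = pd D0 (Dzb i) (G k j) (z, t)"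
proof -
  have "pd D0 (Dzb i) (G k j) = pd D0 (Dzb i) (\<lambda>x. cnj (G j k x))"
    by (rule b.pd_cong) (simp add: G_herm)
  then show ?thesis by simp
qed

lemma S2_mx: "S2 h z i j = (\<Sum>\<Sum>m n. mx H (z, t) $ n $ m *
      (pm (Dz m) G (z, t) ** mx H (z, t) ** pm (Dzb n) G (z, t) - ppm (Dz m) (Dzb n) G (z, t)) $ i $ j)"
  unfolding S2_def chern_curv_mx met_inv_H mx_nth ..

lemma Qtor_mx: "Qtor h z i j = 1/2 * (\<Sum>\<Sum>m n p s. mx H (z, t) $ n $ m * mx H (z, t) $ s $ p *
        (pm (Dz m) G (z, t) $ p $ j - pm (Dz p) G (z, t) $ m $ j) * (pm (Dzb n) G (z, t) $ i $ s - pm (Dzb s) G (z, t) $ i $ n))"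
  unfolding Qtor_def torsion_low_bar_def torsion_low_pd met_inv_H mx_nth pm_nth complex_cnj_diff pd_G_cnj ..

end

end

section \<open>The flow in charts and the passage to the manifold\<close>

locale hcf =
  fixes A :: "('a::{t2_space, second_countable_topology}, 'n::finite) chart set"
    and g :: "real \<Rightarrow> ('a, 'n) form_field" and \<tau> :: ereal
  assumes atlas: "complex_atlas A" and sol: "HCF_solution A \<tau> g"
begin

definition Uc :: "('a, 'n) chart \<Rightarrow> (complex^'n) set" where
  "Uc c = coord c ` dom_of c"

definition Gc :: "('a, 'n) chart \<Rightarrow> 'n \<Rightarrow> 'n \<Rightarrow> (complex^'n) \<times> real \<Rightarrow> complex" where
  "Gc c i j x = herm_comp (g (snd x) c (chart_inv c (fst x))) i j"

lemma chart_facts: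
  assumes "c \<in> A"
  shows "open (dom_of c)" "open (Uc c)" "homeomorphism (dom_of c) (Uc c) (coord c) (chart_inv c)"
    and "p \<in> dom_of c \<Longrightarrow> chart_inv c (coord c p) = p"
    and "z \<in> Uc c \<Longrightarrow> chart_inv c z \<in> dom_of c"
    and "z \<in> Uc c \<Longrightarrow> coord c (chart_inv c z) = z"
    and "p \<in> dom_of c \<Longrightarrow> coord c p \<in> Uc c"
  using assms atlas unfolding complex_atlas_def is_chart_def Uc_def homeomorphism_def by auto

lemma metric:
  assumes "t \<in> time_int \<tau>"
  shows "hermitian_metric A (g t)"
  using sol assms unfolding HCF_solution_def smooth_metric_family_def by blast

lemma metric_facts:
  assumes "t \<in> time_int \<tau>" "c \<in> A" "p \<in> dom_of c"
  shows "bilinear (g t c p)" "g t c p v w = g t c p w v" "v \<noteq> 0 \<Longrightarrow> 0 < g t c p v v"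
    "g t c p (Jst v) (Jst w) = g t c p v w"
  using metric[OF assms(1)] assms(2,3) unfolding hermitian_metric_def by blast+

lemma metric_compat:
  assumes "t \<in> time_int \<tau>" "c \<in> A" "c' \<in> A" "p \<in> dom_of c \<inter> dom_of c'"
  shows "g t c p v w = g t c' p (frechet_derivative (transition c c') (at (coord c p)) v)
      (frechet_derivative (transition c c') (at (coord c p)) w)"
  using metric[OF assms(1)] assms(2-) unfolding hermitian_metric_def Let_def by blast

lemma Gc_family:
  assumes c: "c \<in> A"
  shows "herm_family (Uc c) \<tau> (Gc c)"
proof
  show "open (Uc c)" by (rule chart_facts(2)[OF c])
  interpret S: chart_dom "Uc c \<times> time_int \<tau>"
    unfolding chart_dom_def by (rule smooth_dom_cylinder[OF chart_facts(2)[OF c]])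
  fix i j :: 'n and x :: "(complex^'n) \<times> real" and v :: "complex^'n"
  have s: "smooth_on (Uc c \<times> time_int \<tau>) (\<lambda>x. g (snd x) c (chart_inv c (fst x)) v w)" for v w
    using sol c unfolding HCF_solution_def smooth_metric_family_def Uc_def case_prod_beta by blast
  show "smooth_on (Uc c \<times> time_int \<tau>) (Gc c i j)"
    unfolding Gc_def[abs_def] herm_comp_def Let_def
    by (intro S.smooth_divide_const S.smooth_add S.smooth_mult S.smooth_diff S.smooth_on_const S.smooth_of_real s)
  assume x: "x \<in> Uc c \<times> time_int \<tau>"
  then have t: "snd x \<in> time_int \<tau>" and p: "chart_inv c (fst x) \<in> dom_of c"
    using chart_facts(5)[OF c] by auto
  note m = metric_facts[OF t c p]
  show "cnj (Gc c i j x) = Gc c j i x"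
    unfolding Gc_def by (rule herm_comp_cnj) (rule m(2))
  assume v: "v \<noteq> 0"
  let ?b = "g (snd x) c (chart_inv c (fst x))"
  \<comment> \<open>\<open>qf\<close> is conjugate linear in its first vector and
    \<open>herm_ext\<close> in its second, hence the conjugation.\<close>
  define v' where "v' = (\<chi> i. cnj (v $ i))"
  have "v' \<noteq> 0" using v by (auto simp: v'_def vec_eq_iff)
  have "qf (mx (Gc c) x) v v = herm_ext ?b v' v'"
    unfolding herm_ext_sum[OF m(1)] by (simp add: qf_def Gc_def v'_def)
  also have "\<dots> = of_real (?b v' v' / 2)"
    by (rule herm_ext_diag) (rule m(2), rule m(4))
  finally have eq: "qf (mx (Gc c) x) v v = of_real (?b v' v' / 2)" .
  show "0 < Re (qf (mx (Gc c) x) v v)"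
    unfolding eq using m(3)[OF \<open>v' \<noteq> 0\<close>] by simp
qed

lemma metric_matrix_mx: "metric_matrix (g t) c z = mx (Gc c) (z, t)"
  by (simp add: metric_matrix_def vec_eq_iff Gc_def)

lemma Gc_flow:
  assumes c: "c \<in> A"
  shows "herm_flow (Uc c) \<tau> (Gc c)"
proof -
  interpret F: herm_family "Uc c" \<tau> "Gc c" by (rule Gc_family[OF c])
  show ?thesis
  proof
    fix x :: "(complex^'n) \<times> real" and i j :: 'n
    assume x: "x \<in> Uc c \<times> time_int \<tau>"
    obtain z t where zt: "x = (z, t)" by (cases x)
    have z: "z \<in> Uc c" and t: "t \<in> time_int \<tau>" and x': "(z, t) \<in> Uc c \<times> time_int \<tau>"
      using x zt by auto
    have "((\<lambda>s. herm_comp (g s c (chart_inv c z)) i j) has_vector_derivative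
       (- S2 (metric_matrix (g t) c) z i j - Qtor (metric_matrix (g t) c) z i j)) (at t within time_int \<tau>)"
      using sol t c chart_facts(5,6)[OF c z] unfolding HCF_solution_def by metis
    then have "pd F.D0 Dt (Gc c i j) (z, t) = - S2 (metric_matrix (g t) c) z i j - Qtor (metric_matrix (g t) c) z i j"
      by (intro F.time_derivative[OF F.G_smooth x']) (simp add: Gc_def)
    then show "pd F.D0 Dt (Gc c i j) x = - (\<Sum>\<Sum>m n. mx F.H x $ n $ m *
        (F.dm (pvec (Dz m), ivec (Dz m)) (Gc c) x ** mx F.H x ** F.dm (pvec (Dzb n), ivec (Dzb n)) (Gc c) x
          - F.ddm (pvec (Dz m), ivec (Dz m)) (pvec (Dzb n), ivec (Dzb n)) (Gc c) x) $ i $ j)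
    - 1/2 * (\<Sum>\<Sum>m n p s. mx F.H x $ n $ m * mx F.H x $ s $ p *
        (F.dm (pvec (Dz m), ivec (Dz m)) (Gc c) x $ p $ j - F.dm (pvec (Dz p), ivec (Dz p)) (Gc c) x $ m $ j)
        * (F.dm (pvec (Dzb n), ivec (Dzb n)) (Gc c) x $ i $ s - F.dm (pvec (Dzb s), ivec (Dzb s)) (Gc c) x $ i $ n))"
      unfolding zt F.S2_mx[OF x' metric_matrix_mx] F.Qtor_mx[OF x' metric_matrix_mx] .
  qed
qed

definition PHI :: "('a, 'n) chart \<Rightarrow> real \<Rightarrow> (complex^'n) \<times> real \<Rightarrow> complex^'n \<Rightarrow> complex^'n \<Rightarrow> real" where
  "PHI c = herm_family.Phi (Uc c) \<tau> (Gc c)"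

lemma transition_chart_change:
  assumes c: "c \<in> A" and c': "c' \<in> A"
  defines "W \<equiv> coord c ` (dom_of c \<inter> dom_of c')"
  shows "W \<subseteq> Uc c" "open W" "chart_change W (Uc c') \<tau> (Gc c) (Gc c') (transition c c')"
proof -
  show WU: "W \<subseteq> Uc c" by (auto simp: W_def Uc_def)
  have "openin (top_of_set (dom_of c)) (dom_of c \<inter> dom_of c')"
    using chart_facts(1)[OF c'] by (simp add: openin_open_Int)
  then have "openin (top_of_set (Uc c)) W"
    unfolding W_def using homeomorphism_imp_open_map[OF chart_facts(3)[OF c]] by blast
  then show W: "open W" using chart_facts(2)[OF c] openin_open_trans by blast
  let ?\<phi> = "transition c c'"
  have "herm_family W \<tau> (Gc c)"
    by (rule herm_family_restrict(1)[OF Gc_family[OF c] WU W])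
  moreover have "herm_family (Uc c') \<tau> (Gc c')" by (rule Gc_family[OF c'])
  moreover have "chart_change_axioms W (Uc c') \<tau> (Gc c) (Gc c') ?\<phi>"
  proof
    have D: "\<exists>D. (?\<phi> has_derivative D) (at z) \<and> (\<forall>v. D (Jst v) = Jst (D v))" if "z \<in> W" for z
      using atlas c c' that unfolding complex_atlas_def holomorphic_map_on_def W_def by blast
    have comp: "((\<lambda>z. ?\<phi> z $ a) has_derivative (\<lambda>v. D v $ a)) (at z)" if "(?\<phi> has_derivative D) (at z)" for D z a
      by (rule bounded_linear.has_derivative[OF bounded_linear_vec_nth that])
    show "hol_fun (\<lambda>z. ?\<phi> z $ a) W" for a
      unfolding hol_fun_def
    proof
      fix z assume "z \<in> W"
      then obtain D where D: "(?\<phi> has_derivative D) (at z)" "\<forall>v. D (Jst v) = Jst (D v)" using D by blast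
      have "D (\<i> *s v) $ a = \<i> * D v $ a" for v
        using D(2) unfolding Jst_def by simp
      then show "\<exists>D. ((\<lambda>z. ?\<phi> z $ a) has_derivative D) (at z) \<and> (\<forall>v. D (\<i> *s v) = \<i> * D v)"
        using comp[OF D(1)] by blast
    qed
    have pt: "\<exists>p. p \<in> dom_of c \<inter> dom_of c' \<and> z = coord c p \<and> chart_inv c z = p \<and> ?\<phi> z = coord c' p" if "z \<in> W" for z
      using that chart_facts(4)[OF c] unfolding W_def transition_def by auto
    show "?\<phi> z \<in> Uc c'" if "z \<in> W" for z
      using pt[OF that] by (auto simp: Uc_def)
    fix z t i j
    assume z: "z \<in> W" and t: "t \<in> time_int \<tau>"
    obtain p where p: "p \<in> dom_of c \<inter> dom_of c'" "z = coord c p" "chart_inv c z = p" "?\<phi> z = coord c' p"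
      using pt[OF z] by blast
    have inv': "chart_inv c' (?\<phi> z) = p" using p chart_facts(4)[OF c'] by auto
    obtain D where D: "(?\<phi> has_derivative D) (at z)" "\<forall>v. D (Jst v) = Jst (D v)" using D[OF z] by blast
    have fD: "frechet_derivative ?\<phi> (at z) = D" using frechet_derivative_at[OF D(1)] by simp
    have fDa: "frechet_derivative (\<lambda>z. ?\<phi> z $ a) (at z) = (\<lambda>v. D v $ a)" for a
      using frechet_derivative_at[OF comp[OF D(1)]] by simp
    let ?b = "g t c' p"
    \<comment> \<open>D commutes with J, so the extension pulls back along D just as the real form
      does.\<close>
    have "Gc c i j (z, t) = herm_ext ?b (D (axis i 1)) (D (axis j 1))"
      unfolding Gc_def fst_conv snd_conv p(3) herm_comp_ext herm_ext_def
        metric_compat[OF t c c' p(1), folded p(2), unfolded fD] using D(2) by simp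
    also have "\<dots> = (\<Sum>\<Sum>a b. D (axis i 1) $ a * herm_comp ?b a b * cnj (D (axis j 1) $ b))"
      by (rule herm_ext_sum) (rule metric_facts(1)[OF t c'], use p in auto)
    finally show "Gc c i j (z, t) = (\<Sum>\<Sum>a b. frechet_derivative (\<lambda>z. ?\<phi> z $ a) (at z) (axis i 1) * Gc c' a b (?\<phi> z, t) *
        cnj (frechet_derivative (\<lambda>z. ?\<phi> z $ b) (at z) (axis j 1)))"
      unfolding fDa Gc_def fst_conv snd_conv inv' .
  qed
  ultimately show "chart_change W (Uc c') \<tau> (Gc c) (Gc c') ?\<phi>"
    by (simp add: chart_change_def)
qed

text \<open>The vectors are images under the Jacobian, but later only the attained values matter, so
  their existence suffices.\<close>

lemma PHI_transition:
  assumes c: "c \<in> A" and c': "c' \<in> A" and p: "p \<in> dom_of c \<inter> dom_of c'" and t: "t \<in> time_int \<tau>"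
  shows "\<exists>v' a'. PHI c \<delta> (coord c p, t) v a = PHI c' \<delta> (coord c' p, t) v' a'"
proof -
  let ?W = "coord c ` (dom_of c \<inter> dom_of c')"
  interpret X: chart_change ?W "Uc c'" \<tau> "Gc c" "Gc c'" "transition c c'"
    by (rule transition_chart_change(3)[OF c c'])
  have x: "(coord c p, t) \<in> ?W \<times> time_int \<tau>" using p t by auto
  have "PHI c \<delta> (coord c p, t) v a = X.A.Phi \<delta> (coord c p, t) v a"
    unfolding PHI_def
    by (rule herm_family_restrict(2)[OF Gc_family[OF c] transition_chart_change(1,2)[OF c c'] x, symmetric])
  moreover have "X.psi (coord c p, t) = (coord c' p, t)"
    unfolding X.psi_def unfolding transition_def using chart_facts(4)[OF c] p by auto
  ultimately show ?thesis
    using X.Phi_invariant[OF x, of \<delta> v a] unfolding PHI_def by auto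
qed

lemma PHI_scale:
  assumes "c \<in> A"
  shows "PHI c \<delta> x (r *\<^sub>R v) (s *\<^sub>R a) = r\<^sup>2 * s\<^sup>2 * PHI c \<delta> x v a"
  unfolding PHI_def by (rule herm_flow.Phi_scale[OF Gc_flow[OF assms]])

lemma PHI_unit:
  assumes "c \<in> A"
  shows "PHI c \<delta> x v a = 0 \<or> (\<exists>v' a' k. norm v' = 1 \<and> norm a' = 1 \<and> 0 < k \<and> PHI c \<delta> x v a = k * PHI c \<delta> x v' a')"
proof (cases "v = 0 \<or> a = 0")
  case True
  then show ?thesis
    using PHI_scale[OF assms, of \<delta> x 0 v 1 a] PHI_scale[OF assms, of \<delta> x 1 v 0 a] by auto
next
  case False
  have "PHI c \<delta> x v a = (norm v)\<^sup>2 * (norm a)\<^sup>2 * PHI c \<delta> x (v /\<^sub>R norm v) (a /\<^sub>R norm a)"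
    using PHI_scale[OF assms, of \<delta> x "norm v" "v /\<^sub>R norm v" "norm a" "a /\<^sub>R norm a"] False by simp
  moreover have "norm (v /\<^sub>R norm v) = 1" "norm (a /\<^sub>R norm a) = 1" "0 < (norm v)\<^sup>2 * (norm a)\<^sup>2"
    using False by simp_all
  ultimately show ?thesis by blast
qed

text \<open>The curvature sum is real by \<open>curv_real\<close>, so only its real part is at
  stake; conjugation of \<eta> is a bijection, so both sides quantify over the same vectors.\<close>

lemma griffiths_iff:
  assumes t: "t \<in> time_int \<tau>"
  shows "griffiths_nonneg A (g t) \<longleftrightarrow> (\<forall>c\<in>A. \<forall>p\<in>dom_of c. \<forall>v a. 0 \<le> PHI c 0 (coord c p, t) v a)"
proof -
  have form: "(\<Sum>\<Sum>i j k l. chern_curv (metric_matrix (g t) c) (coord c p) i j k l *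
             (\<xi> $ i) * cnj (\<xi> $ j) * (\<eta> $ k) * cnj (\<eta> $ l)) \<in> \<real>\<^sub>\<ge>\<^sub>0
      \<longleftrightarrow> 0 \<le> PHI c 0 (coord c p, t) \<xi> (\<chi> k. cnj (\<eta> $ k))"
    if "c \<in> A" "p \<in> dom_of c" for c p \<xi> \<eta>
  proof -
    interpret F: herm_family "Uc c" \<tau> "Gc c" by (rule Gc_family[OF that(1)])
    have x: "(coord c p, t) \<in> F.D0" using chart_facts(7)[OF that] t by simp
    show ?thesis
      unfolding F.griffiths_form_curv[OF x metric_matrix_mx] PHI_def F.Phi_def complex_nonneg_Reals_iff
      using F.curv_real[OF x, of \<xi> "\<chi> k. cnj (\<eta> $ k)"] by (simp add: complex_eq_iff)
  qed
  have inv: "(\<chi> k. cnj ((\<chi> k. cnj (a $ k)) $ k)) = a" for a :: "complex^'n"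
    by (simp add: vec_eq_iff)
  show ?thesis
  proof
    assume gn: "griffiths_nonneg A (g t)"
    show "\<forall>c\<in>A. \<forall>p\<in>dom_of c. \<forall>v a. 0 \<le> PHI c 0 (coord c p, t) v a"
    proof (intro ballI allI)
      fix c p v a assume c: "c \<in> A" and p: "p \<in> dom_of c"
      show "0 \<le> PHI c 0 (coord c p, t) v a"
        using gn[unfolded griffiths_nonneg_def, rule_format, OF c p, of v "\<chi> k. cnj (a $ k)"]
        unfolding form[OF c p] inv .
    qed
  next
    assume "\<forall>c\<in>A. \<forall>p\<in>dom_of c. \<forall>v a. 0 \<le> PHI c 0 (coord c p, t) v a"
    then show "griffiths_nonneg A (g t)"
      unfolding griffiths_nonneg_def by (intro ballI allI) (simp only: form)
  qed
qed

text \<open>Finitely many compact coordinate balls cover M and C exceeds the threshold of each; only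
  then is \<epsilon> chosen, from an assumed violation at T. The times at which the perturbed form
  is non-positive on some unit vectors form a compact set; its least element would be a first zero,
  which \<open>no_first_zero\<close> forbids.\<close>

lemma griffiths_preserved:
  assumes comp: "compact (UNIV :: 'a set)" and init: "griffiths_nonneg A (g 0)"
    and T: "0 < T" "ereal T < \<tau>"
  shows "griffiths_nonneg A (g T)"
proof -
  have time: "t \<in> time_int \<tau>" if "0 \<le> t" "t \<le> T" for t
    using that T(2) le_less_trans[of "ereal t" "ereal T" \<tau>] by (simp add: time_int_def)
  have "\<exists>c r. c \<in> A \<and> p \<in> dom_of c \<and> 0 < r \<and> cball (coord c p) r \<subseteq> Uc c" for p :: 'a
  proof -
    obtain c where c: "c \<in> A" "p \<in> dom_of c" using atlas unfolding complex_atlas_def by blast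
    then obtain r where "0 < r" "cball (coord c p) r \<subseteq> Uc c"
      using chart_facts(2)[OF c(1)] chart_facts(7)[OF c] open_contains_cball by blast
    with c show ?thesis by blast
  qed
  then obtain cc rr where cc: "\<And>p. cc p \<in> A" "\<And>p. p \<in> dom_of (cc p)" "\<And>p. 0 < rr p"
    "\<And>p. cball (coord (cc p) p) (rr p) \<subseteq> Uc (cc p)" by metis
  \<comment> \<open>Open coordinate balls cover M; the corresponding closed balls provide the
    compact sets Q.\<close>
  define Op where "Op p = dom_of (cc p) \<inter> coord (cc p) -` ball (coord (cc p) p) (rr p)" for p
  have open_Op: "open (Op p)" for p
    unfolding Op_def using chart_facts(1,3)[OF cc(1)]
    by (intro continuous_open_preimage) (auto simp: homeomorphism_def)
  have "p \<in> Op p" for p using cc(2,3) by (simp add: Op_def)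
  then have cov: "(UNIV :: 'a set) \<subseteq> (\<Union>p\<in>UNIV. Op p)" by blast
  obtain P where P: "finite P" "UNIV \<subseteq> (\<Union>p\<in>P. Op p)"
    by (rule compactE_image[OF comp open_Op cov])
  define Q :: "'a \<Rightarrow> (((complex^'n) \<times> real) \<times> (complex^'n) \<times> (complex^'n)) set"
    where "Q p = (cball (coord (cc p) p) (rr p) \<times> {0..T}) \<times> (sphere 0 1 \<times> sphere 0 1)" for p
  have Q_compact: "compact (Q p)" for p
    unfolding Q_def by (intro compact_Times compact_cball compact_sphere compact_Icc)
  have Q_sub: "Q p \<subseteq> (Uc (cc p) \<times> time_int \<tau>) \<times> UNIV \<times> UNIV" for p
    unfolding Q_def using cc(4)[of p] time by auto
  define good where "good p C \<longleftrightarrow> (\<forall>\<epsilon> z t v a r. 0 < \<epsilon> \<longrightarrow> ((z, t), v, a) \<in> Q p \<longrightarrow> 0 < t \<longrightarrow> \<epsilon> * exp (C * t) \<le> 1 \<longrightarrow> 0 < r \<longrightarrow>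
     (\<forall>s z' v' a'. 0 \<le> s \<longrightarrow> s \<le> t \<longrightarrow> z' \<in> Uc (cc p) \<longrightarrow> dist z' z < r \<longrightarrow>
        0 \<le> PHI (cc p) (\<epsilon> * exp (C * s)) (z', s) v' a') \<longrightarrow>
     PHI (cc p) (\<epsilon> * exp (C * t)) (z, t) v a \<noteq> 0)" for p C
  have "\<exists>C0. \<forall>C>C0. good p C" for p
    unfolding good_def PHI_def
    by (rule herm_flow.no_first_zero[OF Gc_flow[OF cc(1)] Q_compact Q_sub]) (auto simp: Q_def)
  then obtain C0 where C0: "\<And>p C. C0 p < C \<Longrightarrow> good p C" by metis
  \<comment> \<open>The inserted 0 makes C positive, so that \<delta> is increasing; adding 1 makes
    it exceed every threshold strictly.\<close>
  define C where "C = Max (insert 0 (C0 ` P)) + 1"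
  have "0 \<le> Max (insert 0 (C0 ` P))" using P(1) by (intro Max_ge) auto
  then have Cpos: "0 < C" by (simp add: C_def)
  have CP: "C0 p < C" if "p \<in> P" for p
  proof -
    have "C0 p \<le> Max (insert 0 (C0 ` P))" using P(1) that by (intro Max_ge) auto
    then show ?thesis by (simp add: C_def)
  qed
  show ?thesis
  proof (rule ccontr)
    assume "\<not> ?thesis"
    then obtain c1 p1 v1 a1 where bad: "c1 \<in> A" "p1 \<in> dom_of c1" "PHI c1 0 (coord c1 p1, T) v1 a1 < 0"
      unfolding griffiths_iff[OF time[of T, OF less_imp_le[OF T(1)] order_refl]] by (meson not_le)
    interpret F1: herm_family "Uc c1" \<tau> "Gc c1" by (rule Gc_family[OF bad(1)])
    define K1 where "K1 = Re (F1.gf (coord c1 p1, T) v1 * qf (mx (Gc c1) (coord c1 p1, T)) a1 a1)"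
    have PHI1: "PHI c1 \<delta> (coord c1 p1, T) v1 a1 = PHI c1 0 (coord c1 p1, T) v1 a1 + \<delta> * K1" for \<delta>
      by (simp add: PHI_def F1.Phi_def K1_def)
    define \<kappa> where "\<kappa> = - PHI c1 0 (coord c1 p1, T) v1 a1"
    have \<kappa>: "0 < \<kappa>" using bad(3) by (simp add: \<kappa>_def)
    \<comment> \<open>The value of the barrier coefficient at the final time: too small to cancel
      the negative value found at T, and at most 1.\<close>
    define m where "m = min 1 (\<kappa> / (2 * (\<bar>K1\<bar> + 1)))"
    have m: "0 < m" "m \<le> 1" using \<kappa> by (auto simp: m_def)
    have mK: "m * K1 < \<kappa>"
    proof -
      have "m * K1 \<le> m * (\<bar>K1\<bar> + 1)" using m by (intro mult_left_mono) auto
      also have "\<dots> \<le> \<kappa> / (2 * (\<bar>K1\<bar> + 1)) * (\<bar>K1\<bar> + 1)" by (intro mult_right_mono) (auto simp: m_def)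
      also have "\<dots> = \<kappa> / 2" by (simp add: field_simps)
      finally show ?thesis using \<kappa> by simp
    qed
    \<comment> \<open>Normalised so that \<delta> T = m, hence \<delta> \<le> 1 on the whole
      interval up to T.\<close>
    define \<epsilon> where "\<epsilon> = m / exp (C * T)"
    have \<epsilon>: "0 < \<epsilon>" using m by (simp add: \<epsilon>_def)
    define \<delta> where "\<delta> s = \<epsilon> * exp (C * s)" for s
    have \<delta>T: "\<delta> T = m" by (simp add: \<delta>_def \<epsilon>_def)
    have \<delta>pos: "0 < \<delta> s" for s using \<epsilon> by (simp add: \<delta>_def)
    have \<delta>1: "\<delta> s \<le> 1" if "s \<le> T" for s
    proof -
      have "\<delta> s \<le> \<delta> T" using that Cpos \<epsilon> by (simp add: \<delta>_def)
      then show ?thesis using \<delta>T m by simp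
    qed
    have bad1: "PHI c1 (\<delta> T) (coord c1 p1, T) v1 a1 < 0"
      using mK PHI1[of m] unfolding \<delta>T by (simp only: \<kappa>_def)
    have \<delta>cont: "continuous_on UNIV \<delta>" unfolding \<delta>_def[abs_def] by (intro continuous_intros)
    have contPHI: "continuous_on ((Uc c \<times> time_int \<tau>) \<times> UNIV \<times> UNIV) (\<lambda>(x, v, a). PHI c (\<delta> (snd x)) x v a)"
      if "c \<in> A" for c
      unfolding PHI_def by (rule herm_flow.continuous_on_Phi[OF Gc_flow[OF that] \<delta>cont])
    \<comment> \<open>Non-positive rather than negative values, so that B is closed and the least
      time is attained.\<close>
    define B where "B p = Q p \<inter> (\<lambda>(x, v, a). PHI (cc p) (\<delta> (snd x)) x v a) -` {..0}" for p
    have "compact (B p)" for p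
    proof -
      have "closed (B p)"
        unfolding B_def
        by (rule continuous_closed_preimage[OF continuous_on_subset[OF contPHI[OF cc(1)] Q_sub]
              compact_imp_closed[OF Q_compact] closed_atMost])
      then have "compact (Q p \<inter> B p)" by (rule compact_Int_closed[OF Q_compact])
      moreover have "Q p \<inter> B p = B p" by (auto simp: B_def)
      ultimately show ?thesis by simp
    qed
    then have TS_compact: "compact (\<Union>p\<in>P. (\<lambda>q. snd (fst q)) ` B p)"
      by (intro compact_UN P(1) compact_continuous_image continuous_intros)
    define TS where "TS = (\<Union>p\<in>P. (\<lambda>q. snd (fst q)) ` B p)"
    \<comment> \<open>Invariance moves a nonzero value from any chart into one of the finitely many
      compact pieces, and rescaling to unit vectors changes it by a positive factor only.\<close>
    have cover: "\<exists>p v' a' k. p \<in> P \<and> norm v' = 1 \<and> norm a' = 1 \<and> 0 < k \<and> ((coord (cc p) q, t), v', a') \<in> Q p \<and>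
        PHI c (\<delta> t) (coord c q, t) v a = k * PHI (cc p) (\<delta> t) (coord (cc p) q, t) v' a'"
      if c: "c \<in> A" and q: "q \<in> dom_of c" and t: "0 \<le> t" "t \<le> T" and nz: "PHI c (\<delta> t) (coord c q, t) v a \<noteq> 0"
      for c q t v a
    proof -
      obtain p where p: "p \<in> P" "q \<in> Op p" using P(2) by blast
      then have "q \<in> dom_of c \<inter> dom_of (cc p)" using q by (simp add: Op_def)
      from PHI_transition[OF c cc(1) this time[OF t]] obtain v' a' where
        va: "PHI c (\<delta> t) (coord c q, t) v a = PHI (cc p) (\<delta> t) (coord (cc p) q, t) v' a'" by blast
      with PHI_unit[OF cc(1)[of p], of "\<delta> t" "(coord (cc p) q, t)" v' a'] nz obtain v'' a'' k where
        "norm v'' = 1" "norm a'' = 1" "0 < k"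
        "PHI (cc p) (\<delta> t) (coord (cc p) q, t) v' a' = k * PHI (cc p) (\<delta> t) (coord (cc p) q, t) v'' a''" by auto
      moreover from this have "((coord (cc p) q, t), v'', a'') \<in> Q p"
        using p(2) t by (auto simp: Q_def Op_def)
      ultimately show ?thesis using p(1) va by auto
    qed
    have TS_ne: "TS \<noteq> {}"
    proof -
      obtain p v' a' k where p: "p \<in> P" "0 < k" "((coord (cc p) p1, T), v', a') \<in> Q p"
        "PHI c1 (\<delta> T) (coord c1 p1, T) v1 a1 = k * PHI (cc p) (\<delta> T) (coord (cc p) p1, T) v' a'"
        using cover[OF bad(1,2), of T v1 a1] bad1 T(1) by auto
      then have "PHI (cc p) (\<delta> T) (coord (cc p) p1, T) v' a' \<le> 0"
        using bad1 p(2) by (auto simp: p(4) mult_less_0_iff)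
      then have "((coord (cc p) p1, T), v', a') \<in> B p" using p(3) by (simp add: B_def)
      then show ?thesis using p(1) unfolding TS_def by blast
    qed
    obtain t0 where t0: "t0 \<in> TS" "\<And>t. t \<in> TS \<Longrightarrow> t0 \<le> t"
      using compact_attains_inf[OF TS_compact[folded TS_def] TS_ne] by blast
    from t0(1) obtain p z v a where p: "p \<in> P" and zB: "((z, t0), v, a) \<in> B p"
      unfolding TS_def by auto
    then have zQ: "((z, t0), v, a) \<in> Q p" and z0: "PHI (cc p) (\<delta> t0) (z, t0) v a \<le> 0"
      by (auto simp: B_def)
    have t0T: "0 \<le> t0" "t0 \<le> T" using zQ by (auto simp: Q_def)
    have zU: "z \<in> Uc (cc p)" using zQ cc(4)[of p] by (auto simp: Q_def)
    have before: "0 \<le> PHI c (\<delta> t) (coord c q, t) v a"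
      if c: "c \<in> A" and q: "q \<in> dom_of c" and t: "0 \<le> t" "t < t0" for c q t v a
    proof (rule ccontr)
      assume neg: "\<not> ?thesis"
      then obtain p v' a' k where p: "p \<in> P" "0 < k" "((coord (cc p) q, t), v', a') \<in> Q p"
        "PHI c (\<delta> t) (coord c q, t) v a = k * PHI (cc p) (\<delta> t) (coord (cc p) q, t) v' a'"
        using cover[OF c q t(1), of v a] t t0T by auto
      have "PHI (cc p) (\<delta> t) (coord (cc p) q, t) v' a' \<le> 0"
        using neg p(2) by (auto simp: p(4) not_le mult_less_0_iff)
      then have "((coord (cc p) q, t), v', a') \<in> B p" using p(3) by (simp add: B_def)
      then have "t \<in> TS" using p(1) unfolding TS_def by force
      from t0(2)[OF this] t show False by simp
    qed
    \<comment> \<open>At time 0 the curvature part is non-negative by hypothesis and the barrier is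
      strictly positive on nonzero vectors.\<close>
    have t0pos: "0 < t0"
    proof (rule ccontr)
      assume "\<not> 0 < t0"
      then have [simp]: "t0 = 0" using t0T by simp
      interpret F: herm_family "Uc (cc p)" \<tau> "Gc (cc p)" by (rule Gc_family[OF cc(1)])
      have x: "(z, 0) \<in> F.D0" using zU time[of 0] T(1) by simp
      have nz: "v \<noteq> 0" "a \<noteq> 0" using zQ by (auto simp: Q_def)
      have "0 \<le> PHI (cc p) 0 (coord (cc p) (chart_inv (cc p) z), 0) v a"
        using init chart_facts(5)[OF cc(1) zU] cc(1) unfolding griffiths_iff[OF time[OF order_refl less_imp_le[OF T(1)]]] by blast
      then have "0 \<le> PHI (cc p) 0 (z, 0) v a" using chart_facts(6)[OF cc(1) zU] by simp
      moreover have "PHI (cc p) (\<delta> 0) (z, 0) v a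
         = PHI (cc p) 0 (z, 0) v a + \<delta> 0 * (Re (F.gf (z, 0) v) * Re (qf (mx (Gc (cc p)) (z, 0)) a a))"
        unfolding PHI_def F.Phi_def F.qf_real_mult[OF F.gf_real[OF x]] by simp
      moreover have "0 < \<delta> 0 * (Re (F.gf (z, 0) v) * Re (qf (mx (Gc (cc p)) (z, 0)) a a))"
        by (intro mult_pos_pos \<delta>pos F.gf_pos[OF x nz(1)] F.G_pos[OF x nz(2)])
      ultimately show False using z0 by simp
    qed
    \<comment> \<open>Minimality of t0 speaks of strictly earlier times; the time t0 itself is added
      by continuity.\<close>
    have upto: "0 \<le> PHI c (\<delta> s) (z', s) v' a'" if c: "c \<in> A" and s: "0 \<le> s" "s \<le> t0" and z': "z' \<in> Uc c" for c s z' v' a'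
    proof -
      have b: "0 \<le> PHI c (\<delta> s) (z', s) v' a'" if "0 \<le> s" "s < t0" for s
        using before[OF c chart_facts(5)[OF c z'] that, of v' a'] chart_facts(6)[OF c z'] by simp
      have "continuous_on {0..t0} (\<lambda>s. PHI c (\<delta> s) (z', s) v' a')"
      proof -
        have "continuous_on {0..t0} (\<lambda>s. (\<lambda>(x, v, a). PHI c (\<delta> (snd x)) x v a) ((z', s), v', a'))"
          by (rule continuous_on_compose2[OF contPHI[OF c]]) (use z' time t0T in \<open>auto intro!: continuous_intros\<close>)
        then show ?thesis by simp
      qed
      moreover have cl: "closure {0..<t0} = {0..t0}" using t0pos by simp
      ultimately have "continuous_on (closure {0..<t0}) (\<lambda>s. PHI c (\<delta> s) (z', s) v' a')" by simp
      from continuous_ge_on_closure[OF this, of s 0] show ?thesis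
        using b s unfolding cl by auto
    qed
    have "PHI (cc p) (\<delta> t0) (z, t0) v a = 0"
      using upto[OF cc(1) t0T(1) order_refl zU, of v a] z0 by simp
    \<comment> \<open>Non-negativity is known on the whole chart, so any radius serves for the local
      condition in \<open>good\<close>; it is taken to be 1.\<close>
    moreover have "PHI (cc p) (\<epsilon> * exp (C * t0)) (z, t0) v a \<noteq> 0"
    proof (rule C0[OF CP[OF p], unfolded good_def, rule_format, OF \<epsilon> zQ t0pos _ zero_less_one])
      show "\<epsilon> * exp (C * t0) \<le> 1" using \<delta>1[OF t0T(2)] by (simp add: \<delta>_def)
      fix s z' v' a'
      assume "0 \<le> s" "s \<le> t0" "z' \<in> Uc (cc p)"
      then show "0 \<le> PHI (cc p) (\<epsilon> * exp (C * s)) (z', s) v' a'"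
        using upto[OF cc(1)[of p]] unfolding \<delta>_def by blast
    qed
    ultimately show False unfolding \<delta>_def by simp
  qed
qed

end

theorem mainTheorem7:
  fixes A :: "('a::{t2_space, second_countable_topology}, 'n::finite) chart set"
    and g :: "real \<Rightarrow> ('a, 'n) form_field"
    and \<tau> :: ereal
  assumes "compact (UNIV :: 'a set)"
    and "complex_atlas A"
    and "0 < \<tau>"
    and "HCF_solution A \<tau> g"
    and "griffiths_nonneg A (g 0)"
  shows "\<forall>t::real. 0 < t \<and> ereal t < \<tau> \<longrightarrow> griffiths_nonneg A (g t)"
proof -
  interpret hcf A g \<tau> by (rule hcf.intro) (rule assms)+
  show ?thesis using griffiths_preserved[OF assms(1,5)] by blast
qed

end
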